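(* Let $\ell>-2$ be real, let $\Omega\subseteq\overline{\mathbb R^{n+1}_+}$ be a backward time connected domain, and let $f=f(x,t)$ be a function defined on $\Omega$. Let $(x_0,t_0)\in\Omega$ with $t_0>0$, and let $U_{x_0}\subseteq\mathbb R^n$ be a neighborhood of $x_0$ with $U_{x_0}\times(0,t_0)\subseteq\Omega$. Suppose that the function $w(x,r;b)\in C^{m,2,0}_{x,r,t}(U_{x_0}\times[0,\phi(t_0)]\times[0,t_0])$ (the third variable being $b$) satisfies $$w_{rr}-A(x,\partial_x)w=0\ \text{ in } U_{x_0}\ \text{ for all } r\in(0,|\phi(t_0)-\phi(b)|),\qquad w(x,0;b)=f(x,b)\ \text{ in } U_{x_0},$$ for all $b\in(0,t_0)$. Then the function $$u(x,t)=c_\ell\int_0^t db\int_0^{|\phi(t)-\phi(b)|}\left((\phi(t)+\phi(b))^2-r^2\right)^{-\gamma}F\left(\gamma,\gamma;1;\frac{(\phi(t)-\phi(b))^2-r^2}{(\phi(t)+\phi(b))^2-r^2}\right)w(x,r;b)\,dr,$$ defined on $U_{x_0}\times[0,t_0)$, is continuous on $U_{x_0}\times[0,t_0)$ and satisfies $$u_{tt}-t^\ell A(x,\partial_x)u=f(x,t)+c_\ell(\phi'(t))^2\int_0^t(\phi(t)+\phi(b))^{-2\gamma}F\left(\gamma,\gamma;1;\frac{(\phi(t)-\phi(b))^2}{(\phi(t)+\phi(b))^2}\right)w_r(x,0;b)\,db$$ in the sense of distributions $\mathcal D'(U_{x_0}\times(0,t_0))$. Moreover $u(x,0)=0$ for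 all $x\in U_{x_0}$. If, additionally, $\ell<4$, then $u_t$ is continuous on $U_{x_0}\times[0,t_0)$ and $u_t(x,0)=0$ for all $x\in U_{x_0}$.
   Context: $\mathbb R^{n+1}_+=\{(x,t): x\in\mathbb R^n,\ t>0\}$. A set $\Omega\subseteq\overline{\mathbb R^{n+1}_+}$ is backward time (line-)connected (to $t=0$) if for every $(x,t)\in\Omega$ the segment $\{(x,s): s\in(0,t]\}$ is contained in $\Omega$. A domain is a connected (relatively) open set. $A(x,\partial_x)=\sum_{|\alpha|\le m}a_\alpha(x)\partial_x^\alpha$ is a linear partial differential operator of order $m$ in $x$ with $C^\infty$ coefficients on the projection of $\Omega$ to $\mathbb R^n$. $\phi(t)=\frac{2}{\ell+2}t^{(\ell+2)/2}$, $\gamma=\frac{\ell}{2(\ell+2)}$, $c_\ell=\left(\frac{\ell+2}{4}\right)^{-\ell/(\ell+2)}$. $F(a,b;c;z)$ is Gauss's hypergeometric function. $C^{m,2,0}_{x,r,t}$ denotes functions that are continuous together with their partial derivatives up to order $m$ in the first variable $x$, up to order $2$ in the second variable $r$, and merely continuous in the third variable (here $b$), up to the closed endpoints of the intervals. *)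

theory Defs
  imports "HOL-Analysis.Analysis"
begin

subsection \<open>Partial derivatives and differentiability classes\<close>

definition partial_deriv ::
    "'a::real_normed_vector \<Rightarrow> ('a \<Rightarrow> 'b::real_normed_vector) \<Rightarrow> 'a \<Rightarrow> 'b" where
  "partial_deriv v g x = vector_derivative (\<lambda>s. g (x + s *\<^sub>R v)) (at 0)"

definition partial_derivs ::
    "'a::real_normed_vector list \<Rightarrow> ('a \<Rightarrow> 'b::real_normed_vector) \<Rightarrow> 'a \<Rightarrow> 'b" where
  "partial_derivs vs g = foldr partial_deriv vs g"

text \<open>\<open>C^k\<close> on an open set: every iterated partial derivative of order at most \<open>k\<close>, taken in any
  order of the coordinate directions, exists and is continuous.\<close>

definition Ck_on :: "nat \<Rightarrow> 'a::euclidean_space set \<Rightarrow> ('a \<Rightarrow> 'b::real_normed_vector) \<Rightarrow> bool" where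
  "Ck_on k S g \<longleftrightarrow>
     (\<forall>vs. set vs \<subseteq> Basis \<and> length vs \<le> k \<longrightarrow> continuous_on S (partial_derivs vs g)) \<and>
     (\<forall>vs. set vs \<subseteq> Basis \<and> length vs < k \<longrightarrow>
        (\<forall>v\<in>Basis. \<forall>x\<in>S. (\<lambda>s. partial_derivs vs g (x + s *\<^sub>R v)) differentiable at 0))"

definition smooth_on :: "'a::euclidean_space set \<Rightarrow> ('a \<Rightarrow> 'b::real_normed_vector) \<Rightarrow> bool" where
  "smooth_on S g \<longleftrightarrow> (\<forall>k. Ck_on k S g)"

text \<open>A multi-index is a function \<open>\<alpha> :: 'n \<Rightarrow> nat\<close>. The corresponding derivative is taken along some
  list of indices containing each \<open>i\<close> exactly \<open>\<alpha> i\<close> times; for \<open>C^|\<alpha>|\<close> functions the choice of the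
  list is immaterial by Schwarz's theorem.\<close>

definition mi_list :: "('n::finite \<Rightarrow> nat) \<Rightarrow> 'n list" where
  "mi_list \<alpha> = (SOME xs. \<forall>i. count_list xs i = \<alpha> i)"

definition multi_indices :: "nat \<Rightarrow> ('n::finite \<Rightarrow> nat) set" where
  "multi_indices m = {\<alpha>. (\<Sum>i\<in>UNIV. \<alpha> i) \<le> m}"

definition pdo ::
    "nat \<Rightarrow> (('n::finite \<Rightarrow> nat) \<Rightarrow> real ^ 'n \<Rightarrow> complex) \<Rightarrow> (real ^ 'n \<Rightarrow> complex) \<Rightarrow> real ^ 'n \<Rightarrow> complex"
  where
  "pdo m a g x =
     (\<Sum>\<alpha>\<in>multi_indices m. a \<alpha> x * partial_derivs (map (\<lambda>i. axis i 1) (mi_list \<alpha>)) g x)"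

text \<open>Derivative in the second variable \<open>r \<in> [0,R]\<close>, one-sided at the endpoints.\<close>

definition d_r ::
    "real \<Rightarrow> ('x \<Rightarrow> real \<Rightarrow> real \<Rightarrow> complex) \<Rightarrow> 'x \<Rightarrow> real \<Rightarrow> real \<Rightarrow> complex" where
  "d_r R w x r b = vector_derivative (\<lambda>s. w x s b) (at r within {0..R})"

text \<open>The class \<open>C^{m,2,0}\<close> on \<open>U \<times> [0,R] \<times> [0,T]\<close>. Continuity is joint in the three variables;
  only pure derivatives in \<open>x\<close> and pure derivatives in \<open>r\<close> are required, no mixed ones.\<close>

definition C_m_2_0_on ::
    "nat \<Rightarrow> 'a::euclidean_space set \<Rightarrow> real \<Rightarrow> real \<Rightarrow> ('a \<Rightarrow> real \<Rightarrow> real \<Rightarrow> complex) \<Rightarrow> bool" where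
  "C_m_2_0_on m U R T w \<longleftrightarrow>
     (\<forall>r\<in>{0..R}. \<forall>b\<in>{0..T}. Ck_on m U (\<lambda>x. w x r b)) \<and>
     (\<forall>vs. set vs \<subseteq> Basis \<and> length vs \<le> m \<longrightarrow>
        continuous_on (U \<times> {0..R} \<times> {0..T}) (\<lambda>(x, r, b). partial_derivs vs (\<lambda>y. w y r b) x)) \<and>
     (\<forall>k<2. \<forall>x\<in>U. \<forall>r\<in>{0..R}. \<forall>b\<in>{0..T}.
        (\<lambda>s. (d_r R ^^ k) w x s b) differentiable at r within {0..R}) \<and>
     (\<forall>k\<le>2. continuous_on (U \<times> {0..R} \<times> {0..T}) (\<lambda>(x, r, b). (d_r R ^^ k) w x r b))"


subsection \<open>Distributions\<close>

definition test_functions :: "'a::euclidean_space set \<Rightarrow> ('a \<Rightarrow> complex) set" where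
  "test_functions W =
     {\<psi>. smooth_on UNIV \<psi> \<and> (\<exists>K. compact K \<and> K \<subseteq> W \<and> (\<forall>z. z \<notin> K \<longrightarrow> \<psi> z = 0))}"

definition locally_integrable :: "'a::euclidean_space set \<Rightarrow> ('a \<Rightarrow> complex) \<Rightarrow> bool" where
  "locally_integrable W g \<longleftrightarrow> (\<forall>K. compact K \<and> K \<subseteq> W \<longrightarrow> set_integrable lborel K g)"

text \<open>Distributions are represented by functionals, of which only the values on
  \<open>test_functions W\<close> matter.\<close>

type_synonym 'a functional = "('a \<Rightarrow> complex) \<Rightarrow> complex"

definition regular_dist :: "'a::euclidean_space set \<Rightarrow> ('a \<Rightarrow> complex) \<Rightarrow> 'a functional" where
  "regular_dist W g \<psi> = (LINT z:W|lborel. g z * \<psi> z)"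

definition dist_deriv :: "'a::euclidean_space \<Rightarrow> 'a functional \<Rightarrow> 'a functional" where
  "dist_deriv v T \<psi> = - T (partial_deriv v \<psi>)"

definition dist_derivs :: "'a::euclidean_space list \<Rightarrow> 'a functional \<Rightarrow> 'a functional" where
  "dist_derivs vs T = foldr dist_deriv vs T"

definition dist_mult :: "('a \<Rightarrow> complex) \<Rightarrow> 'a functional \<Rightarrow> 'a functional" where
  "dist_mult c T \<psi> = T (\<lambda>z. c z * \<psi> z)"

text \<open>\<open>A(x,\<partial>\<^sub>x)\<close> acting on a distribution in \<open>(x,t)\<close>.\<close>

definition dist_pdo ::
    "nat \<Rightarrow> (('n::finite \<Rightarrow> nat) \<Rightarrow> real ^ 'n \<Rightarrow> complex)
     \<Rightarrow> ((real ^ 'n) \<times> real) functional \<Rightarrow> ((real ^ 'n) \<times> real) functional" where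
  "dist_pdo m a T \<psi> =
     (\<Sum>\<alpha>\<in>multi_indices m.
        dist_mult (\<lambda>(x, t). a \<alpha> x)
          (dist_derivs (map (\<lambda>i. (axis i 1, 0)) (mi_list \<alpha>)) T) \<psi>)"


subsection \<open>Domains\<close>

definition half_space :: "((real ^ 'n) \<times> real) set" where
  "half_space = {(x, t). 0 < t}"

definition backward_time_connected :: "((real ^ 'n) \<times> real) set \<Rightarrow> bool" where
  "backward_time_connected \<Omega> \<longleftrightarrow> (\<forall>x t. (x, t) \<in> \<Omega> \<longrightarrow> (\<forall>s\<in>{0<..t}. (x, s) \<in> \<Omega>))"

definition half_space_domain :: "((real ^ 'n) \<times> real) set \<Rightarrow> bool" where
  "half_space_domain \<Omega> \<longleftrightarrow>
     openin (top_of_set (closure half_space)) \<Omega> \<and> connected \<Omega>"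


subsection \<open>The integral transform\<close>

definition \<phi> :: "real \<Rightarrow> real \<Rightarrow> real" where
  "\<phi> l t = 2 / (l + 2) * t powr ((l + 2) / 2)"

definition \<gamma> :: "real \<Rightarrow> real" where
  "\<gamma> l = l / (2 * (l + 2))"

definition c_l :: "real \<Rightarrow> real" where
  "c_l l = ((l + 2) / 4) powr (- l / (l + 2))"

text \<open>Gauss's series. In the integrals below the argument lies in \<open>[0,1)\<close>, except for \<open>b = 0\<close>, a
  null set.\<close>

definition hyp2F1 :: "real \<Rightarrow> real \<Rightarrow> real \<Rightarrow> real \<Rightarrow> real" where
  "hyp2F1 a b c z = eval_fps (fps_hypergeo [a, b] [c] 1) z"

definition kernel :: "real \<Rightarrow> real \<Rightarrow> real \<Rightarrow> real \<Rightarrow> real" where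
  "kernel l t b r =
     ((\<phi> l t + \<phi> l b)\<^sup>2 - r\<^sup>2) powr (- \<gamma> l) *
     hyp2F1 (\<gamma> l) (\<gamma> l) 1
       (((\<phi> l t - \<phi> l b)\<^sup>2 - r\<^sup>2) / ((\<phi> l t + \<phi> l b)\<^sup>2 - r\<^sup>2))"

definition inner_int ::
    "real \<Rightarrow> ('x \<Rightarrow> real \<Rightarrow> real \<Rightarrow> complex) \<Rightarrow> 'x \<Rightarrow> real \<Rightarrow> real \<Rightarrow> complex" where
  "inner_int l w x t b =
     (LINT r:{0..\<bar>\<phi> l t - \<phi> l b\<bar>}|lborel. complex_of_real (kernel l t b r) * w x r b)"

definition sol :: "real \<Rightarrow> ('x \<Rightarrow> real \<Rightarrow> real \<Rightarrow> complex) \<Rightarrow> 'x \<Rightarrow> real \<Rightarrow> complex" where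
  "sol l w x t = complex_of_real (c_l l) * (LINT b:{0..t}|lborel. inner_int l w x t b)"

text \<open>The argument \<open>wr\<close> stands for \<open>w\<^sub>r\<close>.\<close>

definition source_integrand ::
    "real \<Rightarrow> ('x \<Rightarrow> real \<Rightarrow> real \<Rightarrow> complex) \<Rightarrow> 'x \<Rightarrow> real \<Rightarrow> real \<Rightarrow> complex" where
  "source_integrand l wr x t b =
     complex_of_real ((\<phi> l t + \<phi> l b) powr (- 2 * \<gamma> l) *
       hyp2F1 (\<gamma> l) (\<gamma> l) 1 ((\<phi> l t - \<phi> l b)\<^sup>2 / (\<phi> l t + \<phi> l b)\<^sup>2)) * wr x 0 b"

definition source ::
    "real \<Rightarrow> ('x \<Rightarrow> real \<Rightarrow> complex) \<Rightarrow> ('x \<Rightarrow> real \<Rightarrow> real \<Rightarrow> complex) \<Rightarrow> 'x \<Rightarrow> real \<Rightarrow> complex" where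
  "source l f wr x t =
     f x t + complex_of_real (c_l l * (deriv (\<phi> l) t)\<^sup>2) *
       (LINT b:{0..t}|lborel. source_integrand l wr x t b)"

text \<open>The Bochner integral is \<open>0\<close> on non-integrable functions, so convergence of the integrals
  defining \<open>sol\<close> and \<open>source\<close> for \<open>x \<in> U\<close>, \<open>0 \<le> t < t0\<close> is expressed separately.\<close>

definition transform_converges ::
    "real \<Rightarrow> 'x set \<Rightarrow> real \<Rightarrow> real \<Rightarrow> ('x \<Rightarrow> real \<Rightarrow> real \<Rightarrow> complex) \<Rightarrow> bool" where
  "transform_converges l U R t0 w \<longleftrightarrow>
     (\<forall>x\<in>U. \<forall>t\<in>{0..<t0}.
        (\<forall>b\<in>{0<..<t}. set_integrable lborel {0..\<bar>\<phi> l t - \<phi> l b\<bar>}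
           (\<lambda>r. complex_of_real (kernel l t b r) * w x r b)) \<and>
        set_integrable lborel {0..t} (inner_int l w x t) \<and>
        set_integrable lborel {0..t} (source_integrand l (d_r R w) x t))"

end

theory Submission
  imports Defs
begin

text \<open>
  Fix a source time \<open>b > 0\<close> and let \<open>v(x, t; b)\<close> be \<open>c_l\<close> times the integral of kernel times \<open>w(x, r; b)\<close>
  over \<open>0 < r < \<phi>(t) - \<phi>(b)\<close>, so that \<open>u(x, t)\<close> is the integral of \<open>v(x, t; b)\<close> over \<open>0 < b < t\<close>. As a function
  \<open>G\<close> of \<open>p = \<phi>(t)\<close> and \<open>r\<close>, the kernel solves the Euler-Poisson-Darboux equation
  \<open>G\<^sub>p\<^sub>p + (2 \<gamma> / p) G\<^sub>p = G\<^sub>r\<^sub>r\<close> (lemma \<open>euler_poisson_darboux\<close>), by Gauss's differential equation. In the time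
  variable, and with the factor \<open>c_l\<close>, this reads \<open>K\<^sub>t\<^sub>t = t\<^sup>l K\<^sub>r\<^sub>r\<close>; moreover \<open>K = (t b)\<^sup>-\<^sup>l\<^sup>/\<^sup>4\<close> on the
  characteristic \<open>r = \<phi>(t) - \<phi>(b)\<close>. Differentiating \<open>v\<close> twice in \<open>t\<close> and integrating by parts twice in \<open>r\<close>,
  all terms on the characteristic cancel, and what remains (lemma \<open>has_vector_derivative_wave\<close>) is that
  \<open>v\<^sub>t\<^sub>t\<close> equals \<open>t\<^sup>l\<close> times the sum of \<open>K(t, b, 0) w\<^sub>r(x, 0; b)\<close> and the integral of \<open>K w\<^sub>r\<^sub>r\<close>, that
  \<open>v = 0\<close> at \<open>t = b\<close>, and that \<open>v\<^sub>t\<close> tends to \<open>w(x, 0; b) = f(x, b)\<close> there.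

  For \<open>b > 0\<close> the argument of the hypergeometric function stays away from its singularity at \<open>1\<close>, so all this is
  elementary calculus. Therefore the distributional equation is first proved for each single \<open>b\<close>
  (lemma \<open>green_slice\<close>): Green's formula in \<open>t\<close> on \<open>[b, t\<^sub>0)\<close> produces the terms with \<open>f\<close>, \<open>w\<^sub>r(x, 0; b)\<close> and
  \<open>w\<^sub>r\<^sub>r = A w\<close>, and integration by parts in \<open>x\<close> moves \<open>A\<close> to the test function. Integration over \<open>b\<close>
  (lemma \<open>weak_equation\<close>) needs bounds on \<open>v\<close> itself only. They hold for every \<open>l > - 2\<close>: since
  \<open>\<gamma> < 1 / 2\<close>, the hypergeometric function is bounded on \<open>[0, 1)\<close>, and the homogeneity of the kernel gives
  \<open>\<bar>v\<bar> \<le> C t sup \<bar>w\<bar>\<close> (lemma \<open>inner_integral_bound\<close>).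

  For the continuity of \<open>u\<close> one substitutes \<open>b = t s\<close>. Then \<open>u\<close> is \<open>t\<close> times an integral over the fixed interval
  \<open>0 < s < 1\<close>, to which dominated convergence applies, and \<open>u\<close> vanishes at \<open>t = 0\<close>. If \<open>l < 4\<close>, also \<open>v\<^sub>t\<close> is
  dominated by an integrable function of \<open>s\<close>, namely by a multiple of \<open>s\<^sup>-\<^sup>\<kappa>\<close> with \<open>l / 4 < \<kappa> < 1\<close>
  (lemma \<open>V_bound\<close>). So the integral \<open>u\<^sub>t\<close> of \<open>v\<^sub>t\<close> over \<open>b\<close> is continuous and vanishes at \<open>t = 0\<close> for the same
  reasons, and by Fubini's theorem it is the derivative of \<open>u\<close>.
\<close>


section \<open>Iterated partial derivatives and integration by parts\<close>

lemma eventually_in_open_line: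
  fixes x v :: "'a::real_normed_vector"
  assumes "open S" "x \<in> S"
  shows "\<forall>\<^sub>F s in nhds (0::real). x + s *\<^sub>R v \<in> S"
proof -
  have "((\<lambda>s. x + s *\<^sub>R v) \<longlongrightarrow> x + 0 *\<^sub>R v) (nhds (0::real))"
    by (intro tendsto_intros filterlim_ident)
  then show ?thesis using topological_tendstoD assms by fastforce
qed

lemma line_cong:
  fixes x v :: "'a::real_normed_vector"
  assumes "open S" "x \<in> S" "\<And>y. y \<in> S \<Longrightarrow> f y = g y"
  shows "partial_deriv v f x = partial_deriv v g x"
    "((\<lambda>s. f (x + s *\<^sub>R v)) has_vector_derivative D) (at 0) \<longleftrightarrow>
     ((\<lambda>s. g (x + s *\<^sub>R v)) has_vector_derivative D) (at 0)"
proof -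
  have ev: "\<forall>\<^sub>F s in nhds (0::real). f (x + s *\<^sub>R v) = g (x + s *\<^sub>R v)"
    using eventually_in_open_line[OF assms(1,2), of v] by (rule eventually_mono) (use assms(3) in simp)
  show "partial_deriv v f x = partial_deriv v g x"
    unfolding partial_deriv_def by (rule vector_derivative_cong_eq) (use ev in auto)
  show "((\<lambda>s. f (x + s *\<^sub>R v)) has_vector_derivative D) (at 0) \<longleftrightarrow>
     ((\<lambda>s. g (x + s *\<^sub>R v)) has_vector_derivative D) (at 0)"
    by (rule has_vector_derivative_cong_ev) (use ev assms in auto)
qed

lemma has_partial_deriv:
  "(\<lambda>s. f (x + s *\<^sub>R v)) differentiable (at 0) \<Longrightarrow>
    ((\<lambda>s. f (x + s *\<^sub>R v)) has_vector_derivative partial_deriv v f x) (at 0)"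
  unfolding partial_deriv_def by (simp add: vector_derivative_works)

lemma partial_deriv_eqI:
  "((\<lambda>s. f (x + s *\<^sub>R v)) has_vector_derivative D) (at 0) \<Longrightarrow> partial_deriv v f x = D"
  unfolding partial_deriv_def by (rule vector_derivative_at)

lemma partial_derivs_simps:
  "partial_derivs [] f = f"
  "partial_derivs (v # vs) f = partial_deriv v (partial_derivs vs f)"
  "partial_derivs (vs @ [v]) f = partial_derivs vs (partial_deriv v f)"
  by (simp_all add: partial_derivs_def)

lemma Ck_on_0: "Ck_on 0 S f \<longleftrightarrow> continuous_on S f"
  by (simp add: Ck_on_def partial_derivs_simps)

text \<open>Splitting off the innermost derivative turns the definition, which speaks of lists of directions, into
  a recursion on the order; the sum and product rules are inductions along it.\<close>

lemma Ck_on_Suc: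
  fixes f :: "'a::euclidean_space \<Rightarrow> 'b::real_normed_vector"
  shows
  "Ck_on (Suc k) S f \<longleftrightarrow> continuous_on S f \<and>
    (\<forall>v\<in>Basis. (\<forall>x\<in>S. (\<lambda>s. f (x + s *\<^sub>R v)) differentiable (at 0)) \<and> Ck_on k S (partial_deriv v f))"
  (is "?L \<longleftrightarrow> ?R")
proof
  assume L: ?L
  show ?R
  proof (intro conjI ballI)
    show "continuous_on S f"
      using L unfolding Ck_on_def by (auto simp: partial_derivs_simps dest: spec[of _ "[]"])
    fix v :: 'a assume v: "v \<in> Basis"
    show "(\<lambda>s. f (x + s *\<^sub>R v)) differentiable (at 0)" if "x \<in> S" for x
      using L v that unfolding Ck_on_def by (auto simp: partial_derivs_simps dest: spec[of _ "[]"])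
    show "Ck_on k S (partial_deriv v f)"
      unfolding Ck_on_def partial_derivs_simps(3)[symmetric]
      using L[unfolded Ck_on_def] v by fastforce
  qed
next
  assume R: ?R
  show ?L
    unfolding Ck_on_def
  proof (intro conjI allI impI ballI)
    fix vs :: "'a list" assume vs: "set vs \<subseteq> Basis \<and> length vs \<le> Suc k"
    show "continuous_on S (partial_derivs vs f)"
    proof (cases vs rule: rev_cases)
      case (snoc us v)
      then show ?thesis using R vs by (auto simp: partial_derivs_simps Ck_on_def)
    qed (use R in \<open>simp add: partial_derivs_simps\<close>)
  next
    fix vs :: "'a list" and v x :: 'a assume vs: "set vs \<subseteq> Basis \<and> length vs < Suc k" "v \<in> (Basis :: 'a set)" "x \<in> S"
    show "(\<lambda>s. partial_derivs vs f (x + s *\<^sub>R v)) differentiable (at 0)"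
    proof (cases vs rule: rev_cases)
      case (snoc us u)
      then show ?thesis using R vs by (auto simp: partial_derivs_simps Ck_on_def)
    qed (use R vs in \<open>simp add: partial_derivs_simps\<close>)
  qed
qed

lemma Ck_on_le: "Ck_on k S f \<Longrightarrow> j \<le> k \<Longrightarrow> Ck_on j S f"
  unfolding Ck_on_def by auto

lemma Ck_on_subset: "Ck_on k S f \<Longrightarrow> T \<subseteq> S \<Longrightarrow> Ck_on k T f"
  unfolding Ck_on_def by (meson continuous_on_subset subset_iff)

lemma Ck_on_imp_continuous: "Ck_on k S f \<Longrightarrow> continuous_on S f"
  using Ck_on_le[of k S f 0] by (simp add: Ck_on_0)

text \<open>The product and sum rules are identities on \<open>S\<close> only, since nothing is known about the iterated
  derivatives elsewhere. As \<open>S\<close> is open, agreement on \<open>S\<close> is enough to transfer regularity.\<close>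

lemma Ck_on_cong:
  assumes "open S" "\<And>x. x \<in> S \<Longrightarrow> f x = g x" "Ck_on k S f"
  shows "Ck_on k S g"
  using assms(2,3)
proof (induction k arbitrary: f g)
  case 0
  then show ?case using continuous_on_cong[of S S f g] by (simp add: Ck_on_0)
next
  case (Suc k)
  have c: "continuous_on S g"
    using Suc.prems continuous_on_cong[of S S f g] by (simp add: Ck_on_Suc)
  have "(\<lambda>s. g (x + s *\<^sub>R v)) differentiable (at 0)" if "v \<in> Basis" "x \<in> S" for v x
    using Suc.prems(2) that line_cong(2)[where f = f and g = g and v = v, OF assms(1) that(2) Suc.prems(1)]
    by (auto simp: Ck_on_Suc intro: differentiableI_vector dest!: has_partial_deriv)
  moreover have "Ck_on k S (partial_deriv v g)" if "v \<in> Basis" for v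
    by (rule Suc.IH[of "partial_deriv v f"])
      (use Suc.prems that line_cong(1)[where f = f and g = g, OF assms(1) _ Suc.prems(1)] in \<open>auto simp: Ck_on_Suc\<close>)
  ultimately show ?case using c by (auto simp: Ck_on_Suc)
qed

lemma Ck_on_add:
  fixes f g :: "'a::euclidean_space \<Rightarrow> 'b::real_normed_vector"
  assumes "open S" "Ck_on k S f" "Ck_on k S g"
  shows "Ck_on k S (\<lambda>x. f x + g x)"
  using assms(2,3)
proof (induction k arbitrary: f g)
  case 0
  then show ?case by (auto simp: Ck_on_0 intro: continuous_intros)
next
  case (Suc k)
  have D: "((\<lambda>s. f (x + s *\<^sub>R v) + g (x + s *\<^sub>R v)) has_vector_derivative
      (partial_deriv v f x + partial_deriv v g x)) (at 0)" if "v \<in> Basis" "x \<in> S" for v x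
    using Suc.prems that by (intro has_vector_derivative_add has_partial_deriv) (auto simp: Ck_on_Suc)
  have "Ck_on k S (partial_deriv v (\<lambda>x. f x + g x))" if "v \<in> Basis" for v
    by (rule Ck_on_cong[OF assms(1) _ Suc.IH[of "partial_deriv v f" "partial_deriv v g"]])
      (use Suc.prems that in \<open>auto simp: Ck_on_Suc partial_deriv_eqI[where f = "\<lambda>x. f x + g x", OF D]\<close>)
  then show ?case
    using Suc.prems D by (auto simp: Ck_on_Suc intro: continuous_intros differentiableI_vector)
qed

lemma Ck_on_mult:
  fixes f g :: "'a::euclidean_space \<Rightarrow> 'b::real_normed_algebra"
  assumes "open S" "Ck_on k S f" "Ck_on k S g"
  shows "Ck_on k S (\<lambda>x. f x * g x)"
  using assms(2,3)
proof (induction k arbitrary: f g)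
  case 0
  then show ?case by (auto simp: Ck_on_0 intro: continuous_intros)
next
  case (Suc k)
  have D: "((\<lambda>s. f (x + s *\<^sub>R v) * g (x + s *\<^sub>R v)) has_vector_derivative
      (f x * partial_deriv v g x + partial_deriv v f x * g x)) (at 0)" if "v \<in> Basis" "x \<in> S" for v x
    using has_vector_derivative_mult[OF has_partial_deriv[of f x v] has_partial_deriv[of g x v]]
      Suc.prems that by (simp add: Ck_on_Suc)
  have k: "Ck_on k S f" "Ck_on k S g"
    using Suc.prems Ck_on_le[of "Suc k" S _ k] by auto
  have "Ck_on k S (partial_deriv v (\<lambda>x. f x * g x))" if "v \<in> Basis" for v
    by (rule Ck_on_cong[OF assms(1) _ Ck_on_add[OF assms(1) Suc.IH[of f "partial_deriv v g"] Suc.IH[of "partial_deriv v f" g]]])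
      (use Suc.prems k that in \<open>auto simp: Ck_on_Suc partial_deriv_eqI[where f = "\<lambda>x. f x * g x", OF D]\<close>)
  then show ?case
    using Suc.prems D by (auto simp: Ck_on_Suc intro: continuous_intros differentiableI_vector)
qed

lemma Ck_on_zero: "Ck_on k S (\<lambda>x. 0)"
proof -
  have pd: "partial_deriv v (\<lambda>x. 0) = (\<lambda>x. 0)" for v :: 'a
    by (simp add: partial_deriv_def fun_eq_iff)
  show ?thesis
    by (induction k) (auto simp: Ck_on_0 Ck_on_Suc pd)
qed

lemma Ck_on_Un: "open S \<Longrightarrow> open T \<Longrightarrow> Ck_on k S f \<Longrightarrow> Ck_on k T f \<Longrightarrow> Ck_on k (S \<union> T) f"
  unfolding Ck_on_def by (auto intro: continuous_on_open_Un)

text \<open>Off the closed set \<open>C\<close> the function is locally \<open>0\<close>, and \<open>C\<^sup>k\<close> regularity is a local property.\<close>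

lemma Ck_on_extend_zero:
  assumes "open S" "closed C" "C \<subseteq> S" "Ck_on k S f" "\<And>x. x \<notin> C \<Longrightarrow> f x = 0"
  shows "Ck_on k UNIV f"
proof -
  have "Ck_on k (- C) f"
    by (rule Ck_on_cong[OF _ _ Ck_on_zero]) (use assms in auto)
  then have "Ck_on k (S \<union> - C) f"
    using assms by (intro Ck_on_Un) auto
  moreover have "S \<union> - C = UNIV" using assms(3) by auto
  ultimately show ?thesis by simp
qed

lemma partial_derivs_eq_0:
  assumes "closed C" "\<And>x. x \<notin> C \<Longrightarrow> f x = 0" "x \<notin> C"
  shows "partial_derivs vs f x = 0"
  using assms(3)
proof (induction vs arbitrary: x)
  case (Cons v vs)
  have "partial_deriv v (partial_derivs vs f) x = partial_deriv v (\<lambda>x. 0) x"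
    by (rule line_cong(1)[of "- C"]) (use assms(1) Cons in auto)
  then show ?case by (simp add: partial_derivs_simps) (simp add: partial_deriv_def)
qed (use assms in \<open>simp add: partial_derivs_simps\<close>)

lemma Ck_on_fst:
  fixes f :: "'a::euclidean_space \<Rightarrow> 'b::real_normed_vector"
  assumes "Ck_on k S f"
  shows "Ck_on k (S \<times> (UNIV :: 'c::euclidean_space set)) (\<lambda>z. f (fst z))"
  using assms
proof (induction k arbitrary: f)
  case 0
  then show ?case by (auto simp: Ck_on_0 intro!: continuous_on_compose2[of S f] continuous_intros)
next
  case (Suc k)
  have c: "continuous_on (S \<times> (UNIV :: 'c set)) (\<lambda>z. f (fst z))"
    using Suc.prems by (auto simp: Ck_on_Suc intro!: continuous_on_compose2[of S f] continuous_intros)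
  have e: "partial_deriv (u, 0 :: 'c) (\<lambda>z. f (fst z)) = (\<lambda>z. partial_deriv u f (fst z))"
    "partial_deriv (0, w :: 'c) (\<lambda>z. f (fst z)) = (\<lambda>z. 0)" for u w
    by (simp_all add: partial_deriv_def fun_eq_iff)
  show ?case
    using Suc.prems Suc.IH c Ck_on_zero
    by (auto simp: Ck_on_Suc Basis_prod_def e)
qed

lemma partial_derivs_slice:
  "partial_derivs (map (\<lambda>v. (v, 0)) vs) f (x, t) = partial_derivs vs (\<lambda>y. f (y, t)) x"
  by (induction vs arbitrary: x) (simp_all add: partial_derivs_simps partial_deriv_def)

lemma Ck_on_slice:
  fixes f :: "'a::euclidean_space \<times> 'c::euclidean_space \<Rightarrow> 'b::real_normed_vector"
  assumes "Ck_on k UNIV f"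
  shows "Ck_on k UNIV (\<lambda>x. f (x, t))" 
  using assms
proof (induction k arbitrary: f)
  case 0
  then show ?case by (auto simp: Ck_on_0 intro!: continuous_on_compose2[of UNIV f] continuous_intros)
next
  case (Suc k)
  have e: "partial_deriv u (\<lambda>x. f (x, t)) = (\<lambda>x. partial_deriv (u, 0) f (x, t))" for u
    by (simp add: partial_deriv_def fun_eq_iff)
  have B: "(u, 0::'c) \<in> Basis" if "u \<in> Basis" for u :: 'a using that by (auto simp: Basis_prod_def)
  have "(\<lambda>s. f (x + s *\<^sub>R u, t)) differentiable (at 0)" if "u \<in> Basis" for u x
  proof -
    have "(\<lambda>s. f ((x, t) + s *\<^sub>R (u, 0))) differentiable (at 0)"
      using Suc.prems B[OF that] unfolding Ck_on_Suc by blast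
    then show ?thesis by simp
  qed
  moreover have "continuous_on UNIV (\<lambda>x. f (x, t))"
    using Suc.prems by (auto simp: Ck_on_Suc intro!: continuous_on_compose2[of UNIV f] continuous_intros)
  ultimately show ?case
    using Suc.IH Suc.prems B by (simp add: Ck_on_Suc e)
qed

lemma continuous_on_extend_zero:
  fixes f :: "'a::t2_space \<Rightarrow> 'b::real_normed_vector"
  assumes "open S" "compact C" "C \<subseteq> S" "continuous_on S f" "\<And>x. x \<notin> C \<Longrightarrow> f x = 0"
  shows "continuous_on UNIV f"
proof -
  have "continuous_on (- C) f"
    by (rule continuous_on_eq[OF continuous_on_const[of _ 0]]) (use assms in auto)
  moreover have "open (- C)" using assms(2) by (simp add: compact_imp_closed open_Compl)
  ultimately have "continuous_on (S \<union> - C) f"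
    using assms by (intro continuous_on_open_Un) auto
  moreover have "S \<union> - C = UNIV" using assms(3) by auto
  ultimately show ?thesis by simp
qed

lemma has_vector_derivative_shift:
  fixes f :: "real \<Rightarrow> 'b::real_normed_vector"
  assumes "((\<lambda>s. f (t + s)) has_vector_derivative D) (at 0)"
  shows "(f has_vector_derivative D) (at t)"
proof -
  have "((\<lambda>u. u - t) has_vector_derivative 1) (at t)"
    unfolding has_real_derivative_iff_has_vector_derivative[symmetric]
    by (auto intro!: derivative_eq_intros)
  moreover have "((\<lambda>s. f (t + s)) has_vector_derivative D) (at (t - t))" using assms by simp
  ultimately have "((\<lambda>s. f (t + s)) \<circ> (\<lambda>u. u - t) has_vector_derivative 1 *\<^sub>R D) (at t)"
    by (rule vector_diff_chain_at)
  then show ?thesis by (simp add: o_def)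
qed

lemma integral_lborel_translate:
  fixes f :: "'a::euclidean_space \<Rightarrow> 'b::{banach, second_countable_topology}"
  assumes [measurable]: "f \<in> borel_measurable borel"
  shows "(LBINT x. f (x + c)) = (LBINT x. f x)"
proof -
  have "(LBINT x. f x) = (\<integral>x. f x \<partial>distr lborel borel ((+) c))"
    by (simp add: lborel_distr_plus)
  also have "\<dots> = (LBINT x. f (c + x))"
    by (rule integral_distr) auto
  finally show ?thesis by (simp add: add.commute)
qed

lemma integrable_continuous_compact_support:
  fixes f :: "'a::euclidean_space \<Rightarrow> 'b::{banach, second_countable_topology}"
  assumes "compact C" "continuous_on C f" "\<And>x. x \<notin> C \<Longrightarrow> f x = 0"
  shows "integrable lborel f"
proof -
  have "integrable lborel (\<lambda>x. indicator C x *\<^sub>R f x)"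
    by (rule borel_integrable_compact) (use assms in auto)
  moreover have "(\<lambda>x. indicator C x *\<^sub>R f x) = f"
    using assms(3) by (auto simp: fun_eq_iff indicator_def)
  ultimately show ?thesis by simp
qed

text \<open>Integrating \<open>f (x + v) - f x = \<integral>\<^sub>0\<^sup>1 f'(x + s v) ds\<close> over the whole space gives \<open>0\<close> on the left by
  translation invariance and \<open>\<integral> f'\<close> on the right by Fubini.\<close>

lemma integral_directional_derivative_eq_0:
  fixes f :: "'a::euclidean_space \<Rightarrow> complex"
  assumes C: "compact C" "\<And>x. x \<notin> C \<Longrightarrow> f x = 0" "\<And>x. x \<notin> C \<Longrightarrow> f' x = 0"
    and d: "\<And>x. ((\<lambda>s. f (x + s *\<^sub>R v)) has_vector_derivative f' x) (at 0)"
    and c: "continuous_on UNIV f" "continuous_on UNIV f'"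
  shows "(LBINT x. f' x) = 0"
proof -
  have [measurable]: "f \<in> borel_measurable borel" "f' \<in> borel_measurable borel"
    using c by (auto intro: borel_measurable_continuous_onI)
  have d': "((\<lambda>s. f (x + s *\<^sub>R v)) has_vector_derivative f' (x + s *\<^sub>R v)) (at s)" for x s
    by (rule has_vector_derivative_shift) (use d[of "x + s *\<^sub>R v"] in \<open>simp add: algebra_simps\<close>)
  let ?F = "\<lambda>(x, s). indicator {0..1::real} s *\<^sub>R f' (x + s *\<^sub>R v)"
  have ftc: "(LBINT s. ?F (x, s)) = f (x + v) - f x" for x
  proof -
    have "(LBINT s. indicator {0..1} s *\<^sub>R f' (x + s *\<^sub>R v)) = f (x + 1 *\<^sub>R v) - f (x + 0 *\<^sub>R v)"
      by (rule integral_FTC_atLeastAtMost)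
        (auto intro!: has_vector_derivative_at_within[OF d'] continuous_on_compose2[OF c(2)] continuous_intros)
    then show ?thesis by simp
  qed
  have inner: "(LBINT x. ?F (x, s)) = indicator {0..1} s *\<^sub>R (LBINT x. f' x)" for s
    using integral_lborel_translate[of f' "s *\<^sub>R v"] by simp
  have int: "integrable (lborel \<Otimes>\<^sub>M lborel) ?F"
  proof -
    let ?C = "(\<lambda>(y, s). (y - s *\<^sub>R v, s)) ` (C \<times> {0..1::real})"
    have "compact ?C"
      by (intro compact_continuous_image compact_Times C compact_Icc)
        (auto simp: split_beta intro!: continuous_intros)
    moreover have "?F z = 0" if "z \<notin> ?C" for z
    proof (cases z)
      case (Pair x s)
      have "x + s *\<^sub>R v \<notin> C \<or> s \<notin> {0..1}"
        using that Pair by (force simp: image_iff)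
      then show ?thesis using C(3) Pair by (auto simp: indicator_def)
    qed
    moreover have "continuous_on ?C ?F"
    proof -
      have "continuous_on ?C (\<lambda>z. f' (fst z + snd z *\<^sub>R v))"
        by (intro continuous_on_compose2[OF c(2)] continuous_intros) auto
      then show ?thesis
        by (rule continuous_on_eq) auto
    qed
    ultimately have "integrable lborel ?F"
      by (intro integrable_continuous_compact_support) auto
    then show ?thesis by (simp add: lborel_prod)
  qed
  have "(LBINT x. f' x) = (LBINT s. (LBINT x. ?F (x, s)))"
    unfolding inner by simp
  also have "\<dots> = (LBINT x. (LBINT s. ?F (x, s)))"
    by (rule lborel_pair.Fubini_integral[of "\<lambda>x s. ?F (x, s)"]) (use int in simp)
  also have "\<dots> = (LBINT x. f (x + v) - f x)"
    unfolding ftc ..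
  also have "\<dots> = 0"
  proof -
    have i: "integrable lborel f"
      using C c by (intro integrable_continuous_compact_support[of C]) (auto intro: continuous_on_subset)
    have "integrable lborel (\<lambda>x. f (x + v))"
    proof (rule integrable_continuous_compact_support[of "(\<lambda>x. x - v) ` C"])
      show "compact ((\<lambda>x. x - v) ` C)"
        by (intro compact_continuous_image C continuous_intros)
      show "f (x + v) = 0" if "x \<notin> (\<lambda>x. x - v) ` C" for x
        using that C(2)[of "x + v"] by (force simp: image_iff)
    qed (auto intro!: continuous_on_compose2[OF c(1)] continuous_intros)
    then show ?thesis
      using i integral_lborel_translate[of f v] by simp
  qed
  finally show ?thesis .
qed

text \<open>The factor \<open>g\<close> is regular on \<open>U\<close> only, but \<open>g \<eta>\<close>, extended by zero, is \<open>C\<^sup>1\<close> along \<open>v\<close> on the whole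
  space, so the preceding lemma applies to it.\<close>

lemma integral_by_parts_direction:
  fixes g g' \<eta> \<eta>' :: "'a::euclidean_space \<Rightarrow> complex"
  assumes U: "open U" and C: "compact C" "C \<subseteq> U" "\<And>x. x \<notin> C \<Longrightarrow> \<eta> x = 0" "\<And>x. x \<notin> C \<Longrightarrow> \<eta>' x = 0"
    and d: "\<And>x. x \<in> U \<Longrightarrow> ((\<lambda>s. g (x + s *\<^sub>R v)) has_vector_derivative g' x) (at 0)"
      "\<And>x. ((\<lambda>s. \<eta> (x + s *\<^sub>R v)) has_vector_derivative \<eta>' x) (at 0)"
    and c: "continuous_on U g" "continuous_on U g'" "continuous_on UNIV \<eta>" "continuous_on UNIV \<eta>'"
  shows "(LBINT x. g x * \<eta>' x) = - (LBINT x. g' x * \<eta> x)"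
proof -
  have ext: "continuous_on UNIV (\<lambda>x. h x * k x)" if "continuous_on U h" "continuous_on UNIV k" "\<And>x. x \<notin> C \<Longrightarrow> k x = 0"
    for h k :: "'a \<Rightarrow> complex"
  proof -
    have "continuous_on U (\<lambda>x. h x * k x)"
      using that by (auto intro!: continuous_intros intro: continuous_on_subset)
    then show ?thesis
      by (rule continuous_on_extend_zero[OF U C(1,2)]) (simp add: that)
  qed
  have e1: "continuous_on UNIV (\<lambda>x. g x * \<eta>' x)" and e2: "continuous_on UNIV (\<lambda>x. g' x * \<eta> x)"
    and e3: "continuous_on UNIV (\<lambda>x. g x * \<eta> x)"
    using ext c C by auto
  have "(LBINT x. g x * \<eta>' x + g' x * \<eta> x) = 0"
  proof (rule integral_directional_derivative_eq_0[where f = "\<lambda>x. g x * \<eta> x" and C = C and v = v])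
    show "((\<lambda>s. g (x + s *\<^sub>R v) * \<eta> (x + s *\<^sub>R v)) has_vector_derivative g x * \<eta>' x + g' x * \<eta> x) (at 0)" for x
    proof (cases "x \<in> U")
      case True
      then show ?thesis
        using has_vector_derivative_mult[OF d(1)[OF True] d(2)[of x]] by simp
    next
      case False
      then have "x \<in> - C" using C by auto
      moreover have "open (- C)" using C(1) by (simp add: compact_imp_closed open_Compl)
      ultimately have "((\<lambda>s. g (x + s *\<^sub>R v) * \<eta> (x + s *\<^sub>R v)) has_vector_derivative 0) (at 0) \<longleftrightarrow>
        ((\<lambda>s. (\<lambda>x. 0::complex) (x + s *\<^sub>R v)) has_vector_derivative 0) (at 0)"
        by (intro line_cong(2)[of "- C"]) (use C in auto)
      then show ?thesis using \<open>x \<in> - C\<close> C by simp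
    qed
  qed (use C e1 e2 e3 in \<open>auto intro!: continuous_intros\<close>)
  moreover have "integrable lborel (\<lambda>x. g x * \<eta>' x)" "integrable lborel (\<lambda>x. g' x * \<eta> x)"
    using C e1 e2 by (auto intro!: integrable_continuous_compact_support[of C] intro: continuous_on_subset)
  ultimately show ?thesis
    by (simp add: eq_neg_iff_add_eq_0)
qed

text \<open>The derivatives are moved over one at a time, the outermost one first, so that they reach \<open>\<eta>\<close> in
  the reverse order.\<close>

lemma integral_by_parts_iterated:
  fixes g \<eta> :: "'a::euclidean_space \<Rightarrow> complex"
  assumes U: "open U" and C: "compact C" "C \<subseteq> U"
    and g: "Ck_on k U g" and vs: "set vs \<subseteq> Basis" "length vs \<le> k"
    and \<eta>: "Ck_on (length vs) UNIV \<eta>" "\<And>x. x \<notin> C \<Longrightarrow> \<eta> x = 0"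
  shows "(- 1) ^ length vs * (LBINT x. g x * partial_derivs (rev vs) \<eta> x) =
    (LBINT x. partial_derivs vs g x * \<eta> x)"
  using vs \<eta>
proof (induction vs arbitrary: \<eta>)
  case (Cons v vs)
  have cl: "closed C" using C(1) by (rule compact_imp_closed)
  have z: "partial_deriv v \<eta> x = 0" if "x \<notin> C" for x
    using partial_derivs_eq_0[OF cl Cons.prems(4) that, where vs = "[v]"] by (simp add: partial_derivs_simps)
  have \<eta>1: "Ck_on (length vs) UNIV (partial_deriv v \<eta>)" "continuous_on UNIV \<eta>"
    "\<And>x. (\<lambda>s. \<eta> (x + s *\<^sub>R v)) differentiable (at 0)"
    using Cons.prems by (auto simp: Ck_on_Suc)
  have g1: "continuous_on U (partial_derivs vs g)" "continuous_on U (partial_derivs (v # vs) g)"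
    "\<And>x. x \<in> U \<Longrightarrow> (\<lambda>s. partial_derivs vs g (x + s *\<^sub>R v)) differentiable (at 0)"
    using g Cons.prems(1,2) by (auto simp: Ck_on_def)
  have "(- 1) ^ length vs * (LBINT x. g x * partial_derivs (rev vs) (partial_deriv v \<eta>) x) =
      (LBINT x. partial_derivs vs g x * partial_deriv v \<eta> x)"
    by (rule Cons.IH) (use Cons.prems \<eta>1 z in auto)
  also have "\<dots> = - (LBINT x. partial_deriv v (partial_derivs vs g) x * \<eta> x)"
    by (rule integral_by_parts_direction[where v = v, OF U C Cons.prems(4) z])
      (use \<eta>1 g1 in \<open>auto simp: partial_derivs_simps intro: has_partial_deriv Ck_on_imp_continuous\<close>)
  finally show ?case
    by (simp add: partial_derivs_simps)
qed (simp add: partial_derivs_simps)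

section \<open>Gauss's series with equal upper parameters\<close>

definition hyp_fps :: "real \<Rightarrow> real fps" where
  "hyp_fps g = fps_hypergeo [g, g] [1] 1"

lemma hyp2F1_eq_eval_fps: "hyp2F1 g g 1 = eval_fps (hyp_fps g)"
  by (simp add: hyp2F1_def hyp_fps_def fun_eq_iff)

lemma hyp_fps_nth: "fps_nth (hyp_fps g) n = (pochhammer g n / fact n)\<^sup>2"
  by (simp add: hyp_fps_def pochhammer_fact [symmetric] power2_eq_square field_simps)

lemma hyp_fps_nth_Suc:
  "(real n + 1)\<^sup>2 * fps_nth (hyp_fps g) (Suc n) = (g + real n)\<^sup>2 * fps_nth (hyp_fps g) n"
proof -
  have "pochhammer g (Suc n) / fact (Suc n) = pochhammer g n / fact n * ((g + real n) / (real n + 1))"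
    by (simp add: pochhammer_Suc add_ac)
  moreover have "(real n + 1)\<^sup>2 \<noteq> 0"
    by simp
  ultimately show ?thesis
    unfolding hyp_fps_nth by (simp only: power_mult_distrib power_divide) simp
qed

text \<open>Since \<open>(g)\<^sub>n / n!\<close> is the binomial coefficient of \<open>-g\<close> up to sign, it is of size
  \<open>n\<^sup>g\<^sup>-\<^sup>1\<close>.\<close>

lemma hyp_fps_nth_bound:
  obtains C where "C > 0" "\<And>n. n > 0 \<Longrightarrow> fps_nth (hyp_fps g) n \<le> C * real n powr (2 * g - 2)"
proof -
  let ?q = "\<lambda>n. ((-g) gchoose n) / ((-1)^n / exp ((-g+1) * of_real (ln (real n))))"
  have "convergent ?q"
    using gbinomial_asymptotic[of "-g"] by (auto simp: convergent_def)
  then have "Bseq ?q"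
    by (rule convergent_imp_Bseq)
  then obtain B where B: "B > 0" "\<And>n. norm (?q n) \<le> B"
    by (auto simp: Bseq_def)
  have eq: "fps_nth (hyp_fps g) n = (?q n)\<^sup>2 * real n powr (2 * g - 2)" if "n > 0" for n
  proof -
    have e: "exp ((-g+1) * ln (real n)) = real n powr (1 - g)"
      using that by (simp add: powr_def)
    have sq: "(real n powr (1 - g))\<^sup>2 * real n powr (2 * g - 2) = 1"
      using that by (simp add: power2_eq_square flip: powr_add)
    have "((-g) gchoose n)\<^sup>2 = (pochhammer g n / fact n)\<^sup>2"
      by (simp add: gbinomial_pochhammer power_divide power_mult_distrib flip: power_mult)
    moreover have "(?q n)\<^sup>2 = ((-g) gchoose n)\<^sup>2 * (real n powr (1 - g))\<^sup>2"
      using e by (simp add: power_divide power_mult_distrib flip: power_mult)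
    ultimately show ?thesis
      using sq by (simp add: hyp_fps_nth mult.assoc)
  qed
  show ?thesis
  proof (rule that[of "B\<^sup>2"])
    show "B\<^sup>2 > 0" using B by simp
    fix n :: nat assume n: "n > 0"
    have "\<bar>?q n\<bar> \<le> \<bar>B\<bar>" using B(2)[of n] B(1) by simp
    then have "(?q n)\<^sup>2 \<le> B\<^sup>2" by (rule power2_mono)
    then show "fps_nth (hyp_fps g) n \<le> B\<^sup>2 * real n powr (2 * g - 2)"
      unfolding eq[OF n] by (intro mult_right_mono) auto
  qed
qed

context
  fixes g :: real
  assumes g: "g < 1 / 2"
begin

lemma hyp_fps_nth_nonneg: "fps_nth (hyp_fps g) n \<ge> 0"
  by (simp add: hyp_fps_nth)

lemma summable_hyp_fps: "summable (fps_nth (hyp_fps g))"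
proof -
  obtain C where C: "\<And>n. n > 0 \<Longrightarrow> fps_nth (hyp_fps g) n \<le> C * real n powr (2 * g - 2)"
    using hyp_fps_nth_bound[of g] by blast
  show ?thesis
  proof (rule summable_comparison_test')
    show "summable (\<lambda>n. C * real n powr (2 * g - 2))"
      using g by (intro summable_mult) (simp add: summable_real_powr_iff)
    show "norm (fps_nth (hyp_fps g) n) \<le> C * real n powr (2 * g - 2)" if "n \<ge> 1" for n
      using C[of n] that by (simp add: hyp_fps_nth_nonneg)
  qed
qed

lemma hyp_fps_conv_radius: "fps_conv_radius (hyp_fps g) \<ge> ereal 1"
proof -
  have "summable (\<lambda>n. fps_nth (hyp_fps g) n * 1 ^ n)"
    using summable_hyp_fps by simp
  from conv_radius_geI[OF this] show ?thesis
    by (simp add: fps_conv_radius_def)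
qed

definition hyp :: "real \<Rightarrow> real" where "hyp = eval_fps (hyp_fps g)"
definition hyp' :: "real \<Rightarrow> real" where "hyp' = eval_fps (fps_deriv (hyp_fps g))"
definition hyp'' :: "real \<Rightarrow> real" where "hyp'' = eval_fps (fps_deriv (fps_deriv (hyp_fps g)))"

lemma conv_radius_hyp:
  fixes z :: real
  assumes "\<bar>z\<bar> < 1"
  shows "ereal (norm z) < fps_conv_radius (hyp_fps g)"
    "ereal (norm z) < fps_conv_radius (fps_deriv (hyp_fps g))"
    "ereal (norm z) < fps_conv_radius (fps_deriv (fps_deriv (hyp_fps g)))"
proof -
  have "ereal (norm z) < ereal 1" using assms by (subst less_ereal.simps) simp
  then show "ereal (norm z) < fps_conv_radius (hyp_fps g)"
    "ereal (norm z) < fps_conv_radius (fps_deriv (hyp_fps g))"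
    "ereal (norm z) < fps_conv_radius (fps_deriv (fps_deriv (hyp_fps g)))"
    using hyp_fps_conv_radius fps_conv_radius_deriv[of "hyp_fps g"]
      fps_conv_radius_deriv[of "fps_deriv (hyp_fps g)"]
    by (meson less_le_trans order_trans)+
qed

lemma hyp_0: "hyp 0 = 1"
  by (simp add: hyp_def eval_fps_at_0 hyp_fps_def)

lemma DERIV_hyp:
  "\<bar>z\<bar> < 1 \<Longrightarrow> (hyp has_field_derivative hyp' z) (at z)"
  "\<bar>z\<bar> < 1 \<Longrightarrow> (hyp' has_field_derivative hyp'' z) (at z)"
  unfolding hyp_def hyp'_def hyp''_def
  by (intro has_field_derivative_eval_fps conv_radius_hyp; simp)+

lemma continuous_on_hyp'':
  assumes "continuous_on A h" "\<And>x. x \<in> A \<Longrightarrow> \<bar>h x\<bar> < 1"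
  shows "continuous_on A (\<lambda>x. hyp'' (h x))"
  unfolding hyp''_def
  by (rule continuous_on_eval_fps') (use assms conv_radius_hyp(3)[unfolded real_norm_def] in \<open>auto simp: eball_def\<close>)

lemma continuous_on_hyp':
  assumes "continuous_on A h" "\<And>x. x \<in> A \<Longrightarrow> \<bar>h x\<bar> < 1"
  shows "continuous_on A (\<lambda>x. hyp' (h x))"
  unfolding hyp'_def
  by (rule continuous_on_eval_fps') (use assms conv_radius_hyp(2)[unfolded real_norm_def] in \<open>auto simp: eball_def\<close>)

lemma continuous_on_hyp:
  assumes "continuous_on A h" "\<And>x. x \<in> A \<Longrightarrow> \<bar>h x\<bar> < 1"
  shows "continuous_on A (\<lambda>x. hyp (h x))"
  unfolding hyp_def
  by (rule continuous_on_eval_fps') (use assms conv_radius_hyp(1)[unfolded real_norm_def] in \<open>auto simp: eball_def\<close>)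

text \<open>Gauss's differential equation for \<open>a = b = g\<close>, \<open>c = 1\<close>. The coefficient of \<open>z\<^sup>n\<close> on the left is
  \<open>(n + 1)\<^sup>2 c\<^sub>n\<^sub>+\<^sub>1 - (g + n)\<^sup>2 c\<^sub>n\<close>, which is \<open>0\<close> by the recursion for the coefficients \<open>c\<^sub>n\<close>.\<close>

lemma hyp_ode:
  assumes "\<bar>z\<bar> < 1"
  shows "z * (1 - z) * hyp'' z + (1 - (2 * g + 1) * z) * hyp' z - g\<^sup>2 * hyp z = 0"
proof -
  let ?c = "fps_nth (hyp_fps g)"
  note s = sums_eval_fps[OF conv_radius_hyp(1)[OF assms]]
    sums_eval_fps[OF conv_radius_hyp(2)[OF assms]]
    sums_eval_fps[OF conv_radius_hyp(3)[OF assms]]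
  have s0: "(\<lambda>n. ?c n * z ^ n) sums hyp z"
    using s(1) by (simp add: hyp_def)
  have s1: "(\<lambda>n. (real n + 1) * ?c (Suc n) * z ^ n) sums hyp' z"
    using s(2) by (simp add: hyp'_def add_ac)
  have s2: "(\<lambda>n. (real n + 1) * (real n + 2) * ?c (n + 2) * z ^ n) sums hyp'' z"
    using s(3) by (simp add: hyp''_def algebra_simps)
  have t1: "(\<lambda>n. real n * ?c n * z ^ n) sums (z * hyp' z)"
  proof (rule sums_Suc_imp)
    show "(\<lambda>n. real (Suc n) * ?c (Suc n) * z ^ Suc n) sums (z * hyp' z)"
      using sums_mult[OF s1, of z] by (simp add: algebra_simps)
  qed simp
  have t2: "(\<lambda>n. real n * (real n + 1) * ?c (Suc n) * z ^ n) sums (z * hyp'' z)"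
  proof (rule sums_Suc_imp)
    show "(\<lambda>n. real (Suc n) * (real (Suc n) + 1) * ?c (Suc (Suc n)) * z ^ Suc n) sums (z * hyp'' z)"
      using sums_mult[OF s2, of z] by (simp add: algebra_simps)
  qed simp
  have t3: "(\<lambda>n. real n * (real n - 1) * ?c n * z ^ n) sums (z\<^sup>2 * hyp'' z)"
  proof (rule sums_Suc_imp)
    show "(\<lambda>n. real (Suc n) * (real (Suc n) - 1) * ?c (Suc n) * z ^ Suc n) sums (z\<^sup>2 * hyp'' z)"
      using sums_mult[OF t2, of z] by (simp add: algebra_simps power2_eq_square)
  qed simp
  have "(\<lambda>n. real n * (real n + 1) * ?c (Suc n) * z ^ n - real n * (real n - 1) * ?c n * z ^ n
      + ((real n + 1) * ?c (Suc n) * z ^ n - (2 * g + 1) * (real n * ?c n * z ^ n)) - g\<^sup>2 * (?c n * z ^ n))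
      sums (z * hyp'' z - z\<^sup>2 * hyp'' z + (hyp' z - (2 * g + 1) * (z * hyp' z)) - g\<^sup>2 * hyp z)"
    by (intro sums_add sums_diff sums_mult s0 s1 t1 t2 t3)
  moreover have "real n * (real n + 1) * ?c (Suc n) * z ^ n - real n * (real n - 1) * ?c n * z ^ n
      + ((real n + 1) * ?c (Suc n) * z ^ n - (2 * g + 1) * (real n * ?c n * z ^ n)) - g\<^sup>2 * (?c n * z ^ n) = 0"
    for n
  proof -
    have "real n * (real n + 1) * ?c (Suc n) * z ^ n - real n * (real n - 1) * ?c n * z ^ n
      + ((real n + 1) * ?c (Suc n) * z ^ n - (2 * g + 1) * (real n * ?c n * z ^ n)) - g\<^sup>2 * (?c n * z ^ n)
      = ((real n + 1)\<^sup>2 * ?c (Suc n) - (g + real n)\<^sup>2 * ?c n) * z ^ n"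
      by (simp add: algebra_simps power2_eq_square)
    then show ?thesis by (simp add: hyp_fps_nth_Suc)
  qed
  ultimately have "(\<lambda>n. 0::real) sums (z * hyp'' z - z\<^sup>2 * hyp'' z + (hyp' z - (2 * g + 1) * (z * hyp' z)) - g\<^sup>2 * hyp z)"
    by simp
  from sums_unique2[OF this sums_zero] show ?thesis
    by (simp add: algebra_simps power2_eq_square)
qed

text \<open>The coefficients are nonnegative and summable, because \<open>2 g - 2 < - 1\<close>; so the value at \<open>1\<close> is a bound.\<close>

lemma hyp_bounded:
  obtains C where "C > 0" "\<And>z. 0 \<le> z \<Longrightarrow> z < 1 \<Longrightarrow> \<bar>hyp z\<bar> \<le> C"
proof (rule that[of "(\<Sum>n. fps_nth (hyp_fps g) n) + 1"])
  show "(\<Sum>n. fps_nth (hyp_fps g) n) + 1 > 0"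
    using suminf_nonneg[OF summable_hyp_fps hyp_fps_nth_nonneg] by linarith
  fix z :: real assume z: "0 \<le> z" "z < 1"
  have s: "(\<lambda>n. fps_nth (hyp_fps g) n * z ^ n) sums hyp z"
    unfolding hyp_def by (rule sums_eval_fps[OF conv_radius_hyp(1)]) (use z in auto)
  have "hyp z \<ge> 0"
    by (rule sums_le[OF _ sums_zero s]) (use z hyp_fps_nth_nonneg in auto)
  moreover have "hyp z \<le> (\<Sum>n. fps_nth (hyp_fps g) n)"
    by (rule sums_le[OF _ s summable_sums[OF summable_hyp_fps]])
      (use z hyp_fps_nth_nonneg in \<open>auto intro!: mult_left_le power_le_one\<close>)
  ultimately show "\<bar>hyp z\<bar> \<le> (\<Sum>n. fps_nth (hyp_fps g) n) + 1"
    by simp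
qed

text \<open>The coefficients of the derivative are of size \<open>n\<^sup>2\<^sup>g\<^sup>-\<^sup>1\<close>, hence bounded, and the derivative is
  dominated by a geometric series.\<close>

lemma hyp'_bounded:
  obtains C where "C > 0" "\<And>z. 0 \<le> z \<Longrightarrow> z < 1 \<Longrightarrow> \<bar>hyp' z\<bar> * (1 - z) \<le> C"
proof -
  obtain C where C: "C > 0" "\<And>n. n > 0 \<Longrightarrow> fps_nth (hyp_fps g) n \<le> C * real n powr (2 * g - 2)"
    using hyp_fps_nth_bound[of g] by blast
  have b: "real (Suc n) * fps_nth (hyp_fps g) (Suc n) \<le> C" for n
  proof -
    have "real (Suc n) * fps_nth (hyp_fps g) (Suc n)
        \<le> real (Suc n) * (C * real (Suc n) powr (2 * g - 2))"
      by (intro mult_left_mono C) auto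
    also have "\<dots> = C * (real (Suc n) powr 1 * real (Suc n) powr (2 * g - 2))"
      by simp
    also have "\<dots> = C * real (Suc n) powr (2 * g - 1)"
      by (simp only: flip: powr_add) simp
    also have "\<dots> \<le> C * 1"
    proof (intro mult_left_mono)
      have "real (Suc n) powr (2 * g - 1) \<le> real (Suc n) powr 0"
        using g by (intro powr_mono) auto
      then show "real (Suc n) powr (2 * g - 1) \<le> 1" by simp
    qed (use C in simp)
    finally show ?thesis by simp
  qed
  show ?thesis
  proof (rule that[OF C(1)])
    fix z :: real assume z: "0 \<le> z" "z < 1"
    have s: "(\<lambda>n. real (Suc n) * fps_nth (hyp_fps g) (Suc n) * z ^ n) sums hyp' z"
      unfolding hyp'_def using sums_eval_fps[OF conv_radius_hyp(2)[of z]] z by (simp add: add_ac)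
    have geo: "(\<lambda>n. C * z ^ n) sums (C * (1 / (1 - z)))"
      by (intro sums_mult geometric_sums) (use z in auto)
    have "hyp' z \<ge> 0"
      by (rule sums_le[OF _ sums_zero s]) (use z hyp_fps_nth_nonneg in auto)
    moreover have "hyp' z \<le> C * (1 / (1 - z))"
      by (rule sums_le[OF _ s geo]) (use z b in \<open>auto intro!: mult_right_mono\<close>)
    ultimately show "\<bar>hyp' z\<bar> * (1 - z) \<le> C"
      using z by (simp add: field_simps)
  qed
qed

end

section \<open>The kernel\<close>

text \<open>Throughout, \<open>p\<close> and \<open>q\<close> stand for \<open>\<phi>(t)\<close> and \<open>\<phi>(b)\<close>. In the kernel, \<open>kD\<close> is the base of the power and
  \<open>kz\<close> the argument of the hypergeometric function; indices \<open>p\<close> and \<open>r\<close> denote partial derivatives. On the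
  open set \<open>kdom\<close> one has \<open>kD > 0\<close> and \<open>\<bar>kz\<bar> < 1\<close>, and it contains the domain of integration
  \<open>0 \<le> r \<le> p - q\<close> with its boundary.\<close>

definition kdom :: "real \<Rightarrow> real \<Rightarrow> real \<Rightarrow> bool" where
  "kdom q p r \<longleftrightarrow> 0 < q \<and> 0 < p \<and> r\<^sup>2 < p\<^sup>2 + q\<^sup>2"

definition kD :: "real \<Rightarrow> real \<Rightarrow> real \<Rightarrow> real" where
  "kD q p r = (p + q)\<^sup>2 - r\<^sup>2"

definition kz :: "real \<Rightarrow> real \<Rightarrow> real \<Rightarrow> real" where
  "kz q p r = ((p - q)\<^sup>2 - r\<^sup>2) / kD q p r"

definition kz_p :: "real \<Rightarrow> real \<Rightarrow> real \<Rightarrow> real" where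
  "kz_p q p r = 4 * q * (p\<^sup>2 - q\<^sup>2 + r\<^sup>2) / (kD q p r)\<^sup>2"

definition kz_r :: "real \<Rightarrow> real \<Rightarrow> real \<Rightarrow> real" where
  "kz_r q p r = - 8 * p * q * r / (kD q p r)\<^sup>2"

definition G :: "real \<Rightarrow> real \<Rightarrow> real \<Rightarrow> real \<Rightarrow> real" where
  "G g q p r = kD q p r powr (- g) * hyp g (kz q p r)"

definition G_p :: "real \<Rightarrow> real \<Rightarrow> real \<Rightarrow> real \<Rightarrow> real" where
  "G_p g q p r = kD q p r powr (- g) *
     (- 2 * g * (p + q) / kD q p r * hyp g (kz q p r) + kz_p q p r * hyp' g (kz q p r))"

definition G_r :: "real \<Rightarrow> real \<Rightarrow> real \<Rightarrow> real \<Rightarrow> real" where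
  "G_r g q p r = kD q p r powr (- g) *
     (2 * g * r / kD q p r * hyp g (kz q p r) + kz_r q p r * hyp' g (kz q p r))"

definition G_pp :: "real \<Rightarrow> real \<Rightarrow> real \<Rightarrow> real \<Rightarrow> real" where
  "G_pp g q p r = (let D = kD q p r; z = kz q p r; a = - 2 * g * (p + q) / D; b = kz_p q p r in
     D powr (- g) *
     ((a\<^sup>2 + (4 * g * (p + q)\<^sup>2 / D\<^sup>2 - 2 * g / D)) * hyp g z +
      (2 * a * b + (8 * p * q / D\<^sup>2 - 4 * (p + q) * b / D)) * hyp' g z + b\<^sup>2 * hyp'' g z))"

definition G_rr :: "real \<Rightarrow> real \<Rightarrow> real \<Rightarrow> real \<Rightarrow> real" where
  "G_rr g q p r = (let D = kD q p r; z = kz q p r; a = 2 * g * r / D; b = kz_r q p r in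
     D powr (- g) *
     ((a\<^sup>2 + (4 * g * r\<^sup>2 / D\<^sup>2 + 2 * g / D)) * hyp g z +
      (2 * a * b + (4 * r * b / D - 8 * p * q / D\<^sup>2)) * hyp' g z + b\<^sup>2 * hyp'' g z))"

lemma kD_pos: "kdom q p r \<Longrightarrow> kD q p r > 0"
proof -
  assume k: "kdom q p r"
  then have "p * q > 0" "r\<^sup>2 < p\<^sup>2 + q\<^sup>2" by (simp_all add: kdom_def)
  then show ?thesis by (simp add: kD_def power2_sum)
qed

lemma one_minus_kz: "kD q p r \<noteq> 0 \<Longrightarrow> 1 - kz q p r = 4 * p * q / kD q p r"
  by (simp add: kz_def kD_def field_simps power2_eq_square)

lemma kz_bounds: "kdom q p r \<Longrightarrow> \<bar>kz q p r\<bar> < 1"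
proof -
  assume k: "kdom q p r"
  note D = kD_pos[OF k]
  have pq: "p * q > 0" "r\<^sup>2 < p\<^sup>2 + q\<^sup>2" using k by (simp_all add: kdom_def)
  have "1 - kz q p r > 0"
    using one_minus_kz[of q p r] D pq by simp
  moreover have "1 - kz q p r < 2"
  proof -
    have "4 * p * q < 2 * kD q p r"
      using pq by (simp add: kD_def power2_sum)
    then show ?thesis using one_minus_kz[of q p r] D by (simp add: pos_divide_less_eq)
  qed
  ultimately show ?thesis by simp
qed

text \<open>The common shape of \<open>G\<^sub>p\<^sub>p\<close> and \<open>G\<^sub>r\<^sub>r\<close>: the prefactor \<open>e\<close> has derivative \<open>e a\<close>, and \<open>h, h'\<close> are values
  of the hypergeometric function and its derivative at a point that moves with speed \<open>b\<close>.\<close>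

lemma second_derivative_form:
  fixes e :: real
  shows "e * a * (a * h + b * h') + (a' * h + h' * b * a + (b' * h' + h'' * b * b)) * e =
    e * ((a\<^sup>2 + a') * h + (2 * a * b + b') * h' + b\<^sup>2 * h'')"
  by (simp add: algebra_simps power2_eq_square)

context
  fixes g :: real
  assumes g: "g < 1 / 2"
begin

lemma continuous_on_kernel_parts:
  assumes [continuous_intros]: "continuous_on S Q" "continuous_on S P" "continuous_on S R"
    and k: "\<And>x. x \<in> S \<Longrightarrow> kdom (Q x) (P x) (R x)"
  shows "continuous_on S (\<lambda>x. kD (Q x) (P x) (R x))"
    "continuous_on S (\<lambda>x. kD (Q x) (P x) (R x) powr (- g))"
    "continuous_on S (\<lambda>x. hyp g (kz (Q x) (P x) (R x)))"
    "continuous_on S (\<lambda>x. hyp' g (kz (Q x) (P x) (R x)))"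
    "continuous_on S (\<lambda>x. hyp'' g (kz (Q x) (P x) (R x)))"
    "continuous_on S (\<lambda>x. kz_p (Q x) (P x) (R x))"
    "continuous_on S (\<lambda>x. kz_r (Q x) (P x) (R x))"
proof -
  have D: "kD (Q x) (P x) (R x) \<noteq> 0" if "x \<in> S" for x
    using kD_pos[OF k[OF that]] by simp
  show 1[continuous_intros]: "continuous_on S (\<lambda>x. kD (Q x) (P x) (R x))"
    unfolding kD_def by (intro continuous_intros)
  show "continuous_on S (\<lambda>x. kD (Q x) (P x) (R x) powr (- g))"
    using D by (intro continuous_intros) auto
  have 2: "continuous_on S (\<lambda>x. kz (Q x) (P x) (R x))"
    unfolding kz_def using D by (intro continuous_intros) auto
  show "continuous_on S (\<lambda>x. hyp g (kz (Q x) (P x) (R x)))"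
    "continuous_on S (\<lambda>x. hyp' g (kz (Q x) (P x) (R x)))"
    "continuous_on S (\<lambda>x. hyp'' g (kz (Q x) (P x) (R x)))"
    using kz_bounds[OF k] g 2
    by (intro continuous_on_hyp continuous_on_hyp' continuous_on_hyp''; simp)+
  show "continuous_on S (\<lambda>x. kz_p (Q x) (P x) (R x))" "continuous_on S (\<lambda>x. kz_r (Q x) (P x) (R x))"
    unfolding kz_p_def kz_r_def using D by (intro continuous_intros; simp)+
qed

lemma continuous_on_G:
  assumes "continuous_on S Q" "continuous_on S P" "continuous_on S R"
    and "\<And>x. x \<in> S \<Longrightarrow> kdom (Q x) (P x) (R x)"
  shows "continuous_on S (\<lambda>x. G g (Q x) (P x) (R x))"
    "continuous_on S (\<lambda>x. G_p g (Q x) (P x) (R x))"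
    "continuous_on S (\<lambda>x. G_rr g (Q x) (P x) (R x))"
proof -
  note [continuous_intros] = continuous_on_kernel_parts[OF assms] assms(1-3)
  have D: "kD (Q x) (P x) (R x) \<noteq> 0" if "x \<in> S" for x
    using kD_pos[OF assms(4)[OF that]] by simp
  show "continuous_on S (\<lambda>x. G g (Q x) (P x) (R x))"
    unfolding G_def by (intro continuous_intros)
  show "continuous_on S (\<lambda>x. G_p g (Q x) (P x) (R x))"
    unfolding G_p_def using D by (intro continuous_intros) auto
  show "continuous_on S (\<lambda>x. G_rr g (Q x) (P x) (R x))"
    unfolding G_rr_def Let_def using D by (intro continuous_intros) auto
qed

context
  fixes q p r :: real
  assumes k: "kdom q p r"
begin

lemma DERIV_kernel_parts:
  "((\<lambda>p. kD q p r) has_field_derivative 2 * (p + q)) (at p)"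
  "((\<lambda>r. kD q p r) has_field_derivative - 2 * r) (at r)"
  "((\<lambda>p. kD q p r powr (- g)) has_field_derivative kD q p r powr (- g) * (- 2 * g * (p + q) / kD q p r)) (at p)"
  "((\<lambda>r. kD q p r powr (- g)) has_field_derivative kD q p r powr (- g) * (2 * g * r / kD q p r)) (at r)"
  "((\<lambda>p. kz q p r) has_field_derivative kz_p q p r) (at p)"
  "((\<lambda>r. kz q p r) has_field_derivative kz_r q p r) (at r)"
proof -
  note D = kD_pos[OF k]
  show 1: "((\<lambda>p. kD q p r) has_field_derivative 2 * (p + q)) (at p)"
    unfolding kD_def by (auto intro!: derivative_eq_intros)
  show 2: "((\<lambda>r. kD q p r) has_field_derivative - 2 * r) (at r)"
    unfolding kD_def by (auto intro!: derivative_eq_intros)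
  have pw: "kD q p r powr (- g - 1) = kD q p r powr (- g) / kD q p r"
    using D by (simp add: powr_diff)
  have 3: "((\<lambda>x. x powr (- g)) has_field_derivative - g * kD q p r powr (- g - 1)) (at (kD q p r))"
    using D by (auto intro!: derivative_eq_intros)
  show "((\<lambda>p. kD q p r powr (- g)) has_field_derivative kD q p r powr (- g) * (- 2 * g * (p + q) / kD q p r)) (at p)"
    by (rule DERIV_cong[OF DERIV_chain2[OF 3 1]]) (use pw in simp)
  show "((\<lambda>r. kD q p r powr (- g)) has_field_derivative kD q p r powr (- g) * (2 * g * r / kD q p r)) (at r)"
    by (rule DERIV_cong[OF DERIV_chain2[OF 3 2]]) (use pw in simp)
  have n1: "((\<lambda>p. (p - q)\<^sup>2 - r\<^sup>2) has_field_derivative 2 * (p - q)) (at p)"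
    by (auto intro!: derivative_eq_intros)
  have n2: "((\<lambda>r. (p - q)\<^sup>2 - r\<^sup>2) has_field_derivative - 2 * r) (at r)"
    by (auto intro!: derivative_eq_intros)
  have D0: "kD q p r \<noteq> 0" using D by simp
  show "((\<lambda>p. kz q p r) has_field_derivative kz_p q p r) (at p)"
    unfolding kz_def
    by (rule DERIV_cong[OF DERIV_divide[OF n1 1 D0]])
      (use D0 in \<open>simp add: kz_p_def field_simps power2_eq_square, simp add: kD_def algebra_simps power2_eq_square\<close>)
  show "((\<lambda>r. kz q p r) has_field_derivative kz_r q p r) (at r)"
    unfolding kz_def
    by (rule DERIV_cong[OF DERIV_divide[OF n2 2 D0]])
      (use D0 in \<open>simp add: kz_r_def field_simps power2_eq_square, simp add: kD_def algebra_simps power2_eq_square\<close>)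
qed

lemma DERIV_hyp_kz:
  "((\<lambda>p. hyp g (kz q p r)) has_field_derivative hyp' g (kz q p r) * kz_p q p r) (at p)"
  "((\<lambda>p. hyp' g (kz q p r)) has_field_derivative hyp'' g (kz q p r) * kz_p q p r) (at p)"
  "((\<lambda>r. hyp g (kz q p r)) has_field_derivative hyp' g (kz q p r) * kz_r q p r) (at r)"
  "((\<lambda>r. hyp' g (kz q p r)) has_field_derivative hyp'' g (kz q p r) * kz_r q p r) (at r)"
  by (intro DERIV_chain2[OF DERIV_hyp(1)] DERIV_chain2[OF DERIV_hyp(2)] g kz_bounds[OF k]
      DERIV_kernel_parts)+

lemma DERIV_G:
  "((\<lambda>p. G g q p r) has_field_derivative G_p g q p r) (at p)"
  "((\<lambda>r. G g q p r) has_field_derivative G_r g q p r) (at r)"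
  unfolding G_def
  by (rule DERIV_cong[OF DERIV_mult[OF DERIV_kernel_parts(3) DERIV_hyp_kz(1)]],
      simp add: G_p_def algebra_simps)
     (rule DERIV_cong[OF DERIV_mult[OF DERIV_kernel_parts(4) DERIV_hyp_kz(3)]],
      simp add: G_r_def algebra_simps)

lemma DERIV_G_p: "((\<lambda>p. G_p g q p r) has_field_derivative G_pp g q p r) (at p)"
proof -
  have D0: "kD q p r \<noteq> 0" using kD_pos[OF k] by simp
  have a: "((\<lambda>p. - 2 * g * (p + q) / kD q p r) has_field_derivative
      4 * g * (p + q)\<^sup>2 / (kD q p r)\<^sup>2 - 2 * g / kD q p r) (at p)"
    by (rule DERIV_cong[OF DERIV_divide[OF _ DERIV_kernel_parts(1) D0, where D = "- 2 * g"]])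
      (auto intro!: derivative_eq_intros simp: D0 field_simps power2_eq_square)
  have b: "((\<lambda>p. kz_p q p r) has_field_derivative
      8 * p * q / (kD q p r)\<^sup>2 - 4 * (p + q) * kz_p q p r / kD q p r) (at p)"
  proof -
    have n: "((\<lambda>p. 4 * q * (p\<^sup>2 - q\<^sup>2 + r\<^sup>2)) has_field_derivative 8 * p * q) (at p)"
      by (auto intro!: derivative_eq_intros)
    have d: "((\<lambda>p. (kD q p r)\<^sup>2) has_field_derivative 2 * kD q p r * (2 * (p + q))) (at p)"
      by (rule DERIV_cong[OF DERIV_power[OF DERIV_kernel_parts(1)]]) simp
    show ?thesis
      unfolding kz_p_def
      by (rule DERIV_cong[OF DERIV_divide[OF n d]])
        (use D0 in \<open>simp_all add: divide_simps power2_eq_square, simp_all add: algebra_simps\<close>)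
  qed
  show ?thesis
    unfolding G_p_def
    by (rule DERIV_cong[OF DERIV_mult[OF DERIV_kernel_parts(3) DERIV_add[OF
          DERIV_mult[OF a DERIV_hyp_kz(1)] DERIV_mult[OF b DERIV_hyp_kz(2)]]]])
      (unfold G_pp_def Let_def, rule second_derivative_form)
qed

lemma DERIV_G_r: "((\<lambda>r. G_r g q p r) has_field_derivative G_rr g q p r) (at r)"
proof -
  have D0: "kD q p r \<noteq> 0" using kD_pos[OF k] by simp
  have a: "((\<lambda>r. 2 * g * r / kD q p r) has_field_derivative
      4 * g * r\<^sup>2 / (kD q p r)\<^sup>2 + 2 * g / kD q p r) (at r)"
    by (rule DERIV_cong[OF DERIV_divide[OF _ DERIV_kernel_parts(2) D0, where D = "2 * g"]])
      (auto intro!: derivative_eq_intros simp: D0 field_simps power2_eq_square)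
  have b: "((\<lambda>r. kz_r q p r) has_field_derivative
      4 * r * kz_r q p r / kD q p r - 8 * p * q / (kD q p r)\<^sup>2) (at r)"
  proof -
    have n: "((\<lambda>r. - 8 * p * q * r) has_field_derivative - 8 * p * q) (at r)"
      by (auto intro!: derivative_eq_intros)
    have d: "((\<lambda>r. (kD q p r)\<^sup>2) has_field_derivative 2 * kD q p r * (- 2 * r)) (at r)"
      by (rule DERIV_cong[OF DERIV_power[OF DERIV_kernel_parts(2)]]) simp
    show ?thesis
      unfolding kz_r_def
      by (rule DERIV_cong[OF DERIV_divide[OF n d]])
        (use D0 in \<open>simp_all add: divide_simps power2_eq_square, simp_all add: algebra_simps\<close>)
  qed
  show ?thesis
    unfolding G_r_def
    by (rule DERIV_cong[OF DERIV_mult[OF DERIV_kernel_parts(4) DERIV_add[OF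
          DERIV_mult[OF a DERIV_hyp_kz(3)] DERIV_mult[OF b DERIV_hyp_kz(4)]]]])
      (unfold G_rr_def Let_def, rule second_derivative_form)
qed

text \<open>Collecting the terms with \<open>F\<close>, \<open>F'\<close> and \<open>F''\<close>, one finds \<open>4 q / (p D)\<close> times the left-hand side of Gauss's
  equation. For \<open>F''\<close> this rests on \<open>(p\<^sup>2 - q\<^sup>2 + r\<^sup>2)\<^sup>2 - 4 p\<^sup>2 r\<^sup>2 = ((p - q)\<^sup>2 - r\<^sup>2) D\<close>.\<close>

lemma euler_poisson_darboux: "G_pp g q p r + 2 * g / p * G_p g q p r = G_rr g q p r"
proof -
  define D where "D = kD q p r"
  define E where "E = D powr (- g)"
  define z where "z = kz q p r"
  have D0: "D \<noteq> 0" using kD_pos[OF k] by (simp add: D_def)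
  have p0: "p \<noteq> 0" using k by (simp add: kdom_def)
  have De: "D = (p + q)\<^sup>2 - r\<^sup>2" by (simp add: D_def kD_def)
  have ze: "z = ((p - q)\<^sup>2 - r\<^sup>2) / D" by (simp add: z_def kz_def D_def)
  let ?m = "4 * q / (p * D)"
  define a1 where "a1 = - 2 * g * (p + q) / D"
  define b1 where "b1 = 4 * q * (p\<^sup>2 - q\<^sup>2 + r\<^sup>2) / D\<^sup>2"
  define a2 where "a2 = 2 * g * r / D"
  define b2 where "b2 = - 8 * p * q * r / D\<^sup>2"
  have c0: "a1\<^sup>2 + (4 * g * (p + q)\<^sup>2 / D\<^sup>2 - 2 * g / D) + 2 * g / p * a1
      - (a2\<^sup>2 + (4 * g * r\<^sup>2 / D\<^sup>2 + 2 * g / D)) = - (?m * g\<^sup>2)"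
  proof -
    have "p * D\<^sup>2 * (a1\<^sup>2 + (4 * g * (p + q)\<^sup>2 / D\<^sup>2 - 2 * g / D) + 2 * g / p * a1
      - (a2\<^sup>2 + (4 * g * r\<^sup>2 / D\<^sup>2 + 2 * g / D))) =
      4 * g\<^sup>2 * p * (p + q)\<^sup>2 + 4 * g * p * (p + q)\<^sup>2 - 2 * g * p * D - 4 * g\<^sup>2 * (p + q) * D
       - 4 * g\<^sup>2 * p * r\<^sup>2 - 4 * g * p * r\<^sup>2 - 2 * g * p * D"
      using D0 p0 by (simp add: a1_def a2_def field_simps power2_eq_square)
    also have "\<dots> = - 4 * q * g\<^sup>2 * D"
      unfolding De by (simp add: algebra_simps power2_eq_square)
    also have "\<dots> = p * D\<^sup>2 * (- (?m * g\<^sup>2))"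
      using D0 p0 by (simp add: field_simps power2_eq_square)
    finally show ?thesis using D0 p0 by (simp only: mult_cancel_left) simp
  qed
  have c1: "2 * a1 * b1 + (8 * p * q / D\<^sup>2 - 4 * (p + q) * b1 / D) + 2 * g / p * b1
      - (2 * a2 * b2 + (4 * r * b2 / D - 8 * p * q / D\<^sup>2)) = ?m * (1 - (2 * g + 1) * z)"
  proof -
    have "p * D^3 * (2 * a1 * b1 + (8 * p * q / D\<^sup>2 - 4 * (p + q) * b1 / D) + 2 * g / p * b1
      - (2 * a2 * b2 + (4 * r * b2 / D - 8 * p * q / D\<^sup>2))) =
      - 16 * g * p * (p + q) * q * (p\<^sup>2 - q\<^sup>2 + r\<^sup>2) + 16 * p\<^sup>2 * q * D
      - 16 * p * (p + q) * q * (p\<^sup>2 - q\<^sup>2 + r\<^sup>2) + 8 * g * q * (p\<^sup>2 - q\<^sup>2 + r\<^sup>2) * D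
      + 32 * g * p\<^sup>2 * q * r\<^sup>2 + 32 * p\<^sup>2 * q * r\<^sup>2"
      using D0 p0 by (simp add: a1_def a2_def b1_def b2_def field_simps power2_eq_square power3_eq_cube)
    also have "\<dots> = 4 * q * D * (D - (2 * g + 1) * ((p - q)\<^sup>2 - r\<^sup>2))"
      unfolding De by (simp add: algebra_simps power2_eq_square)
    also have "\<dots> = p * D^3 * (?m * (1 - (2 * g + 1) * z))"
      using D0 p0 by (simp add: ze field_simps power2_eq_square power3_eq_cube)
    finally show ?thesis using D0 p0 by (simp only: mult_cancel_left) simp
  qed
  have c2: "b1\<^sup>2 - b2\<^sup>2 = ?m * (z * (1 - z))"
  proof -
    have "D^4 * (b1\<^sup>2 - b2\<^sup>2) = 16 * q\<^sup>2 * (p\<^sup>2 - q\<^sup>2 + r\<^sup>2)\<^sup>2 - 64 * p\<^sup>2 * q\<^sup>2 * r\<^sup>2"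
      using D0 p0 by (simp add: b1_def b2_def field_simps power2_eq_square power4_eq_xxxx)
    also have "\<dots> = 16 * q\<^sup>2 * ((p - q)\<^sup>2 - r\<^sup>2) * D"
      unfolding De by (simp add: algebra_simps power2_eq_square)
    also have "\<dots> = D^4 * (?m * (((p - q)\<^sup>2 - r\<^sup>2) / D * (4 * p * q / D)))"
      using D0 p0 by (simp add: field_simps power2_eq_square power4_eq_xxxx)
    also have "((p - q)\<^sup>2 - r\<^sup>2) / D * (4 * p * q / D) = z * (1 - z)"
      using one_minus_kz[of q p r] D0 by (simp add: z_def D_def kz_def)
    finally show ?thesis using D0 by (simp only: mult_cancel_left) simp
  qed
  have "G_pp g q p r + 2 * g / p * G_p g q p r - G_rr g q p r = E *
     ((a1\<^sup>2 + (4 * g * (p + q)\<^sup>2 / D\<^sup>2 - 2 * g / D) + 2 * g / p * a1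
      - (a2\<^sup>2 + (4 * g * r\<^sup>2 / D\<^sup>2 + 2 * g / D))) * hyp g z
      + (2 * a1 * b1 + (8 * p * q / D\<^sup>2 - 4 * (p + q) * b1 / D) + 2 * g / p * b1
      - (2 * a2 * b2 + (4 * r * b2 / D - 8 * p * q / D\<^sup>2))) * hyp' g z
      + (b1\<^sup>2 - b2\<^sup>2) * hyp'' g z)"
    unfolding G_pp_def G_p_def G_rr_def Let_def kz_p_def kz_r_def
      D_def[symmetric] E_def[symmetric] z_def[symmetric]
      a1_def[symmetric] b1_def[symmetric] a2_def[symmetric] b2_def[symmetric]
    by (simp add: algebra_simps)
  also have "\<dots> = E * ?m * (z * (1 - z) * hyp'' g z + (1 - (2 * g + 1) * z) * hyp' g z - g\<^sup>2 * hyp g z)"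
  proof -
    have "- (m * g\<^sup>2) * h0 + m * (1 - (2 * g + 1) * z) * h1 + m * (z * (1 - z)) * h2 =
        m * (z * (1 - z) * h2 + (1 - (2 * g + 1) * z) * h1 - g\<^sup>2 * h0)" for m h0 h1 h2
      by (simp add: algebra_simps)
    then show ?thesis unfolding c0 c1 c2 by (simp only: mult.assoc)
  qed
  also have "\<dots> = 0"
    using hyp_ode[OF g kz_bounds[OF k]] by (simp add: z_def)
  finally show ?thesis by simp
qed

end

text \<open>On \<open>r = p - q\<close> the argument \<open>kz\<close> vanishes identically, so that \<open>G\<close> and its derivative along this
  line come from the power alone.\<close>

lemma kernel_on_characteristic:
  assumes "0 < q" "0 < p"
  shows "G g q p (p - q) = (4 * p * q) powr (- g)"
    "G_p g q p (p - q) + G_r g q p (p - q) = - g / p * (4 * p * q) powr (- g)"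
proof -
  have D: "kD q p (p - q) = 4 * p * q" and z: "kz q p (p - q) = 0"
    by (simp_all add: kD_def kz_def power2_eq_square algebra_simps)
  have zz: "kz_p q p (p - q) + kz_r q p (p - q) = 0"
    unfolding kz_p_def kz_r_def add_divide_distrib[symmetric]
    by (simp add: power2_eq_square algebra_simps)
  show "G g q p (p - q) = (4 * p * q) powr (- g)"
    by (simp add: G_def D z hyp_0[OF g])
  have "G_p g q p (p - q) + G_r g q p (p - q) = (4 * p * q) powr (- g) *
    ((- 2 * g * (p + q) / (4 * p * q) + 2 * g * (p - q) / (4 * p * q)) * hyp g 0
     + (kz_p q p (p - q) + kz_r q p (p - q)) * hyp' g 0)"
    by (simp add: G_p_def G_r_def D z algebra_simps)
  also have "- 2 * g * (p + q) / (4 * p * q) + 2 * g * (p - q) / (4 * p * q) = - g / p"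
    using assms by (simp add: field_simps)
  finally show "G_p g q p (p - q) + G_r g q p (p - q) = - g / p * (4 * p * q) powr (- g)"
    by (simp add: zz hyp_0[OF g])
qed

end

lemma G_r_0: "G_r g q p 0 = 0"
  by (simp add: G_r_def kz_r_def)

section \<open>The transform for a fixed source time\<close>

text \<open>The chain rule for \<open>(s, y) \<mapsto> \<integral>\<^sub>0\<^sup>y H s r dr\<close> along the curve \<open>s \<mapsto> (s, R s)\<close>. Regularity of \<open>H\<close> is required on
  a rectangle that reaches beyond the endpoint \<open>R t\<close>.\<close>

lemma has_vector_derivative_moving_integral:
  fixes H Ht :: "real \<Rightarrow> real \<Rightarrow> 'a::euclidean_space"
  assumes I: "open I" "convex I" "t \<in> I"
    and deriv: "\<And>s r. s \<in> I \<Longrightarrow> r \<in> {0..S} \<Longrightarrow> ((\<lambda>s. H s r) has_vector_derivative Ht s r) (at s)"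
    and cont: "continuous_on (I \<times> {0..S}) (\<lambda>(s, r). H s r)" "continuous_on (I \<times> {0..S}) (\<lambda>(s, r). Ht s r)"
    and R: "(R has_real_derivative R') (at t)" "0 < R t" "R t < S"
  shows "((\<lambda>s. integral {0..R s} (H s)) has_vector_derivative
    (R' *\<^sub>R H t (R t) + integral {0..R t} (Ht t))) (at t)"
proof -
  define f where "f = (\<lambda>s y. integral {0..y} (H s))"
  have Hc: "continuous_on {0..y} (H s)" if "s \<in> I" "y \<le> S" for s y
  proof -
    have "continuous_on {0..y} (\<lambda>r. (\<lambda>(s, r). H s r) (s, r))"
      by (rule continuous_on_compose2[OF cont(1)]) (use that in \<open>auto intro!: continuous_intros\<close>)
    then show ?thesis by simp
  qed
  have fx: "((\<lambda>s. f s (R t)) has_derivative (\<lambda>x. x *\<^sub>R integral {0..R t} (Ht t))) (at t within I)"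
  proof -
    have "((\<lambda>s. integral (cbox 0 (R t)) (H s)) has_vector_derivative integral (cbox 0 (R t)) (Ht t)) (at t within I)"
    proof (rule leibniz_rule_vector_derivative)
      show "((\<lambda>s. H s r) has_vector_derivative Ht s r) (at s within I)"
        if "s \<in> I" "r \<in> cbox 0 (R t)" for s r
        using that R by (intro has_vector_derivative_at_within[OF deriv]) auto
      show "H s integrable_on cbox 0 (R t)" if "s \<in> I" for s
        using Hc[OF that, of "R t"] R by (intro integrable_continuous) simp
      show "continuous_on (I \<times> cbox 0 (R t)) (\<lambda>(s, r). Ht s r)"
        by (rule continuous_on_subset[OF cont(2)]) (use R in auto)
    qed (use I in auto)
    then show ?thesis by (simp add: has_vector_derivative_def f_def)
  qed
  have fy: "((\<lambda>y. f s y) has_derivative blinfun_apply (blinfun_scaleR_left (H s y))) (at y within {0<..<S})"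
    if "s \<in> I" "y \<in> {0<..<S}" for s y
  proof -
    have "((\<lambda>y. integral {0..y} (H s)) has_vector_derivative H s y) (at y within {0..S})"
      by (rule integral_has_vector_derivative) (use that Hc in auto)
    then have "((\<lambda>y. f s y) has_vector_derivative H s y) (at y within {0<..<S})"
      unfolding f_def by (rule has_vector_derivative_within_subset) auto
    then show ?thesis by (simp add: has_vector_derivative_def)
  qed
  have "continuous_on (I \<times> {0<..<S}) (\<lambda>(s, r). H s r)"
    by (rule continuous_on_subset[OF cont(1)]) auto
  then have "continuous_on (I \<times> {0<..<S}) (\<lambda>(s, r). blinfun_scaleR_left (H s r))"
    by (auto simp: split_beta intro!: continuous_intros)
  then have fyc: "continuous (at (t, R t) within I \<times> {0<..<S}) (\<lambda>(s, r). blinfun_scaleR_left (H s r))"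
    using I R by (auto simp: continuous_on_eq_continuous_within)
  have "((\<lambda>(s, y). f s y) has_derivative
      (\<lambda>(ts, ty). ts *\<^sub>R integral {0..R t} (Ht t) + blinfun_scaleR_left (H t (R t)) ty))
      (at (t, R t) within I \<times> {0<..<S})"
    by (rule has_derivative_partialsI[OF fx fy fyc]) (use I R in auto)
  then have D: "((\<lambda>(s, y). f s y) has_derivative
      (\<lambda>(ts, ty). ts *\<^sub>R integral {0..R t} (Ht t) + ty *\<^sub>R H t (R t))) (at (t, R t))"
    using I R by (subst (asm) at_within_open) (auto intro!: open_Times)
  have P: "((\<lambda>s. (s, R s)) has_derivative (\<lambda>h. (h, h * R'))) (at t)"
    by (intro has_derivative_Pair has_derivative_ident)
      (use R(1) in \<open>simp add: has_field_derivative_def mult_commute_abs\<close>)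
  have "((\<lambda>s. (\<lambda>(s, y). f s y) (s, R s)) has_derivative
      (\<lambda>h. (\<lambda>(ts, ty). ts *\<^sub>R integral {0..R t} (Ht t) + ty *\<^sub>R H t (R t)) (h, h * R'))) (at t)"
    by (rule has_derivative_compose[OF P D])
  then show ?thesis
    by (simp add: f_def has_vector_derivative_def algebra_simps)
qed

context
  fixes l :: real
  assumes l: "l > - 2"
begin

lemma \<gamma>_less_half: "\<gamma> l < 1 / 2"
  using l by (simp add: \<gamma>_def field_simps)

lemma \<phi>_pos: "0 < t \<Longrightarrow> 0 < \<phi> l t"
  using l by (simp add: \<phi>_def)

lemma \<phi>_nonneg: "0 \<le> \<phi> l t"
  using l by (simp add: \<phi>_def)

lemma \<phi>_less: "0 \<le> s \<Longrightarrow> s < t \<Longrightarrow> \<phi> l s < \<phi> l t"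
  using l by (simp add: \<phi>_def powr_less_mono2 divide_strict_right_mono)

lemma \<phi>_le: "0 \<le> s \<Longrightarrow> s \<le> t \<Longrightarrow> \<phi> l s \<le> \<phi> l t"
  using \<phi>_less[of s t] by (cases "s = t") auto

lemma DERIV_\<phi>: "0 < t \<Longrightarrow> (\<phi> l has_real_derivative t powr (l / 2)) (at t)"
proof -
  assume t: "0 < t"
  have "((\<lambda>t. 2 / (l + 2) * t powr ((l + 2) / 2)) has_real_derivative
      2 / (l + 2) * ((l + 2) / 2 * t powr ((l + 2) / 2 - 1))) (at t)"
    using t by (intro DERIV_cmult) (auto intro!: derivative_eq_intros)
  moreover have "2 / (l + 2) * ((l + 2) / 2 * t powr ((l + 2) / 2 - 1)) = t powr (l / 2)"
    using l by (simp add: add_divide_distrib flip: mult.assoc)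
  ultimately show ?thesis
    unfolding \<phi>_def[abs_def] by (simp only:)
qed

lemma continuous_on_\<phi>: "continuous_on {0..} (\<phi> l)"
  unfolding \<phi>_def[abs_def] using l by (intro continuous_intros continuous_on_powr') auto

lemma continuous_on_\<phi>_compose:
  assumes "continuous_on S h" "\<And>x. x \<in> S \<Longrightarrow> 0 \<le> h x"
  shows "continuous_on S (\<lambda>x. \<phi> l (h x))"
  by (rule continuous_on_compose2[OF continuous_on_\<phi> assms(1)]) (use assms in auto)

lemma kdom_time:
  assumes "0 < b" "0 < t" "0 \<le> r" "r < \<phi> l t"
  shows "kdom (\<phi> l b) (\<phi> l t) r"
proof -
  have "r\<^sup>2 \<le> (\<phi> l t)\<^sup>2" using assms by (intro power_mono) auto
  moreover have "0 < (\<phi> l b)\<^sup>2" using \<phi>_pos[OF assms(1)] by simp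
  ultimately show ?thesis
    unfolding kdom_def using \<phi>_pos[OF assms(1)] \<phi>_pos[OF assms(2)] by linarith
qed

definition K :: "real \<Rightarrow> real \<Rightarrow> real \<Rightarrow> real" where
  "K t b r = c_l l * kernel l t b r"

definition K_t :: "real \<Rightarrow> real \<Rightarrow> real \<Rightarrow> real" where
  "K_t t b r = c_l l * (t powr (l / 2) * G_p (\<gamma> l) (\<phi> l b) (\<phi> l t) r)"

lemma kernel_eq_G: "kernel l t b r = G (\<gamma> l) (\<phi> l b) (\<phi> l t) r"
  by (simp add: kernel_def G_def kD_def kz_def hyp2F1_eq_eval_fps hyp_def[OF \<gamma>_less_half])

lemma K_eq_G: "K t b r = c_l l * G (\<gamma> l) (\<phi> l b) (\<phi> l t) r"
  by (simp add: K_def kernel_eq_G)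

text \<open>All powers of \<open>t\<close> below are rational expressions in \<open>t\<close> and \<open>t\<^sup>l\<^sup>/\<^sup>4\<close>.\<close>

lemma powr_quarter:
  assumes "0 < (t::real)"
  shows "t powr (l / 2) = (t powr (l / 4))\<^sup>2" "t powr l = (t powr (l / 4)) ^ 4"
    "t powr (- l / 4) = 1 / t powr (l / 4)" "t powr (l / 4 - 1) = t powr (l / 4) / t"
    "t powr (l / 2 - 1) = (t powr (l / 4))\<^sup>2 / t"
proof -
  have "t powr (l / 2) = t powr (l / 4 + l / 4)" by simp
  then show 1: "t powr (l / 2) = (t powr (l / 4))\<^sup>2" unfolding powr_add power2_eq_square .
  have "t powr l = t powr (l / 2 + l / 2)" by simp
  then show "t powr l = (t powr (l / 4)) ^ 4" unfolding powr_add 1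
    by (simp add: power2_eq_square power4_eq_xxxx)
  show "t powr (- l / 4) = 1 / t powr (l / 4)" by (simp add: powr_minus_divide)
  show "t powr (l / 4 - 1) = t powr (l / 4) / t" using assms by (simp add: powr_diff)
  show "t powr (l / 2 - 1) = (t powr (l / 4))\<^sup>2 / t" using assms by (simp add: powr_diff 1)
qed

lemma \<gamma>_over_\<phi>: "0 < t \<Longrightarrow> \<gamma> l / \<phi> l t = (l / 4) / (t * (t powr (l / 4))\<^sup>2)"
proof -
  assume t: "0 < t"
  have "t powr ((l + 2) / 2) = t powr (l / 2 + 1)" by (simp add: add_divide_distrib)
  also have "\<dots> = (t powr (l / 4))\<^sup>2 * t" using t powr_quarter(1)[OF t] by (simp add: powr_add)
  finally have e: "t powr ((l + 2) / 2) = (t powr (l / 4))\<^sup>2 * t" .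
  have "\<gamma> l / \<phi> l t = (l / (2 * (l + 2))) / (2 / (l + 2) * ((t powr (l / 4))\<^sup>2 * t))"
    unfolding \<gamma>_def \<phi>_def e ..
  also have "\<dots> = (l / 4) / (t * (t powr (l / 4))\<^sup>2)"
  proof -
    have "l / (2 * e) / (2 / e * (c * t)) = l / 4 / (t * c)" if "e \<noteq> 0" for c e :: real
      using that by (simp add: mult_ac)
    from this[of "l + 2"] show ?thesis using l by (simp only:)
  qed
  finally show ?thesis .
qed

text \<open>This identity fixes the constant \<open>c_l\<close>.\<close>

lemma c_l_characteristic:
  assumes t: "0 < t" and b: "0 < b"
  shows "c_l l * (4 * \<phi> l t * \<phi> l b) powr (- \<gamma> l) = t powr (- l / 4) * b powr (- l / 4)"
proof -
  define e where "e = (l + 2) / 4"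
  have e: "e > 0" using l by (simp add: e_def)
  have g2: "2 * \<gamma> l = l / (l + 2)" and gl: "(l + 2) / 2 * \<gamma> l = l / 4"
    using l by (simp_all add: \<gamma>_def field_simps)
  have "4 * \<phi> l t * \<phi> l b = e powr (- 2) * (t powr ((l + 2) / 2) * b powr ((l + 2) / 2))"
    using e l by (simp add: \<phi>_def powr_minus e_def powr_numeral field_simps power2_eq_square)
  then have "(4 * \<phi> l t * \<phi> l b) powr (- \<gamma> l) =
      e powr (2 * \<gamma> l) * (t powr (- ((l + 2) / 2 * \<gamma> l)) * b powr (- ((l + 2) / 2 * \<gamma> l)))"
    using t b e by (simp add: powr_mult powr_powr)
  then show ?thesis
  proof -
    assume *: "(4 * \<phi> l t * \<phi> l b) powr (- \<gamma> l) =
      e powr (2 * \<gamma> l) * (t powr (- ((l + 2) / 2 * \<gamma> l)) * b powr (- ((l + 2) / 2 * \<gamma> l)))"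
    have "e powr (- l / (l + 2)) * e powr (l / (l + 2)) = 1"
      using e by (simp add: powr_minus_divide)
    then show ?thesis
      unfolding * g2 gl c_l_def e_def[symmetric] by simp
  qed
qed

lemma K_characteristic:
  assumes t: "0 < t" and b: "0 < b"
  shows "K t b (\<phi> l t - \<phi> l b) = t powr (- l / 4) * b powr (- l / 4)"
  using kernel_on_characteristic(1)[OF \<gamma>_less_half \<phi>_pos[OF b] \<phi>_pos[OF t]]
    c_l_characteristic[OF t b] by (simp add: K_eq_G)

text \<open>In the time variable the Euler-Poisson-Darboux equation becomes \<open>K\<^sub>t\<^sub>t = t\<^sup>l K\<^sub>r\<^sub>r\<close>, because
  \<open>\<phi>'\<^sup>2 = t\<^sup>l\<close> and \<open>\<phi>'' / \<phi>'\<^sup>2 = 2 \<gamma> / \<phi>\<close>.\<close>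

lemma DERIV_K:
  assumes "0 < t" "kdom (\<phi> l b) (\<phi> l t) r"
  shows "((\<lambda>t. K t b r) has_real_derivative K_t t b r) (at t)"
    "((\<lambda>t. K_t t b r) has_real_derivative
       t powr l * (c_l l * G_rr (\<gamma> l) (\<phi> l b) (\<phi> l t) r)) (at t)"
    "((\<lambda>r. K t b r) has_real_derivative c_l l * G_r (\<gamma> l) (\<phi> l b) (\<phi> l t) r) (at r)"
    "((\<lambda>r. G_r (\<gamma> l) (\<phi> l b) (\<phi> l t) r) has_real_derivative G_rr (\<gamma> l) (\<phi> l b) (\<phi> l t) r) (at r)"
proof -
  let ?g = "\<gamma> l" and ?q = "\<phi> l b" and ?p = "\<phi> l t"
  note g = \<gamma>_less_half
  note k = assms(2)
  have 1: "((\<lambda>t. G ?g ?q (\<phi> l t) r) has_real_derivative G_p ?g ?q ?p r * t powr (l / 2)) (at t)"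
    by (rule DERIV_chain2[OF DERIV_G(1)[OF g k] DERIV_\<phi>[OF assms(1)]])
  show "((\<lambda>t. K t b r) has_real_derivative K_t t b r) (at t)"
    unfolding K_eq_G K_t_def by (rule DERIV_cong[OF DERIV_cmult[OF 1]]) simp
  have 2: "((\<lambda>t. G_p ?g ?q (\<phi> l t) r) has_real_derivative G_pp ?g ?q ?p r * t powr (l / 2)) (at t)"
    by (rule DERIV_chain2[OF DERIV_G_p[OF g k] DERIV_\<phi>[OF assms(1)]])
  have 3: "((\<lambda>t. t powr (l / 2)) has_real_derivative l / 2 * t powr (l / 2 - 1)) (at t)"
    using assms(1) by (auto intro!: derivative_eq_intros)
  have 4: "l / 2 * t powr (l / 2 - 1) * G_p ?g ?q ?p r + G_pp ?g ?q ?p r * t powr (l / 2) * t powr (l / 2)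
      = t powr l * G_rr ?g ?q ?p r"
  proof -
    define a where "a = t powr (l / 4)"
    have a: "a \<noteq> 0" "t \<noteq> 0" using assms by (simp_all add: a_def)
    have e: "2 * ?g / ?p = (l / 2) / (t * a\<^sup>2)"
      using \<gamma>_over_\<phi>[OF assms(1)] by (simp add: a_def)
    have "G_rr ?g ?q ?p r = G_pp ?g ?q ?p r + (l / 2) / (t * a\<^sup>2) * G_p ?g ?q ?p r"
      using euler_poisson_darboux[OF g k] unfolding e by simp
    then show ?thesis
      unfolding powr_quarter[OF assms(1)] a_def[symmetric] using a
      by (simp add: field_simps power2_eq_square power4_eq_xxxx)
  qed
  show "((\<lambda>t. K_t t b r) has_real_derivative t powr l * (c_l l * G_rr ?g ?q ?p r)) (at t)"
    unfolding K_t_def using 4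
    by (intro DERIV_cong[OF DERIV_cmult[OF DERIV_mult[OF 3 2]]]) (simp add: algebra_simps)
  show "((\<lambda>r. K t b r) has_real_derivative c_l l * G_r ?g ?q ?p r) (at r)"
    unfolding K_eq_G by (rule DERIV_cmult[OF DERIV_G(2)[OF g k]])
  show "((\<lambda>r. G_r ?g ?q ?p r) has_real_derivative G_rr ?g ?q ?p r) (at r)"
    by (rule DERIV_G_r[OF g k])
qed

lemma continuous_on_K:
  assumes c: "continuous_on S T" "continuous_on S B" "continuous_on S R"
    and p: "\<And>x. x \<in> S \<Longrightarrow> 0 < T x" "\<And>x. x \<in> S \<Longrightarrow> 0 < B x"
    and k: "\<And>x. x \<in> S \<Longrightarrow> 0 \<le> R x" "\<And>x. x \<in> S \<Longrightarrow> R x < \<phi> l (T x)"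
  shows "continuous_on S (\<lambda>x. K (T x) (B x) (R x))"
    "continuous_on S (\<lambda>x. K_t (T x) (B x) (R x))"
    "continuous_on S (\<lambda>x. G_rr (\<gamma> l) (\<phi> l (B x)) (\<phi> l (T x)) (R x))"
proof -
  have ph: "continuous_on S (\<lambda>x. \<phi> l (T x))" "continuous_on S (\<lambda>x. \<phi> l (B x))"
    using p by (auto intro!: continuous_on_\<phi>_compose c intro: less_imp_le)
  have kd: "kdom (\<phi> l (B x)) (\<phi> l (T x)) (R x)" if "x \<in> S" for x
    using kdom_time[of "B x" "T x" "R x"] p k that by auto
  note G = continuous_on_G[OF \<gamma>_less_half ph(2,1) c(3) kd]
  show "continuous_on S (\<lambda>x. K (T x) (B x) (R x))"
    unfolding K_eq_G by (intro continuous_intros G)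
  have pw: "continuous_on S (\<lambda>x. T x powr (l / 2))"
    by (intro continuous_on_powr continuous_on_const c(1)) (use p(1) in force)
  show "continuous_on S (\<lambda>x. K_t (T x) (B x) (R x))"
    unfolding K_t_def by (intro continuous_on_mult continuous_on_const pw G)
  show "continuous_on S (\<lambda>x. G_rr (\<gamma> l) (\<phi> l (B x)) (\<phi> l (T x)) (R x))"
    by (intro G)
qed

text \<open>The contribution of the source time \<open>b\<close> to the solution at a fixed point in space, where \<open>h\<close> is
  \<open>w(x, \<cdot>; b)\<close>, and the values of its first two derivatives in \<open>t\<close>.\<close>

definition wave :: "real \<Rightarrow> (real \<Rightarrow> complex) \<Rightarrow> real \<Rightarrow> complex" where
  "wave b h t = integral {0..\<phi> l t - \<phi> l b} (\<lambda>r. K t b r *\<^sub>R h r)"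

definition wave_t :: "real \<Rightarrow> (real \<Rightarrow> complex) \<Rightarrow> real \<Rightarrow> complex" where
  "wave_t b h t = (t powr (l / 4) * b powr (- l / 4)) *\<^sub>R h (\<phi> l t - \<phi> l b) +
     integral {0..\<phi> l t - \<phi> l b} (\<lambda>r. K_t t b r *\<^sub>R h r)"

definition wave_tt :: "real \<Rightarrow> (real \<Rightarrow> complex) \<Rightarrow> (real \<Rightarrow> complex) \<Rightarrow> real \<Rightarrow> complex" where
  "wave_tt b h' h'' t = (t powr l) *\<^sub>R (integral {0..\<phi> l t - \<phi> l b} (\<lambda>r. K t b r *\<^sub>R h'' r) + K t b 0 *\<^sub>R h' 0)"

context
  fixes t0 b :: real and h h' h'' :: "real \<Rightarrow> complex"
  assumes b: "0 < b" "b < t0"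
    and h: "\<And>r. r \<in> {0..\<phi> l t0} \<Longrightarrow> (h has_vector_derivative h' r) (at r within {0..\<phi> l t0})"
      "\<And>r. r \<in> {0..\<phi> l t0} \<Longrightarrow> (h' has_vector_derivative h'' r) (at r within {0..\<phi> l t0})"
    and h'': "continuous_on {0..\<phi> l t0} h''"
begin

lemma continuous_on_h: "continuous_on {0..\<phi> l t0} h" "continuous_on {0..\<phi> l t0} h'"
  using continuous_on_vector_derivative[OF h(1)] continuous_on_vector_derivative[OF h(2)] by auto

text \<open>The bound \<open>r \<le> \<phi>(t) - \<phi>(b) / 2\<close> leaves room above the endpoint \<open>\<phi>(t) - \<phi>(b)\<close>, and still gives
  \<open>r < \<phi>(s)\<close> for \<open>s\<close> near \<open>t\<close>, where the kernel is regular.\<close>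

lemma local_rectangle:
  assumes "b < t" "t < t0"
  obtains I where "open I" "convex I" "t \<in> I" "\<And>s. s \<in> I \<Longrightarrow> 0 < s"
    "\<And>s. s \<in> I \<Longrightarrow> \<phi> l t - \<phi> l b / 2 < \<phi> l s"
proof -
  have "isCont (\<phi> l) t"
    using DERIV_\<phi>[of t] b assms by (intro DERIV_isCont) auto
  then obtain d where d: "d > 0" "\<And>s. dist s t < d \<Longrightarrow> dist (\<phi> l s) (\<phi> l t) < \<phi> l b / 2"
    unfolding continuous_at_eps_delta using \<phi>_pos[OF b(1)] by (meson half_gt_zero)
  show ?thesis
  proof (rule that[of "ball t (min d t)"])
    fix s assume s: "s \<in> ball t (min d t)"
    then have "dist s t < d" "\<bar>s - t\<bar> < t" by (auto simp: dist_commute dist_real_def)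
    then show "0 < s" "\<phi> l t - \<phi> l b / 2 < \<phi> l s"
      using d(2)[of s] by (auto simp: dist_real_def abs_if split: if_splits)
  qed (use d assms b in auto)
qed

text \<open>Two applications of the Leibniz rule. In the second derivative \<open>K\<^sub>t\<^sub>t = t\<^sup>l K\<^sub>r\<^sub>r\<close> allows two integrations by parts
  in \<open>r\<close>. At \<open>r = 0\<close> they leave \<open>K h'\<close>, as \<open>K\<^sub>r = 0\<close> there. At the characteristic end all terms cancel:
  those with \<open>h'\<close> by the value of \<open>K\<close>, those with \<open>h\<close> by its derivative along the characteristic.\<close>

lemma has_vector_derivative_wave:
  assumes t: "b < t" "t < t0"
  shows "(wave b h has_vector_derivative wave_t b h t) (at t)" "(wave_t b h has_vector_derivative wave_tt b h' h'' t) (at t)"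
proof -
  have t_pos: "0 < t" using t b by simp
  let ?R = "\<lambda>t. \<phi> l t - \<phi> l b" and ?S = "\<phi> l t - \<phi> l b / 2"
  obtain I where I: "open I" "convex I" "t \<in> I" "\<And>s. s \<in> I \<Longrightarrow> 0 < s"
    "\<And>s. s \<in> I \<Longrightarrow> ?S < \<phi> l s"
    using local_rectangle[OF t] by blast
  have q: "0 < \<phi> l b" and R: "0 < ?R t" "?R t < ?S" and S: "?S \<le> \<phi> l t0" "?R t < \<phi> l t0"
    using \<phi>_pos[OF b(1)] \<phi>_less[of b t] \<phi>_less[of t t0] t b by auto
  have DR: "(?R has_real_derivative t powr (l / 2)) (at t)"
    by (rule DERIV_cong[OF DERIV_diff[OF DERIV_\<phi>[OF t_pos] DERIV_const]]) simp
  have kd: "kdom (\<phi> l b) (\<phi> l s) r" if "s \<in> I" "r \<in> {0..?S}" for s r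
    using kdom_time[of b s r] b that I(4)[of s] I(5)[of s] by auto
  have hc: "continuous_on (I \<times> {0..?S}) (\<lambda>z. h (snd z))"
    by (rule continuous_on_compose2[OF continuous_on_h(1)]) (use S in \<open>auto intro!: continuous_intros\<close>)
  have Kc: "continuous_on (I \<times> {0..?S}) (\<lambda>z. K (fst z) b (snd z))"
      "continuous_on (I \<times> {0..?S}) (\<lambda>z. K_t (fst z) b (snd z))"
      "continuous_on (I \<times> {0..?S}) (\<lambda>z. G_rr (\<gamma> l) (\<phi> l b) (\<phi> l (fst z)) (snd z))"
    using I b by (intro continuous_on_K continuous_intros; force)+
  have powc: "continuous_on (I \<times> {0..?S}) (\<lambda>z. fst z powr l)"
    using I(4) by (intro continuous_intros) force
  have dK: "((\<lambda>s. K s b r *\<^sub>R h r) has_vector_derivative K_t s b r *\<^sub>R h r) (at s)"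
    and dK_t: "((\<lambda>s. K_t s b r *\<^sub>R h r) has_vector_derivative
       (s powr l * (c_l l * G_rr (\<gamma> l) (\<phi> l b) (\<phi> l s) r)) *\<^sub>R h r) (at s)"
    if "s \<in> I" "r \<in> {0..?S}" for s r
    using has_vector_derivative_scaleR[OF DERIV_K(1)[OF I(4)[OF that(1)] kd[OF that]] has_vector_derivative_const[of "h r"]]
      has_vector_derivative_scaleR[OF DERIV_K(2)[OF I(4)[OF that(1)] kd[OF that]] has_vector_derivative_const[of "h r"]]
    by simp_all
  define a where "a = t powr (l / 4)"
  define B where "B = b powr (- l / 4)"
  have a: "a > 0" using t_pos by (simp add: a_def)
  note pw = powr_quarter[OF t_pos, folded a_def]
  have KR: "K t b (?R t) = B / a"
    unfolding K_characteristic[OF t_pos b(1)] pw B_def by simp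
  have "(wave b h has_vector_derivative (t powr (l / 2) *\<^sub>R (K t b (?R t) *\<^sub>R h (?R t)) +
      integral {0..?R t} (\<lambda>r. K_t t b r *\<^sub>R h r))) (at t)"
    unfolding wave_def[abs_def]
    by (rule has_vector_derivative_moving_integral[OF I(1-3) dK _ _ DR R])
      (use hc Kc in \<open>auto simp: split_beta intro!: continuous_intros\<close>)
  moreover have "t powr (l / 2) *\<^sub>R (K t b (?R t) *\<^sub>R h (?R t)) = (t powr (l / 4) * b powr (- l / 4)) *\<^sub>R h (?R t)"
    using a unfolding KR pw a_def[symmetric] B_def[symmetric] by (simp add: power2_eq_square)
  ultimately show "(wave b h has_vector_derivative wave_t b h t) (at t)"
    by (simp only: wave_t_def)
  have 1: "((\<lambda>t. integral {0..?R t} (\<lambda>r. K_t t b r *\<^sub>R h r)) has_vector_derivative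
      (t powr (l / 2) *\<^sub>R (K_t t b (?R t) *\<^sub>R h (?R t)) +
      integral {0..?R t} (\<lambda>r. (t powr l * (c_l l * G_rr (\<gamma> l) (\<phi> l b) (\<phi> l t) r)) *\<^sub>R h r))) (at t)"
    by (rule has_vector_derivative_moving_integral[OF I(1-3) dK_t _ _ DR R])
      (use hc Kc powc in \<open>auto simp: split_beta intro!: continuous_intros\<close>)
  have 2: "((\<lambda>t. h (?R t)) has_vector_derivative t powr (l / 2) *\<^sub>R h' (?R t)) (at t)"
  proof -
    have "(h has_vector_derivative h' (?R t)) (at (?R t) within {0..\<phi> l t0})"
      by (rule h) (use R S in auto)
    then have "(h has_vector_derivative h' (?R t)) (at (?R t))"
      using R S by (subst (asm) at_within_interior) auto
    from vector_diff_chain_at[OF DR[unfolded has_real_derivative_iff_has_vector_derivative] this]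
    show ?thesis by (simp add: o_def)
  qed
  have 3: "((\<lambda>t. t powr (l / 4) * B) has_real_derivative l / 4 * (a / t) * B) (at t)"
    using t_pos pw by (auto intro!: derivative_eq_intros)
  have 4: "((\<lambda>t. (t powr (l / 4) * B) *\<^sub>R h (?R t)) has_vector_derivative
      ((a * B) *\<^sub>R (t powr (l / 2) *\<^sub>R h' (?R t)) + (l / 4 * (a / t) * B) *\<^sub>R h (?R t))) (at t)"
    using has_vector_derivative_scaleR[OF 3 2] by (simp add: a_def)
  let ?Gr = "\<lambda>r. G_r (\<gamma> l) (\<phi> l b) (\<phi> l t) r" and ?Grr = "\<lambda>r. G_rr (\<gamma> l) (\<phi> l b) (\<phi> l t) r"
  let ?J = "integral {0..?R t} (\<lambda>r. K t b r *\<^sub>R h'' r)"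
  have sub: "{0..?R t} \<subseteq> {0..\<phi> l t0}" using S by auto
  have ft: "continuous_on {0..?R t} (\<lambda>r. K t b r)" "continuous_on {0..?R t} ?Grr"
    using t_pos b q by (intro continuous_on_K continuous_intros; force)+
  have hh: "continuous_on {0..?R t} h" "continuous_on {0..?R t} h''"
    using continuous_on_h h'' sub by (auto intro: continuous_on_subset)
  \<comment> \<open>\<open>K\<^sub>r h - K h'\<close> is an antiderivative of \<open>K\<^sub>r\<^sub>r h - K h''\<close>.\<close>
  have 5: "integral {0..?R t} (\<lambda>r. (c_l l * ?Grr r) *\<^sub>R h r) =
      ?J + ((c_l l * ?Gr (?R t)) *\<^sub>R h (?R t) - K t b (?R t) *\<^sub>R h' (?R t)) + K t b 0 *\<^sub>R h' 0"
  proof -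
    have "((\<lambda>r. (c_l l * ?Grr r) *\<^sub>R h r - K t b r *\<^sub>R h'' r) has_integral
        ((c_l l * ?Gr (?R t)) *\<^sub>R h (?R t) - K t b (?R t) *\<^sub>R h' (?R t)) -
        ((c_l l * ?Gr 0) *\<^sub>R h 0 - K t b 0 *\<^sub>R h' 0)) {0..?R t}"
    proof (rule fundamental_theorem_of_calculus)
      fix r assume r: "r \<in> {0..?R t}"
      then have k: "kdom (\<phi> l b) (\<phi> l t) r" using kdom_time[of b t r] b t_pos q by auto
      have d: "(h has_vector_derivative h' r) (at r within {0..?R t})"
        "(h' has_vector_derivative h'' r) (at r within {0..?R t})"
        using h[of r] r sub by (auto intro: has_vector_derivative_within_subset)
      have "((\<lambda>r. (c_l l * ?Gr r) *\<^sub>R h r - K t b r *\<^sub>R h' r) has_vector_derivative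
         ((c_l l * ?Gr r) *\<^sub>R h' r + (c_l l * ?Grr r) *\<^sub>R h r)
          - (K t b r *\<^sub>R h'' r + (c_l l * ?Gr r) *\<^sub>R h' r)) (at r within {0..?R t})"
        by (intro has_vector_derivative_diff has_vector_derivative_scaleR d
            DERIV_cmult DERIV_K[OF t_pos k, THEN has_field_derivative_at_within])
      then show "((\<lambda>r. (c_l l * ?Gr r) *\<^sub>R h r - K t b r *\<^sub>R h' r) has_vector_derivative
         (c_l l * ?Grr r) *\<^sub>R h r - K t b r *\<^sub>R h'' r) (at r within {0..?R t})"
        by simp
    qed (use R in simp)
    then have "integral {0..?R t} (\<lambda>r. (c_l l * ?Grr r) *\<^sub>R h r - K t b r *\<^sub>R h'' r) =
        ((c_l l * ?Gr (?R t)) *\<^sub>R h (?R t) - K t b (?R t) *\<^sub>R h' (?R t)) + K t b 0 *\<^sub>R h' 0"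
      by (simp add: integral_unique G_r_0)
    moreover have "integral {0..?R t} (\<lambda>r. (c_l l * ?Grr r) *\<^sub>R h r - K t b r *\<^sub>R h'' r) =
        integral {0..?R t} (\<lambda>r. (c_l l * ?Grr r) *\<^sub>R h r) - ?J"
      using ft hh by (intro Henstock_Kurzweil_Integration.integral_diff integrable_continuous_real continuous_intros)
    ultimately show ?thesis by (simp add: algebra_simps)
  qed
  have 6: "integral {0..?R t} (\<lambda>r. (t powr l * (c_l l * ?Grr r)) *\<^sub>R h r) =
      (t powr l) *\<^sub>R integral {0..?R t} (\<lambda>r. (c_l l * ?Grr r) *\<^sub>R h r)"
    by (simp flip: scaleR_scaleR)
  \<comment> \<open>The coefficient of \<open>h\<close> at the characteristic end.\<close>
  have 7: "l / 4 * (a / t) * B + t powr (l / 2) * K_t t b (?R t) + t powr l * (c_l l * ?Gr (?R t)) = 0"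
  proof -
    have "c_l l * G_p (\<gamma> l) (\<phi> l b) (\<phi> l t) (?R t) + c_l l * ?Gr (?R t) =
        - (\<gamma> l / \<phi> l t) * (c_l l * (4 * \<phi> l t * \<phi> l b) powr (- \<gamma> l))"
      using kernel_on_characteristic(2)[OF \<gamma>_less_half q \<phi>_pos[OF t_pos]]
      by (simp flip: distrib_left)
    also have "\<dots> = - ((l / 4) / (t * a\<^sup>2)) * (B / a)"
      unfolding c_l_characteristic[OF t_pos b(1)] \<gamma>_over_\<phi>[OF t_pos] pw B_def a_def by simp
    finally have e0: "c_l l * G_p (\<gamma> l) (\<phi> l b) (\<phi> l t) (?R t) + c_l l * ?Gr (?R t) =
      - ((l / 4) / (t * a\<^sup>2)) * (B / a)" .
    have e: "a ^ 4 * (c_l l * G_p (\<gamma> l) (\<phi> l b) (\<phi> l t) (?R t) + c_l l * ?Gr (?R t)) =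
       - (l / 4 * (a / t) * B)"
      unfolding e0 using a t_pos by (simp add: power2_eq_square power4_eq_xxxx)
    show ?thesis
      unfolding K_t_def pw using e by (simp add: algebra_simps power2_eq_square power4_eq_xxxx)
  qed
  \<comment> \<open>The coefficient of \<open>h'\<close> at the characteristic end.\<close>
  have 8: "a * B * t powr (l / 2) - t powr l * K t b (?R t) = 0"
    unfolding KR pw using a by (simp add: power2_eq_square power4_eq_xxxx)
  have collect: "(u1 *\<^sub>R (u2 *\<^sub>R H') + u3 *\<^sub>R H) + (u2 *\<^sub>R (u4 *\<^sub>R H) + u5 *\<^sub>R (J + (u6 *\<^sub>R H - u7 *\<^sub>R H') + E)) =
      (u3 + u2 * u4 + u5 * u6) *\<^sub>R H + (u1 * u2 - u5 * u7) *\<^sub>R H' + u5 *\<^sub>R (J + E)"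
    for u1 u2 u3 u4 u5 u6 u7 :: real and H H' J E :: complex
    by (simp add: algebra_simps)
  have eq: "wave_tt b h' h'' t = ((a * B) *\<^sub>R (t powr (l / 2) *\<^sub>R h' (?R t)) + (l / 4 * (a / t) * B) *\<^sub>R h (?R t)) +
      (t powr (l / 2) *\<^sub>R (K_t t b (?R t) *\<^sub>R h (?R t)) +
      integral {0..?R t} (\<lambda>r. (t powr l * (c_l l * ?Grr r)) *\<^sub>R h r))"
  proof -
    have "((a * B) *\<^sub>R (t powr (l / 2) *\<^sub>R h' (?R t)) + (l / 4 * (a / t) * B) *\<^sub>R h (?R t)) +
      (t powr (l / 2) *\<^sub>R (K_t t b (?R t) *\<^sub>R h (?R t)) +
      integral {0..?R t} (\<lambda>r. (t powr l * (c_l l * ?Grr r)) *\<^sub>R h r)) =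
      (l / 4 * (a / t) * B + t powr (l / 2) * K_t t b (?R t) + t powr l * (c_l l * ?Gr (?R t))) *\<^sub>R h (?R t)
      + (a * B * t powr (l / 2) - t powr l * K t b (?R t)) *\<^sub>R h' (?R t) + wave_tt b h' h'' t"
      unfolding 6 5 wave_tt_def by (rule collect)
    then show ?thesis unfolding 7 8 by simp
  qed
  show "(wave_t b h has_vector_derivative wave_tt b h' h'' t) (at t)"
    unfolding eq using has_vector_derivative_add[OF 4 1] unfolding wave_t_def[abs_def] B_def .
qed

end

end

section \<open>Size and continuity of the inner integrals\<close>

text \<open>After the substitution \<open>r = R z s\<close> the domain of integration is fixed.\<close>

lemma continuous_on_moving_integral:
  fixes F :: "'a::topological_space \<Rightarrow> real \<Rightarrow> 'b::euclidean_space"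
  assumes R: "continuous_on S R" "\<And>z. z \<in> S \<Longrightarrow> 0 \<le> R z"
    and F: "continuous_on {(z, r). z \<in> S \<and> 0 \<le> r \<and> r \<le> R z} (\<lambda>(z, r). F z r)"
  shows "continuous_on S (\<lambda>z. integral {0..R z} (F z))"
proof -
  have "continuous_on (S \<times> {0..1}) (\<lambda>y. (\<lambda>(z, r). F z r) (fst y, R (fst y) * snd y))"
    by (intro continuous_on_compose2[OF F] continuous_intros continuous_on_compose2[OF R(1)])
      (use R(2) in \<open>auto intro: mult_left_le\<close>)
  then have "continuous_on S (\<lambda>z. integral (cbox 0 1) (\<lambda>s. F z (R z * s)))"
    by (intro integral_continuous_on_param) (simp add: split_beta)
  then have "continuous_on S (\<lambda>z. R z *\<^sub>R integral (cbox 0 1) (\<lambda>s. F z (R z * s)))"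
    by (intro continuous_intros R)
  moreover have "R z *\<^sub>R integral (cbox 0 1) (\<lambda>s. F z (R z * s)) = integral {0..R z} (F z)" if z: "z \<in> S" for z
  proof (cases "R z = 0")
    case False
    then have pos: "R z > 0" using R(2)[OF z] by simp
    have "continuous_on {0..R z} (\<lambda>r. (\<lambda>(z, r). F z r) (z, r))"
      by (intro continuous_on_compose2[OF F] continuous_intros) (use z in auto)
    then have "(F z has_integral integral {0..R z} (F z)) {0..R z}"
      by (intro integrable_integral integrable_continuous_real) simp
    from has_integral_stretch_real[OF this, of "R z"] pos
    have "((\<lambda>s. F z (R z * s)) has_integral (1 / R z) *\<^sub>R integral {0..R z} (F z)) ((\<lambda>s. s / R z) ` {0..R z})"
      by simp
    moreover have "(\<lambda>s. s / R z) ` {0..R z} = {0..1}"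
      using image_divide_atLeastAtMost[OF pos, of 0 "R z"] pos by simp
    ultimately have "integral (cbox 0 1) (\<lambda>s. F z (R z * s)) = (1 / R z) *\<^sub>R integral {0..R z} (F z)"
      by (simp add: integral_unique)
    then show ?thesis using pos by simp
  qed simp
  ultimately show ?thesis by (simp cong: continuous_on_cong)
qed

context
  fixes g :: real
  assumes g: "g < 1 / 2"
begin

lemma kernel_geometry:
  assumes "0 < q" "q \<le> p" "0 \<le> r" "r \<le> p - q"
  shows "0 < kD q p r" "kD q p r \<le> 4 * p\<^sup>2" "p * (p + q - r) \<le> kD q p r"
    "0 \<le> kz q p r" "kz q p r < 1" "0 < p" "r < p"
proof -
  show p: "0 < p" "r < p" using assms by auto
  have f: "kD q p r = (p + q - r) * (p + q + r)" by (simp add: kD_def power2_eq_square algebra_simps)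
  show D: "0 < kD q p r" unfolding f using assms by (intro mult_pos_pos) auto
  have "(p + q)\<^sup>2 \<le> (2 * p)\<^sup>2" using assms by (intro power_mono) auto
  then show "kD q p r \<le> 4 * p\<^sup>2" by (simp add: kD_def power_mult_distrib) (smt (verit) zero_le_power2)
  have "(p + q - r) * p \<le> (p + q - r) * (p + q + r)" using assms by (intro mult_left_mono) auto
  then show "p * (p + q - r) \<le> kD q p r" by (simp add: f mult.commute)
  have "r\<^sup>2 \<le> (p - q)\<^sup>2" using assms by (intro power_mono) auto
  then show "0 \<le> kz q p r" unfolding kz_def using D by simp
  have "0 < 4 * p * q / kD q p r" using D p assms by simp
  then show "kz q p r < 1" using one_minus_kz[of q p r] D by simp
qed

text \<open>As \<open>p (p + q - r) \<le> kD \<le> 4 p\<^sup>2\<close>, a power with any exponent \<open>- d\<close>, of either sign, is split as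
  \<open>kD\<^sup>-\<^sup>e kD\<^sup>e\<^sup>-\<^sup>d\<close> with \<open>0 \<le> e\<close> and \<open>d \<le> e\<close>; the lower bound is applied to the first factor, the upper one to
  the second.\<close>

lemma kD_powr_bound:
  assumes "0 < q" "q \<le> p" "0 \<le> r" "r \<le> p - q" and e: "0 \<le> e" "d \<le> e"
  shows "kD q p r powr (- d) \<le> 4 powr (e - d) * (p powr (e - 2 * d) * (p + q - r) powr (- e))"
proof -
  note k = kernel_geometry[OF assms(1-4)]
  have pr: "0 < p * (p + q - r)" using k assms by (intro mult_pos_pos) auto
  have "kD q p r powr (- d) = kD q p r powr (- e) * kD q p r powr (e - d)"
    by (simp flip: powr_add)
  also have "\<dots> \<le> (p * (p + q - r)) powr (- e) * (4 * p\<^sup>2) powr (e - d)"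
    using k e pr by (intro mult_mono powr_mono2 powr_mono2') auto
  also have "\<dots> = (p powr (- e) * (p + q - r) powr (- e)) * (4 powr (e - d) * p powr (2 * (e - d)))"
    using k assms by (simp add: powr_mult powr_power power2_eq_square flip: powr_add)
  also have "\<dots> = 4 powr (e - d) * ((p powr (- e) * p powr (2 * (e - d))) * (p + q - r) powr (- e))"
    by (simp add: mult_ac)
  also have "p powr (- e) * p powr (2 * (e - d)) = p powr (e - 2 * d)"
    by (simp add: algebra_simps flip: powr_add)
  finally show ?thesis .
qed

text \<open>The exponent \<open>1/2\<close> exceeds \<open>g\<close> and keeps the singularity at \<open>r = p\<close> integrable.\<close>

lemma G_bound:
  obtains C where "C > 0" "\<And>q p r. 0 < q \<Longrightarrow> q \<le> p \<Longrightarrow> 0 \<le> r \<Longrightarrow> r \<le> p - q \<Longrightarrow>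
    \<bar>G g q p r\<bar> \<le> C * (p powr (1 / 2 - 2 * g) * (p - r) powr (- (1 / 2)))"
proof -
  obtain C where C: "C > 0" "\<And>z. 0 \<le> z \<Longrightarrow> z < 1 \<Longrightarrow> \<bar>hyp g z\<bar> \<le> C"
    using hyp_bounded[OF g] by blast
  show ?thesis
  proof (rule that[of "C * 4 powr (1 / 2 - g)"])
    fix q p r :: real assume a: "0 < q" "q \<le> p" "0 \<le> r" "r \<le> p - q"
    note k = kernel_geometry[OF a]
    have "\<bar>G g q p r\<bar> = kD q p r powr (- g) * \<bar>hyp g (kz q p r)\<bar>"
      by (simp add: G_def abs_mult)
    also have "\<dots> \<le> (4 powr (1 / 2 - g) * (p powr (1 / 2 - 2 * g) * (p - r) powr (- (1 / 2)))) * C"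
    proof (intro mult_mono C)
      have "(p + q - r) powr - (1 / 2) \<le> (p - r) powr - (1 / 2)"
        using a k by (intro powr_mono2') auto
      then have "4 powr (1 / 2 - g) * (p powr (1 / 2 - 2 * g) * (p + q - r) powr (- (1 / 2)))
        \<le> 4 powr (1 / 2 - g) * (p powr (1 / 2 - 2 * g) * (p - r) powr (- (1 / 2)))"
        by (intro mult_left_mono) auto
      moreover have "kD q p r powr (- g) \<le> 4 powr (1 / 2 - g) * (p powr (1 / 2 - 2 * g) * (p + q - r) powr (- (1 / 2)))"
        by (rule kD_powr_bound[OF a]) (use g in auto)
      ultimately show "kD q p r powr (- g) \<le> 4 powr (1 / 2 - g) * (p powr (1 / 2 - 2 * g) * (p - r) powr (- (1 / 2)))"
        by (rule order_trans[rotated])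
    qed (use k in auto)
    finally show "\<bar>G g q p r\<bar> \<le> C * 4 powr (1 / 2 - g) * (p powr (1 / 2 - 2 * g) * (p - r) powr (- (1 / 2)))"
      by (simp add: mult_ac)
  qed (use C in simp)
qed

text \<open>The derivative of \<open>kz\<close> contains the factor \<open>1 - kz\<close>, which compensates the blow-up of \<open>F'\<close> at \<open>1\<close>. So \<open>G\<^sub>p\<close>
  is of the size \<open>p kD\<^sup>-\<^sup>g\<^sup>-\<^sup>1\<close> of the derivative of the power.\<close>

lemma G_p_bound:
  assumes e: "0 \<le> e" "g \<le> e"
  obtains C where "C > 0" "\<And>q p r. 0 < q \<Longrightarrow> q \<le> p \<Longrightarrow> 0 \<le> r \<Longrightarrow> r \<le> p - q \<Longrightarrow>
    \<bar>G_p g q p r\<bar> \<le> C * (p powr (e - 2 * g) * (p + q - r) powr (- e - 1))"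
proof -
  obtain C0 where C0: "C0 > 0" "\<And>z. 0 \<le> z \<Longrightarrow> z < 1 \<Longrightarrow> \<bar>hyp g z\<bar> \<le> C0"
    using hyp_bounded[OF g] by blast
  obtain C1 where C1: "C1 > 0" "\<And>z. 0 \<le> z \<Longrightarrow> z < 1 \<Longrightarrow> \<bar>hyp' g z\<bar> * (1 - z) \<le> C1"
    using hyp'_bounded[OF g] by blast
  let ?C = "4 * \<bar>g\<bar> * C0 + 2 * C1"
  show ?thesis
  proof (rule that[of "?C * 4 powr (e - g)"])
    have "?C > 0" using C0 C1 by (intro add_nonneg_pos) auto
    then show "?C * 4 powr (e - g) > 0" by simp
    fix q p r :: real assume a: "0 < q" "q \<le> p" "0 \<le> r" "r \<le> p - q"
    note k = kernel_geometry[OF a]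
    let ?D = "kD q p r" and ?z = "kz q p r"
    have z: "1 - ?z = 4 * p * q / ?D" using one_minus_kz[of q p r] k by simp
    have 1: "\<bar>- 2 * g * (p + q) / ?D * hyp g ?z\<bar> \<le> (4 * \<bar>g\<bar> * C0) * (p / ?D)"
    proof -
      have "\<bar>- 2 * g * (p + q) / ?D * hyp g ?z\<bar> = (2 * \<bar>g\<bar> * (p + q) / ?D) * \<bar>hyp g ?z\<bar>"
        using k a by (simp add: abs_mult)
      also have "\<dots> \<le> (2 * \<bar>g\<bar> * (2 * p) / ?D) * C0"
        using k a by (intro mult_mono C0 divide_right_mono mult_left_mono) auto
      finally show ?thesis by (simp add: mult_ac)
    qed
    have 2: "\<bar>kz_p q p r * hyp' g ?z\<bar> \<le> (2 * C1) * (p / ?D)"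
    proof -
      have q2: "q\<^sup>2 \<le> p\<^sup>2" and r2: "r\<^sup>2 \<le> p\<^sup>2" using a k by (auto intro: power_mono)
      have n: "p\<^sup>2 - q\<^sup>2 + r\<^sup>2 \<le> 2 * p\<^sup>2" "0 \<le> p\<^sup>2 - q\<^sup>2 + r\<^sup>2"
        using q2 r2 zero_le_power2[of q] zero_le_power2[of r] by linarith+
      have "kz_p q p r = ((p\<^sup>2 - q\<^sup>2 + r\<^sup>2) / (p * ?D)) * (1 - ?z)"
        unfolding z kz_p_def using k by (simp add: field_simps power2_eq_square)
      then have "\<bar>kz_p q p r * hyp' g ?z\<bar> = ((p\<^sup>2 - q\<^sup>2 + r\<^sup>2) / (p * ?D)) * (\<bar>hyp' g ?z\<bar> * (1 - ?z))"
        using k q2 by (simp add: abs_mult)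
      also have "\<dots> \<le> (2 * p\<^sup>2 / (p * ?D)) * C1"
        using k a n by (intro mult_mono C1 divide_right_mono) auto
      also have "\<dots> = (2 * C1) * (p / ?D)"
        using k by (simp add: power2_eq_square)
      finally show ?thesis .
    qed
    have 3: "\<bar>- 2 * g * (p + q) / ?D * hyp g ?z + kz_p q p r * hyp' g ?z\<bar> \<le> ?C * (p / ?D)"
      unfolding distrib_right by (rule order_trans[OF abs_triangle_ineq add_mono[OF 1 2]])
    have "\<bar>G_p g q p r\<bar> = ?D powr (- g) * \<bar>- 2 * g * (p + q) / ?D * hyp g ?z + kz_p q p r * hyp' g ?z\<bar>"
      by (simp add: G_p_def abs_mult)
    also have "\<dots> \<le> ?D powr (- g) * (?C * (p / ?D))"
      by (intro mult_left_mono 3) simp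
    also have "\<dots> = ?C * (p * ?D powr (- (g + 1)))"
    proof -
      have "?D powr (- (g + 1)) = ?D powr (- g - 1)" by simp
      also have "\<dots> = ?D powr (- g) / ?D" using k(1) by (simp only: powr_diff) simp
      finally show ?thesis by simp
    qed
    also have "\<dots> \<le> ?C * (p * (4 powr (e + 1 - (g + 1)) * (p powr (e + 1 - 2 * (g + 1)) * (p + q - r) powr (- (e + 1)))))"
      using k e C0 C1 by (intro mult_left_mono kD_powr_bound[OF a]) auto
    also have "\<dots> = ?C * 4 powr (e - g) * ((p powr 1 * p powr (e - 1 - 2 * g)) * (p + q - r) powr (- e - 1))"
    proof -
      have "e + 1 - (g + 1) = e - g" "e + 1 - 2 * (g + 1) = e - 1 - 2 * g" "- (e + 1) = - e - 1"
        by simp_all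
      moreover have "p powr 1 = p" using k by simp
      ultimately show ?thesis by (simp only: mult_ac)
    qed
    also have "p powr 1 * p powr (e - 1 - 2 * g) = p powr (e - 2 * g)"
      by (simp only: powr_add[symmetric]) simp
    finally show "\<bar>G_p g q p r\<bar> \<le> ?C * 4 powr (e - g) * (p powr (e - 2 * g) * (p + q - r) powr (- e - 1))" .
  qed
qed

end

lemma integral_powr_below_singularity:
  fixes c R e :: real
  assumes "0 \<le> R" "R < c" "e \<noteq> 1"
  shows "((\<lambda>r. (c - r) powr (- e)) has_integral (c powr (1 - e) - (c - R) powr (1 - e)) / (1 - e)) {0..R}"
proof -
  have "((\<lambda>r. (c - r) powr (- e)) has_integral
    (- ((c - R) powr (1 - e) / (1 - e))) - (- ((c - 0) powr (1 - e) / (1 - e)))) {0..R}"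
  proof (rule fundamental_theorem_of_calculus)
    fix r assume r: "r \<in> {0..R}"
    have "((\<lambda>r. - ((c - r) powr (1 - e) / (1 - e))) has_real_derivative (c - r) powr (- e)) (at r)"
      using r assms by (auto intro!: derivative_eq_intros)
    then show "((\<lambda>r. - ((c - r) powr (1 - e) / (1 - e))) has_vector_derivative (c - r) powr (- e)) (at r within {0..R})"
      unfolding has_real_derivative_iff_has_vector_derivative[symmetric] by (rule has_field_derivative_at_within)
  qed (use assms in simp)
  then show ?thesis by (simp add: diff_divide_distrib)
qed

context
  fixes l :: real
  assumes l: "l > - 2"
begin

lemma \<phi>_powr: "0 < t \<Longrightarrow> \<phi> l t powr e = (2 / (l + 2)) powr e * t powr ((l + 2) / 2 * e)"
proof -
  assume t: "0 < t"
  have "(2 / (l + 2) * t powr ((l + 2) / 2)) powr e = (2 / (l + 2)) powr e * (t powr ((l + 2) / 2)) powr e"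
    by (rule powr_mult)
  then show ?thesis unfolding \<phi>_def powr_powr .
qed

text \<open>With \<open>M\<close> a bound for the data, the inner integral is of size \<open>M t\<close> uniformly in the source time: it
  is homogeneous of degree \<open>1 - 2\<gamma>\<close> in \<open>\<phi>(t)\<close>, and \<open>\<phi>(t)\<^sup>1\<^sup>-\<^sup>2\<^sup>\<gamma>\<close> is a multiple of \<open>t\<close>.\<close>

lemma inner_integral_bound:
  obtains C where "C > 0" "\<And>t b h M. 0 < b \<Longrightarrow> b \<le> t \<Longrightarrow> continuous_on {0..\<phi> l t - \<phi> l b} h \<Longrightarrow>
    (\<And>r. r \<in> {0..\<phi> l t - \<phi> l b} \<Longrightarrow> norm (h r :: complex) \<le> M) \<Longrightarrow>
    norm (integral {0..\<phi> l t - \<phi> l b} (\<lambda>r. K l t b r *\<^sub>R h r)) \<le> C * M * t"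
proof -
  let ?g = "\<gamma> l"
  obtain C where C: "C > 0" "\<And>q p r. 0 < q \<Longrightarrow> q \<le> p \<Longrightarrow> 0 \<le> r \<Longrightarrow> r \<le> p - q \<Longrightarrow>
      \<bar>G ?g q p r\<bar> \<le> C * (p powr (1 / 2 - 2 * ?g) * (p - r) powr (- (1 / 2)))"
    using G_bound[OF \<gamma>_less_half[OF l]] by blast
  let ?c = "\<bar>c_l l\<bar> * C"
  define A where "A = (2 / (l + 2)) powr (1 - 2 * ?g)"
  show ?thesis
  proof (rule that[of "?c * (2 * A)"])
    have "c_l l > 0" using l by (simp add: c_l_def)
    then show "?c * (2 * A) > 0" using C l by (simp add: A_def)
    fix t b M :: real and h :: "real \<Rightarrow> complex"
    assume b: "0 < b" "b \<le> t" and h: "continuous_on {0..\<phi> l t - \<phi> l b} h"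
      "\<And>r. r \<in> {0..\<phi> l t - \<phi> l b} \<Longrightarrow> norm (h r) \<le> M"
    let ?p = "\<phi> l t" and ?q = "\<phi> l b"
    have pq: "0 < ?q" "?q \<le> ?p" using \<phi>_pos[OF l b(1)] \<phi>_le[OF l _ b(2)] b by auto
    have t: "0 < t" using b by simp
    have "norm (h 0) \<le> M" using h(2)[of 0] pq by auto
    then have M: "0 \<le> M" using norm_ge_zero order_trans by blast
    have Kc: "continuous_on {0..?p - ?q} (\<lambda>r. K l t b r)"
      by (intro continuous_on_K[OF l] continuous_intros) (use b pq in auto)
    have i: "((\<lambda>r. (?p - r) powr (- (1 / 2))) has_integral (?p powr (1 / 2) - ?q powr (1 / 2)) * 2) {0..?p - ?q}"
      using integral_powr_below_singularity[of "?p - ?q" ?p "1 / 2"] pq by simp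
    have i': "((\<lambda>r. (?c * M * ?p powr (1 / 2 - 2 * ?g)) * (?p - r) powr (- (1 / 2))) has_integral
        (?c * M * ?p powr (1 / 2 - 2 * ?g)) * ((?p powr (1 / 2) - ?q powr (1 / 2)) * 2)) {0..?p - ?q}"
      by (rule has_integral_mult_right[OF i])
    have "norm (integral {0..?p - ?q} (\<lambda>r. K l t b r *\<^sub>R h r))
      \<le> integral {0..?p - ?q} (\<lambda>r. (?c * M * ?p powr (1 / 2 - 2 * ?g)) * (?p - r) powr (- (1 / 2)))"
    proof (rule integral_norm_bound_integral)
      show "(\<lambda>r. K l t b r *\<^sub>R h r) integrable_on {0..?p - ?q}"
        by (intro integrable_continuous_real continuous_intros Kc h)
      fix r assume r: "r \<in> {0..?p - ?q}"
      have "norm (K l t b r *\<^sub>R h r) = \<bar>c_l l\<bar> * \<bar>G ?g ?q ?p r\<bar> * norm (h r)"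
        by (simp add: K_eq_G[OF l] abs_mult)
      also have "\<dots> \<le> (\<bar>c_l l\<bar> * (C * (?p powr (1 / 2 - 2 * ?g) * (?p - r) powr (- (1 / 2))))) * M"
        using C(2)[of ?q ?p r] pq r h(2)[OF r] C(1) by (intro mult_mono mult_left_mono) auto
      finally show "norm (K l t b r *\<^sub>R h r) \<le> (?c * M * ?p powr (1 / 2 - 2 * ?g)) * (?p - r) powr (- (1 / 2))"
        by (simp add: mult_ac)
    qed (use i' in blast)
    also have "\<dots> = (?c * M * ?p powr (1 / 2 - 2 * ?g)) * ((?p powr (1 / 2) - ?q powr (1 / 2)) * 2)"
      by (rule integral_unique[OF i'])
    also have "\<dots> \<le> (?c * M * ?p powr (1 / 2 - 2 * ?g)) * (?p powr (1 / 2) * 2)"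
      using C M by (intro mult_left_mono mult_right_mono) auto
    also have "\<dots> = ?c * M * 2 * (?p powr (1 / 2 - 2 * ?g) * ?p powr (1 / 2))"
      by (simp add: mult_ac)
    also have "?p powr (1 / 2 - 2 * ?g) * ?p powr (1 / 2) = ?p powr (1 - 2 * ?g)"
      by (simp flip: powr_add)
    also have "\<dots> = A * t powr ((l + 2) / 2 * (1 - 2 * ?g))"
      using \<phi>_powr[OF t] by (simp add: A_def)
    also have "(l + 2) / 2 * (1 - 2 * ?g) = 1"
      using l by (simp add: \<gamma>_def field_simps)
    finally show "norm (integral {0..?p - ?q} (\<lambda>r. K l t b r *\<^sub>R h r)) \<le> ?c * (2 * A) * M * t"
      using t by (simp add: mult_ac)
  qed
qed

text \<open>The integral of \<open>\<bar>K\<^sub>t\<bar>\<close> is homogeneous of degree \<open>0\<close> in \<open>(t, b)\<close> and is therefore controlled by the ratio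
  alone. It grows as \<open>b \<rightarrow> 0\<close>, where the singularity of the kernel reaches the domain of integration.\<close>

lemma inner_integral_K_t_bound:
  assumes k: "0 < k" "l / 4 \<le> k"
  obtains C where "C > 0" "\<And>t b h M. 0 < b \<Longrightarrow> b \<le> t \<Longrightarrow> continuous_on {0..\<phi> l t - \<phi> l b} h \<Longrightarrow>
    (\<And>r. r \<in> {0..\<phi> l t - \<phi> l b} \<Longrightarrow> norm (h r :: complex) \<le> M) \<Longrightarrow>
    norm (integral {0..\<phi> l t - \<phi> l b} (\<lambda>r. K_t l t b r *\<^sub>R h r)) \<le> C * M * (t / b) powr k"
proof -
  let ?g = "\<gamma> l"
  define e where "e = k * 2 / (l + 2)"
  have "?g = l / 4 * (2 / (l + 2))" using l by (simp add: \<gamma>_def field_simps)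
  also have "\<dots> \<le> k * (2 / (l + 2))" using k l by (intro mult_right_mono) auto
  finally have e: "0 < e" "?g \<le> e" using k l by (auto simp: e_def)
  have ek: "(l + 2) / 2 * e = k" and gl: "(l + 2) / 2 * (2 * ?g) = l / 2"
    using k l by (auto simp: e_def \<gamma>_def field_simps)
  obtain C where C: "C > 0" "\<And>q p r. 0 < q \<Longrightarrow> q \<le> p \<Longrightarrow> 0 \<le> r \<Longrightarrow> r \<le> p - q \<Longrightarrow>
      \<bar>G_p ?g q p r\<bar> \<le> C * (p powr (e - 2 * ?g) * (p + q - r) powr (- e - 1))"
    using G_p_bound[OF \<gamma>_less_half[OF l], of e] e by auto
  let ?c = "\<bar>c_l l\<bar> * C"
  define A where "A = (2 / (l + 2)) powr (- 2 * ?g)"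
  show ?thesis
  proof (rule that[of "?c * A / e"])
    have "c_l l > 0" using l by (simp add: c_l_def)
    then show "?c * A / e > 0" using C l e by (simp add: A_def)
    fix t b M :: real and h :: "real \<Rightarrow> complex"
    assume b: "0 < b" "b \<le> t" and h: "continuous_on {0..\<phi> l t - \<phi> l b} h"
      "\<And>r. r \<in> {0..\<phi> l t - \<phi> l b} \<Longrightarrow> norm (h r) \<le> M"
    let ?p = "\<phi> l t" and ?q = "\<phi> l b"
    have pq: "0 < ?q" "?q \<le> ?p" using \<phi>_pos[OF l b(1)] \<phi>_le[OF l _ b(2)] b by auto
    have t: "0 < t" using b by simp
    have "norm (h 0) \<le> M" using h(2)[of 0] pq by auto
    then have M: "0 \<le> M" using norm_ge_zero order_trans by blast
    have Kc: "continuous_on {0..?p - ?q} (\<lambda>r. K_t l t b r)"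
      by (intro continuous_on_K[OF l] continuous_intros) (use b pq in auto)
    let ?I = "((?p + ?q) powr (- e) - (2 * ?q) powr (- e)) / (- e)"
    have i: "((\<lambda>r. (?p + ?q - r) powr (- e - 1)) has_integral ?I) {0..?p - ?q}"
      using integral_powr_below_singularity[of "?p - ?q" "?p + ?q" "e + 1"] pq e by simp
    have I: "?I \<le> ?q powr (- e) / e"
    proof -
      have "(2 * ?q) powr (- e) \<le> ?q powr (- e)" using pq e by (intro powr_mono2') auto
      then have "(2 * ?q) powr (- e) - (?p + ?q) powr (- e) \<le> ?q powr (- e)"
        using powr_ge_zero[of "?p + ?q" "- e"] by linarith
      moreover have "?I = ((2 * ?q) powr (- e) - (?p + ?q) powr (- e)) / e"
        by (simp add: minus_divide_right[symmetric] diff_divide_distrib)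
      ultimately show ?thesis using e by (simp only: divide_right_mono less_imp_le)
    qed
    let ?B = "?c * M * (t powr (l / 2) * ?p powr (e - 2 * ?g))"
    have i': "((\<lambda>r. ?B * (?p + ?q - r) powr (- e - 1)) has_integral ?B * ?I) {0..?p - ?q}"
      by (rule has_integral_mult_right[OF i])
    have "norm (integral {0..?p - ?q} (\<lambda>r. K_t l t b r *\<^sub>R h r))
      \<le> integral {0..?p - ?q} (\<lambda>r. ?B * (?p + ?q - r) powr (- e - 1))"
    proof (rule integral_norm_bound_integral)
      show "(\<lambda>r. K_t l t b r *\<^sub>R h r) integrable_on {0..?p - ?q}"
        by (intro integrable_continuous_real continuous_intros Kc h)
      fix r assume r: "r \<in> {0..?p - ?q}"
      have "norm (K_t l t b r *\<^sub>R h r) = \<bar>c_l l\<bar> * (t powr (l / 2) * \<bar>G_p ?g ?q ?p r\<bar>) * norm (h r)"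
        by (simp add: K_t_def[OF l] abs_mult)
      also have "\<dots> \<le> (\<bar>c_l l\<bar> * (t powr (l / 2) * (C * (?p powr (e - 2 * ?g) * (?p + ?q - r) powr (- e - 1))))) * M"
        using C(2)[of ?q ?p r] pq r h(2)[OF r] C(1) by (intro mult_mono mult_left_mono) auto
      finally show "norm (K_t l t b r *\<^sub>R h r) \<le> ?B * (?p + ?q - r) powr (- e - 1)"
        by (simp add: mult_ac)
    qed (use i' in blast)
    also have "\<dots> = ?B * ?I"
      by (rule integral_unique[OF i'])
    also have "\<dots> \<le> ?B * (?q powr (- e) / e)"
      using C M by (intro mult_left_mono I) auto
    also have "?p powr (e - 2 * ?g) = A * (2 / (l + 2)) powr e * t powr (k - l / 2)"
    proof -
      have "(l + 2) / 2 * (e - 2 * ?g) = k - l / 2"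
        using ek gl by (simp add: right_diff_distrib)
      moreover have "(2 / (l + 2)) powr (e - 2 * ?g) = A * (2 / (l + 2)) powr e"
        by (simp add: A_def flip: powr_add)
      ultimately show ?thesis using \<phi>_powr[OF t, of "e - 2 * ?g"] by (simp only:)
    qed
    also have "?q powr (- e) = (2 / (l + 2)) powr (- e) * b powr (- k)"
      using \<phi>_powr[OF b(1), of "- e"] ek by simp
    also have "?c * M * (t powr (l / 2) * (A * (2 / (l + 2)) powr e * t powr (k - l / 2))) *
        ((2 / (l + 2)) powr (- e) * b powr (- k) / e) =
        (?c * A / e) * M * (((2 / (l + 2)) powr e * (2 / (l + 2)) powr (- e)) *
          ((t powr (l / 2) * t powr (k - l / 2)) * b powr (- k)))"
      by (simp add: mult_ac)
    also have "(2 / (l + 2)) powr e * (2 / (l + 2)) powr (- e) = 1"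
      using l by (simp flip: powr_add)
    also have "t powr (l / 2) * t powr (k - l / 2) = t powr k"
      by (simp flip: powr_add)
    also have "1 * (t powr k * b powr (- k)) = (t / b) powr k"
      using t b by (simp add: powr_divide powr_minus_divide)
    finally show "norm (integral {0..?p - ?q} (\<lambda>r. K_t l t b r *\<^sub>R h r)) \<le> ?c * A / e * M * (t / b) powr k" .
  qed
qed

end

section \<open>Integrals over the source time\<close>

text \<open>The closed intervals in the definition of the transform contain \<open>b = 0\<close>, where the kernel is evaluated
  outside its region of regularity. All integrals are therefore passed to open intervals.\<close>

lemma set_integral_Icc_eq_Ioo:
  fixes f :: "real \<Rightarrow> 'b::{banach, second_countable_topology}"
  shows "set_integrable lborel {a..b} f \<longleftrightarrow> set_integrable lborel {a<..<b} f"
    "(LBINT x:{a..b}. f x) = (LBINT x:{a<..<b}. f x)"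
  unfolding set_integrable_def set_lebesgue_integral_def
  by (rule integrable_discrete_difference[where X = "{a, b}"], auto simp: indicator_def)
    (rule integral_discrete_difference[where X = "{a, b}"], auto simp: indicator_def)

lemma continuous_on_triple_slice:
  assumes "continuous_on S (\<lambda>(x, t, b). F x t b)" "continuous_on A f1" "continuous_on A f2" "continuous_on A f3"
    "\<And>y. y \<in> A \<Longrightarrow> (f1 y, f2 y, f3 y) \<in> S"
  shows "continuous_on A (\<lambda>y. F (f1 y) (f2 y) (f3 y))"
  using continuous_on_compose2[OF assms(1) continuous_on_Pair[OF assms(2) continuous_on_Pair[OF assms(3,4)]]]
    assms(5) by (auto simp: image_subset_iff)

text \<open>The substitution \<open>b = t s\<close> makes the domain of integration independent of \<open>t\<close>; dominated
  convergence then gives continuity.\<close>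

context
  fixes F :: "'a::euclidean_space \<Rightarrow> real \<Rightarrow> real \<Rightarrow> complex" and W :: "('a \<times> real) set" and g :: "real \<Rightarrow> real"
  assumes pos: "\<And>x t. (x, t) \<in> W \<Longrightarrow> 0 < t"
    and cont: "continuous_on {(x, t, b). (x, t) \<in> W \<and> 0 < b \<and> b < t} (\<lambda>(x, t, b). F x t b)"
    and dom: "\<And>C. compact C \<Longrightarrow> C \<subseteq> W \<Longrightarrow>
      \<exists>M. \<forall>x t s. (x, t) \<in> C \<longrightarrow> s \<in> {0<..<1} \<longrightarrow> norm (F x t (t * s)) \<le> M * g s"
    and g: "set_integrable lborel {0<..<1} g"
begin

lemma source_time_measurable:
  assumes "(x, t) \<in> W"
  shows "(\<lambda>s. indicator {0<..<1} s *\<^sub>R F x t (t * s)) \<in> borel_measurable borel"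
  by (rule borel_measurable_continuous_on_indicator)
    (use pos[OF assms] assms in \<open>auto intro!: continuous_on_triple_slice[OF cont] continuous_intros\<close>)

lemma source_time_dominated:
  assumes "(x, t) \<in> W"
  shows "integrable lborel (\<lambda>s. indicator {0<..<1} s *\<^sub>R F x t (t * s))"
proof -
  obtain M where M: "\<And>s. s \<in> {0<..<1} \<Longrightarrow> norm (F x t (t * s)) \<le> M * g s"
    using dom[of "{(x, t)}"] assms by auto
  have "integrable lborel (\<lambda>s. M *\<^sub>R (indicator {0<..<1} s *\<^sub>R g s))"
    using g unfolding set_integrable_def by (rule integrable_scaleR_right)
  then show ?thesis
    by (rule Bochner_Integration.integrable_bound)
      (use source_time_measurable[OF assms] M in \<open>auto simp: indicator_def intro: order_trans[OF _ abs_ge_self]\<close>)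
qed

lemma source_time_scaling:
  assumes W: "(x, t) \<in> W"
  shows "set_integrable lborel {0..t} (F x t)"
    "(LBINT b:{0..t}. F x t b) = t *\<^sub>R (LBINT s. indicator {0<..<1} s *\<^sub>R F x t (t * s))"
proof -
  have t: "0 < t" by (rule pos[OF W])
  have e: "(\<lambda>s. indicator {0<..<t} (0 + t * s) *\<^sub>R F x t (0 + t * s)) = (\<lambda>s. indicator {0<..<1} s *\<^sub>R F x t (t * s))"
    using t by (auto simp: fun_eq_iff indicator_def zero_less_mult_iff)
  show "set_integrable lborel {0..t} (F x t)"
    unfolding set_integral_Icc_eq_Ioo(1) unfolding set_integrable_def
    using source_time_dominated[OF W] t
    by (subst lborel_integrable_real_affine_iff[of t _ 0, symmetric]) (simp_all only: e)
  show "(LBINT b:{0..t}. F x t b) = t *\<^sub>R (LBINT s. indicator {0<..<1} s *\<^sub>R F x t (t * s))"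
    unfolding set_integral_Icc_eq_Ioo(2) unfolding set_lebesgue_integral_def
    using t by (subst lborel_integral_real_affine[of t _ 0]) (simp_all only: e, simp)
qed

lemma continuous_on_source_time_integral:
  "continuous_on W (\<lambda>(x, t). LBINT b:{0..t}. F x t b)"
  unfolding continuous_on_sequentially
proof (intro allI ballI impI, elim conjE)
  fix z :: "nat \<Rightarrow> 'a \<times> real" and a assume a: "a \<in> W" and z: "\<forall>n. z n \<in> W" "z \<longlonglongrightarrow> a"
  let ?C = "insert a (range z)"
  have "compact ?C" by (rule compact_sequence_with_limit[OF z(2)])
  moreover have CW: "?C \<subseteq> W" using a z by auto
  ultimately obtain M where M: "\<And>x t s. (x, t) \<in> ?C \<Longrightarrow> s \<in> {0<..<1} \<Longrightarrow> norm (F x t (t * s)) \<le> M * g s"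
    using dom by meson
  let ?f = "\<lambda>y s. indicator {0<..<1} s *\<^sub>R F (fst y) (snd y) (snd y * s)"
  have m: "?f y \<in> borel_measurable lborel" if "y \<in> W" for y
    using source_time_measurable[of "fst y" "snd y"] that by simp
  have "(\<lambda>n. LBINT s. ?f (z n) s) \<longlonglongrightarrow> (LBINT s. ?f a s)"
  proof (rule integral_dominated_convergence)
    show "integrable lborel (\<lambda>s. M *\<^sub>R (indicator {0<..<1} s *\<^sub>R g s))"
      using g unfolding set_integrable_def by (rule integrable_scaleR_right)
    show "AE s in lborel. norm (?f (z n) s) \<le> M *\<^sub>R (indicator {0<..<1} s *\<^sub>R g s)" for n
      using M[of "fst (z n)" "snd (z n)"] by (auto simp: indicator_def)
    show "AE s in lborel. (\<lambda>n. ?f (z n) s) \<longlonglongrightarrow> ?f a s"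
    proof (rule AE_I2)
      fix s :: real
      show "(\<lambda>n. ?f (z n) s) \<longlonglongrightarrow> ?f a s"
      proof (cases "s \<in> {0<..<1}")
        case True
        have "continuous_on W (\<lambda>y. F (fst y) (snd y) (snd y * s))"
          by (rule continuous_on_triple_slice[OF cont])
            (use True pos in \<open>auto intro!: continuous_intros\<close>)
        then have "(\<lambda>n. F (fst (z n)) (snd (z n)) (snd (z n) * s)) \<longlonglongrightarrow> F (fst a) (snd a) (snd a * s)"
          using a z unfolding continuous_on_sequentially by (auto simp: o_def)
        then show ?thesis using True by simp
      qed simp
    qed
  qed (use m a z in auto)
  then have "(\<lambda>n. snd (z n) *\<^sub>R (LBINT s. ?f (z n) s)) \<longlonglongrightarrow> snd a *\<^sub>R (LBINT s. ?f a s)"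
    by (intro tendsto_intros z(2))
  then show "((\<lambda>(x, t). LBINT b:{0..t}. F x t b) \<circ> z) \<longlonglongrightarrow> (\<lambda>(x, t). LBINT b:{0..t}. F x t b) a"
    using a z by (simp add: o_def split_beta source_time_scaling(2))
qed

end

lemma continuous_on_vanishing_initial_time:
  fixes u :: "'a::euclidean_space \<Rightarrow> real \<Rightarrow> complex"
  assumes U: "open U"
    and c: "continuous_on (U \<times> {0<..<t0}) (\<lambda>(x, t). u x t)"
    and z: "\<And>x. x \<in> U \<Longrightarrow> u x 0 = 0"
    and b: "\<And>C. compact C \<Longrightarrow> C \<subseteq> U \<Longrightarrow> \<exists>M. \<forall>x t. x \<in> C \<longrightarrow> t \<in> {0<..<t0} \<longrightarrow> norm (u x t) \<le> M * t"
  shows "continuous_on (U \<times> {0..<t0}) (\<lambda>(x, t). u x t)"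
  unfolding continuous_on_eq_continuous_within
proof
  fix y assume y: "y \<in> U \<times> {0..<t0}"
  obtain x t where xt: "y = (x, t)" "x \<in> U" "0 \<le> t" "t < t0" using y by auto
  show "continuous (at y within U \<times> {0..<t0}) (\<lambda>(x, t). u x t)"
  proof (cases "t = 0")
    case False
    then have "continuous (at y) (\<lambda>(x, t). u x t)"
      using c xt U by (subst (asm) continuous_on_eq_continuous_at) (auto simp: open_Times)
    then show ?thesis by (rule continuous_at_imp_continuous_at_within)
  next
    case True
    obtain e where e: "e > 0" "cball x e \<subseteq> U"
      using U xt open_contains_cball by blast
    obtain M where M: "\<And>x' t. x' \<in> cball x e \<Longrightarrow> t \<in> {0<..<t0} \<Longrightarrow> norm (u x' t) \<le> M * t"
      using b[OF compact_cball e(2)] by blast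
    have "((\<lambda>(x, t). u x t) \<longlongrightarrow> 0) (at (x, 0) within U \<times> {0..<t0})"
    proof (rule Lim_null_comparison)
      show "\<forall>\<^sub>F z in at (x, 0) within U \<times> {0..<t0}. norm (case z of (x, t) \<Rightarrow> u x t) \<le> M * snd z"
        unfolding eventually_at
      proof (intro exI[of _ e] conjI ballI impI e)
        fix z assume z': "z \<in> U \<times> {0..<t0}" "z \<noteq> (x, 0) \<and> dist z (x, 0) < e"
        obtain x' t' where zz: "z = (x', t')" by (cases z)
        have "dist x' x < e" using z' dist_fst_le[of z "(x, 0)"] by (simp add: zz)
        then have "x' \<in> cball x e" by (simp add: dist_commute)
        then show "norm (case z of (x, t) \<Rightarrow> u x t) \<le> M * snd z"
          using M[of x' t'] z[of x'] z' by (cases "t' = 0") (auto simp: zz)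
      qed
      have "((\<lambda>z. M * snd z) \<longlongrightarrow> M * snd (x, 0::real)) (at (x, 0) within U \<times> {0..<t0})"
        by (intro tendsto_intros)
      then show "((\<lambda>z. M * snd z) \<longlongrightarrow> 0) (at (x, 0) within U \<times> {0..<t0})" by simp
    qed
    then show ?thesis using True xt z by (simp add: continuous_within)
  qed
qed

section \<open>The solution\<close>

locale wave_transform =
  fixes l t0 :: real and U :: "'a::euclidean_space set"
  assumes l: "l > - 2" and t0: "0 < t0" and U: "open U"
begin

text \<open>The regularity that \<open>w\<close>, \<open>w\<^sub>r\<close> and \<open>w\<^sub>r\<^sub>r\<close> have in common.\<close>

definition data :: "('a \<Rightarrow> real \<Rightarrow> real \<Rightarrow> complex) \<Rightarrow> bool" where
  "data h \<longleftrightarrow> continuous_on (U \<times> {0..\<phi> l t0} \<times> {0..t0}) (\<lambda>(x, r, b). h x r b)"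

text \<open>The kernel \<open>K\<close> includes the constant \<open>c_l\<close>, so \<open>J w x t b\<close> is the contribution of the source time \<open>b\<close> to
  the solution.\<close>

definition J :: "('a \<Rightarrow> real \<Rightarrow> real \<Rightarrow> complex) \<Rightarrow> 'a \<Rightarrow> real \<Rightarrow> real \<Rightarrow> complex" where
  "J h x t b = integral {0..\<phi> l t - \<phi> l b} (\<lambda>r. K l t b r *\<^sub>R h x r b)"

definition J_t :: "('a \<Rightarrow> real \<Rightarrow> real \<Rightarrow> complex) \<Rightarrow> 'a \<Rightarrow> real \<Rightarrow> real \<Rightarrow> complex" where
  "J_t h x t b = integral {0..\<phi> l t - \<phi> l b} (\<lambda>r. K_t l t b r *\<^sub>R h x r b)"

definition past :: "('a \<times> real \<times> real) set" where
  "past = {(x, t, b). x \<in> U \<and> 0 < b \<and> b \<le> t \<and> t < t0}"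

lemma \<phi>_past:
  assumes "0 < b" "b \<le> t" "t < t0"
  shows "0 < \<phi> l b" "\<phi> l b \<le> \<phi> l t" "\<phi> l t < \<phi> l t0" "0 < t"
  using \<phi>_pos[OF l assms(1)] \<phi>_le[OF l _ assms(2)] \<phi>_less[OF l _ assms(3)] assms by auto

lemma data_slice:
  assumes "data h" "continuous_on A f1" "continuous_on A f2" "continuous_on A f3"
    "\<And>y. y \<in> A \<Longrightarrow> f1 y \<in> U" "\<And>y. y \<in> A \<Longrightarrow> 0 \<le> f2 y \<and> f2 y \<le> \<phi> l t0" "\<And>y. y \<in> A \<Longrightarrow> 0 \<le> f3 y \<and> f3 y \<le> t0"
  shows "continuous_on A (\<lambda>y. h (f1 y) (f2 y) (f3 y))"
  using assms(1) unfolding data_def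
  by (rule continuous_on_triple_slice) (use assms in auto)

lemma data_slice_r:
  assumes "data h" "x \<in> U" "0 < b" "b \<le> t" "t < t0"
  shows "continuous_on {0..\<phi> l t - \<phi> l b} (\<lambda>r. h x r b)"
  by (rule data_slice[OF assms(1)]) (use assms \<phi>_past[OF assms(3-5)] in \<open>auto intro!: continuous_intros\<close>)

lemma data_bound:
  assumes "data h" "compact C" "C \<subseteq> U"
  obtains M where "0 \<le> M" "\<And>x r b. x \<in> C \<Longrightarrow> r \<in> {0..\<phi> l t0} \<Longrightarrow> b \<in> {0..t0} \<Longrightarrow> norm (h x r b) \<le> M"
proof -
  have "compact ((\<lambda>(x, r, b). h x r b) ` (C \<times> {0..\<phi> l t0} \<times> {0..t0}))"
    using assms(1) unfolding data_def
    by (intro compact_continuous_image compact_Times assms compact_Icc)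
      (rule continuous_on_subset, assumption, use assms in auto)
  then obtain M where "\<And>y. y \<in> (\<lambda>(x, r, b). h x r b) ` (C \<times> {0..\<phi> l t0} \<times> {0..t0}) \<Longrightarrow> norm y \<le> M"
    using compact_imp_bounded bounded_iff by metis
  then show ?thesis
    by (intro that[of "max M 0"]) force+
qed

lemma continuous_on_J:
  assumes h: "data h"
  shows "continuous_on past (\<lambda>(x, t, b). J h x t b)" "continuous_on past (\<lambda>(x, t, b). J_t h x t b)"
proof -
  let ?R = "\<lambda>(x::'a, t, b). \<phi> l t - \<phi> l b"
  have R: "continuous_on past ?R"
    unfolding split_beta
    by (intro continuous_intros continuous_on_\<phi>_compose[OF l]) (auto simp: past_def)
  have R0: "0 \<le> ?R z" if "z \<in> past" for z
    using that \<phi>_past by (auto simp: past_def)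
  let ?A = "{(z, r). z \<in> past \<and> 0 \<le> r \<and> r \<le> ?R z}"
  have A: "0 < snd (snd (fst y))" "snd (snd (fst y)) \<le> fst (snd (fst y))" "fst (snd (fst y)) < t0"
    "fst (fst y) \<in> U" "0 \<le> snd y" "snd y \<le> \<phi> l (fst (snd (fst y))) - \<phi> l (snd (snd (fst y)))" if "y \<in> ?A" for y
    using that by (auto simp: past_def)
  have A': "0 < fst (snd (fst y))" "snd y < \<phi> l (fst (snd (fst y)))" "snd y \<le> \<phi> l t0" if "y \<in> ?A" for y
    using A[OF that] \<phi>_past[OF A(1-3)[OF that]] by auto
  have hc: "continuous_on ?A (\<lambda>y. h (fst (fst y)) (snd y) (snd (snd (fst y))))"
  proof (rule data_slice[OF h])
    fix y assume y: "y \<in> ?A"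
    show "fst (fst y) \<in> U" by (rule A(4)[OF y])
    show "0 \<le> snd y \<and> snd y \<le> \<phi> l t0" using A(5)[OF y] A'(3)[OF y] by (rule conjI)
    show "0 \<le> snd (snd (fst y)) \<and> snd (snd (fst y)) \<le> t0" using A(1-3)[OF y] by linarith
  qed (intro continuous_intros)+
  have Kc: "continuous_on ?A (\<lambda>y. K l (fst (snd (fst y))) (snd (snd (fst y))) (snd y))"
    "continuous_on ?A (\<lambda>y. K_t l (fst (snd (fst y))) (snd (snd (fst y))) (snd y))"
    by (rule continuous_on_K[OF l], (intro continuous_intros)+, erule A' A, erule A' A, erule A' A, erule A' A)+
  have "continuous_on past (\<lambda>z. integral {0..?R z} (\<lambda>r. K l (fst (snd z)) (snd (snd z)) r *\<^sub>R h (fst z) r (snd (snd z))))"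
    by (rule continuous_on_moving_integral[OF R R0])
      (use hc Kc in \<open>auto simp: split_beta intro!: continuous_intros\<close>)
  then show "continuous_on past (\<lambda>(x, t, b). J h x t b)" by (simp add: J_def split_beta)
  have "continuous_on past (\<lambda>z. integral {0..?R z} (\<lambda>r. K_t l (fst (snd z)) (snd (snd z)) r *\<^sub>R h (fst z) r (snd (snd z))))"
    by (rule continuous_on_moving_integral[OF R R0])
      (use hc Kc in \<open>auto simp: split_beta intro!: continuous_intros\<close>)
  then show "continuous_on past (\<lambda>(x, t, b). J_t h x t b)" by (simp add: J_t_def split_beta)
qed

lemma inner_int_eq_J:
  assumes h: "data h" "x \<in> U" "0 < b" "b \<le> t" "t < t0"
  shows "set_integrable lborel {0..\<bar>\<phi> l t - \<phi> l b\<bar>} (\<lambda>r. complex_of_real (kernel l t b r) * h x r b)"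
    "complex_of_real (c_l l) * inner_int l h x t b = J h x t b"
proof -
  note p = \<phi>_past[OF h(3-5)]
  have c: "c_l l \<noteq> 0" using l by (simp add: c_l_def)
  have kc: "continuous_on {0..\<phi> l t - \<phi> l b} (\<lambda>r. K l t b r)"
    by (intro continuous_on_K[OF l] continuous_intros) (use h p in auto)
  have e: "(\<lambda>r. complex_of_real (kernel l t b r) * h x r b) = (\<lambda>r. (K l t b r / c_l l) *\<^sub>R h x r b)"
    using c by (simp add: K_def[OF l] scaleR_conv_of_real)
  have kc': "continuous_on {0..\<phi> l t - \<phi> l b} (\<lambda>r. complex_of_real (kernel l t b r) * h x r b)"
    unfolding e using c by (intro continuous_intros kc data_slice_r[OF h]) auto
  show i: "set_integrable lborel {0..\<bar>\<phi> l t - \<phi> l b\<bar>} (\<lambda>r. complex_of_real (kernel l t b r) * h x r b)"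
    using borel_integrable_atLeastAtMost'[OF kc'] p by simp
  have "inner_int l h x t b = integral {0..\<phi> l t - \<phi> l b} (\<lambda>r. (1 / c_l l) *\<^sub>R (K l t b r *\<^sub>R h x r b))"
    unfolding inner_int_def using set_borel_integral_eq_integral(2)[OF i] p unfolding e by simp
  also have "\<dots> = (1 / c_l l) *\<^sub>R J h x t b"
    by (simp add: J_def del: scaleR_scaleR)
  finally show "complex_of_real (c_l l) * inner_int l h x t b = J h x t b"
    using c by (simp add: scaleR_conv_of_real)
qed

lemma J_dominated:
  assumes h: "data h" and C: "compact C" "C \<subseteq> U"
  shows "\<exists>M. \<forall>x\<in>C. \<forall>t\<in>{0<..<t0}. \<forall>s\<in>{0<..<1}. norm (J h x t (t * s)) \<le> M * 1"
proof -
  obtain M where M: "0 \<le> M" "\<And>x r b. x \<in> C \<Longrightarrow> r \<in> {0..\<phi> l t0} \<Longrightarrow> b \<in> {0..t0} \<Longrightarrow> norm (h x r b) \<le> M"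
    using data_bound[OF h C] by blast
  obtain B where B: "B > 0" "\<And>t b h M. 0 < b \<Longrightarrow> b \<le> t \<Longrightarrow> continuous_on {0..\<phi> l t - \<phi> l b} h \<Longrightarrow>
    (\<And>r. r \<in> {0..\<phi> l t - \<phi> l b} \<Longrightarrow> norm (h r :: complex) \<le> M) \<Longrightarrow>
    norm (integral {0..\<phi> l t - \<phi> l b} (\<lambda>r. K l t b r *\<^sub>R h r)) \<le> B * M * t"
    using inner_integral_bound[OF l] by blast
  have "norm (J h x t (t * s)) \<le> B * M * t0 * 1" if a: "x \<in> C" "t \<in> {0<..<t0}" "s \<in> {0<..<1}" for x t s
  proof -
    have b: "0 < t * s" "t * s \<le> t" "t < t0" using a by (auto simp: mult_left_le)
    have "norm (J h x t (t * s)) \<le> B * M * t"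
      unfolding J_def
    proof (rule B(2)[OF b(1,2)])
      show "continuous_on {0..\<phi> l t - \<phi> l (t * s)} (\<lambda>r. h x r (t * s))"
        using data_slice_r[OF h _ b] a C by auto
      show "norm (h x r (t * s)) \<le> M" if "r \<in> {0..\<phi> l t - \<phi> l (t * s)}" for r
      proof (rule M(2)[OF a(1)])
        show "r \<in> {0..\<phi> l t0}" "t * s \<in> {0..t0}" using that \<phi>_past[OF b] b by auto
      qed
    qed
    also have "\<dots> \<le> B * M * t0" using B M b by (intro mult_left_mono) auto
    finally show ?thesis by simp
  qed
  then show ?thesis by blast
qed

lemma set_integrable_one: "set_integrable lborel {0<..<1::real} (\<lambda>s. 1::real)"
  unfolding set_integrable_def by simp

lemma continuous_on_past_interior:
  "continuous_on past (\<lambda>(x, t, b). F x t b) \<Longrightarrow>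
    continuous_on {(x, t, b). (x, t) \<in> U \<times> {0<..<t0} \<and> 0 < b \<and> b < t} (\<lambda>(x, t, b). F x t b)"
  by (rule continuous_on_subset) (auto simp: past_def)

text \<open>If \<open>F x t b\<close> is bounded, locally uniformly in \<open>x\<close>, by an integrable function of the ratio \<open>b / t\<close>, then
  its integral over \<open>b\<close> is of size \<open>t\<close> and extends continuously by \<open>0\<close> to the initial time.\<close>

context
  fixes F :: "'a \<Rightarrow> real \<Rightarrow> real \<Rightarrow> complex" and k :: "real \<Rightarrow> real"
  assumes F: "continuous_on past (\<lambda>(x, t, b). F x t b)" and k: "set_integrable lborel {0<..<1} k"
    and dom: "\<And>C. compact C \<Longrightarrow> C \<subseteq> U \<Longrightarrow>
      \<exists>M. \<forall>x\<in>C. \<forall>t\<in>{0<..<t0}. \<forall>s\<in>{0<..<1}. norm (F x t (t * s)) \<le> M * k s"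
begin

lemma superposition_dominated:
  assumes "compact C" "C \<subseteq> U \<times> {0<..<t0}"
  shows "\<exists>M. \<forall>x t s. (x, t) \<in> C \<longrightarrow> s \<in> {0<..<1} \<longrightarrow> norm (F x t (t * s)) \<le> M * k s"
proof -
  have "compact (fst ` C)" "fst ` C \<subseteq> U"
    using assms by (auto intro!: compact_continuous_image continuous_intros)
  then obtain M where M: "\<forall>x\<in>fst ` C. \<forall>t\<in>{0<..<t0}. \<forall>s\<in>{0<..<1}. norm (F x t (t * s)) \<le> M * k s"
    using dom by blast
  have "norm (F x t (t * s)) \<le> M * k s" if "(x, t) \<in> C" "s \<in> {0<..<1}" for x t s
  proof -
    have "x \<in> fst ` C" "t \<in> {0<..<t0}" using that(1) assms(2) by force+
    then show ?thesis using M that(2) by blast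
  qed
  then show ?thesis by blast
qed

lemma superposition_integrable:
  assumes "x \<in> U" "t \<in> {0<..<t0}"
  shows "set_integrable lborel {0..t} (F x t)"
  by (rule source_time_scaling(1)[OF _ continuous_on_past_interior[OF F] superposition_dominated k]) (use assms in auto)

lemma continuous_on_superposition:
  "continuous_on (U \<times> {0..<t0}) (\<lambda>(x, t). LBINT b:{0..t}. F x t b)"
proof (rule continuous_on_vanishing_initial_time[OF U])
  show "continuous_on (U \<times> {0<..<t0}) (\<lambda>(x, t). LBINT b:{0..t}. F x t b)"
    by (rule continuous_on_source_time_integral[OF _ continuous_on_past_interior[OF F] superposition_dominated k]) auto
  show "(LBINT b:{0..0}. F x 0 b) = 0" for x
    unfolding set_integral_Icc_eq_Ioo(2) by (simp add: set_lebesgue_integral_def)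
  fix C assume C: "compact C" "C \<subseteq> U"
  obtain M where M: "\<forall>x\<in>C. \<forall>t\<in>{0<..<t0}. \<forall>s\<in>{0<..<1}. norm (F x t (t * s)) \<le> M * k s"
    using dom[OF C] by blast
  let ?I = "LBINT s:{0<..<1}. k s"
  have "norm (LBINT b:{0..t}. F x t b) \<le> (M * ?I) * t" if "x \<in> C" "t \<in> {0<..<t0}" for x t
  proof -
    have xt: "(x, t) \<in> U \<times> {0<..<t0}" "0 < t" using that C by auto
    let ?f = "\<lambda>s. indicator {0<..<1} s *\<^sub>R F x t (t * s)"
    have i: "integrable lborel ?f"
      by (rule source_time_dominated[OF _ continuous_on_past_interior[OF F] superposition_dominated k xt(1)]) auto
    have "norm (LBINT s. ?f s) \<le> (LBINT s. M *\<^sub>R (indicator {0<..<1} s *\<^sub>R k s))"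
    proof (rule order_trans[OF integral_norm_bound integral_mono])
      show "integrable lborel (\<lambda>s. M *\<^sub>R (indicator {0<..<1} s *\<^sub>R k s))"
        using k unfolding set_integrable_def by (rule integrable_scaleR_right)
      show "integrable lborel (\<lambda>s. norm (?f s))" using i by (rule integrable_norm)
      show "norm (?f s) \<le> M *\<^sub>R (indicator {0<..<1} s *\<^sub>R k s)" for s
        using M that by (auto simp: indicator_def)
    qed
    then have "t * norm (LBINT s. ?f s) \<le> t * (M * ?I)"
      using xt by (intro mult_left_mono) (auto simp: set_lebesgue_integral_def)
    moreover have "(LBINT b:{0..t}. F x t b) = t *\<^sub>R (LBINT s. ?f s)"
      by (rule source_time_scaling(2)[OF _ continuous_on_past_interior[OF F] superposition_dominated k xt(1)]) auto
    ultimately show ?thesis using xt by (simp add: mult_ac)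
  qed
  then show "\<exists>M. \<forall>x t. x \<in> C \<longrightarrow> t \<in> {0<..<t0} \<longrightarrow> norm (LBINT b:{0..t}. F x t b) \<le> M * t"
    by blast
qed

end

lemma sol_0: "sol l h x 0 = 0"
  unfolding sol_def set_integral_Icc_eq_Ioo(2) by (simp add: set_lebesgue_integral_def)

context
  fixes h assumes h: "data h"
begin

lemma sol_eq:
  assumes "x \<in> U" "t \<in> {0<..<t0}"
  shows "set_integrable lborel {0..t} (inner_int l h x t)" "sol l h x t = (LBINT b:{0..t}. J h x t b)"
proof -
  have c: "c_l l \<noteq> 0" using l by (simp add: c_l_def)
  have i: "set_integrable lborel {0..t} (J h x t)"
    by (rule superposition_integrable[OF continuous_on_J(1)[OF h] set_integrable_one J_dominated[OF h] assms])
  have e: "inner_int l h x t b = complex_of_real (1 / c_l l) * J h x t b" if "b \<in> {0<..<t}" for b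
    using inner_int_eq_J(2)[OF h assms(1), of b t] that assms c by (auto simp: field_simps)
  have "set_integrable lborel {0<..<t} (\<lambda>b. complex_of_real (1 / c_l l) * J h x t b)"
    using i unfolding set_integral_Icc_eq_Ioo(1) by (rule set_integrable_mult_right)
  then have i2: "set_integrable lborel {0<..<t} (inner_int l h x t)"
    by (subst set_integrable_cong[OF refl refl e]) auto
  then show "set_integrable lborel {0..t} (inner_int l h x t)"
    unfolding set_integral_Icc_eq_Ioo(1) .
  have "sol l h x t = (LBINT b:{0<..<t}. complex_of_real (c_l l) * inner_int l h x t b)"
    unfolding sol_def set_integral_Icc_eq_Ioo(2) by simp
  also have "\<dots> = (LBINT b:{0<..<t}. J h x t b)"
    by (rule set_lebesgue_integral_cong) (use e c in \<open>auto simp: field_simps\<close>)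
  finally show "sol l h x t = (LBINT b:{0..t}. J h x t b)"
    unfolding set_integral_Icc_eq_Ioo(2) .
qed

lemma continuous_on_sol: "continuous_on (U \<times> {0..<t0}) (\<lambda>(x, t). sol l h x t)"
proof (rule continuous_on_eq)
  show "continuous_on (U \<times> {0..<t0}) (\<lambda>(x, t). LBINT b:{0..t}. J h x t b)"
    by (rule continuous_on_superposition[OF continuous_on_J(1)[OF h] set_integrable_one J_dominated[OF h]])
  have "(LBINT b:{0..0}. J h x 0 b) = 0" for x
    unfolding set_integral_Icc_eq_Ioo(2) by (simp add: set_lebesgue_integral_def)
  then show "(case z of (x, t) \<Rightarrow> LBINT b:{0..t}. J h x t b) = (case z of (x, t) \<Rightarrow> sol l h x t)"
    if "z \<in> U \<times> {0..<t0}" for z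
    using that sol_eq(2)[of "fst z" "snd z"] sol_0[of h "fst z"] by (cases "snd z = 0") (auto simp: split_beta)
qed

end

end

section \<open>The weak equation\<close>

context wave_transform
begin

abbreviation "W \<equiv> U \<times> {0<..<t0}"

text \<open>The weak equation is an identity between integrals over \<open>0 < b < t\<close> and \<open>(x, t) \<in> W\<close>; \<open>tested Q \<Psi>\<close> is
  the integrand. Its boundedness and compact support justify every exchange of integrals.\<close>

definition tested :: "('a \<Rightarrow> real \<Rightarrow> real \<Rightarrow> complex) \<Rightarrow> ('a \<times> real \<Rightarrow> complex) \<Rightarrow> 'a \<times> real \<Rightarrow> real \<Rightarrow> complex" where
  "tested Q \<Psi> z b = indicator {0<..<snd z} b *\<^sub>R (Q (fst z) (snd z) b * \<Psi> z)"

text \<open>Written in the ratio \<open>s = b / t\<close>, in the form in which the superposition lemmas take a dominating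
  function, which is constant here.\<close>

definition locally_bounded :: "('a \<Rightarrow> real \<Rightarrow> real \<Rightarrow> complex) \<Rightarrow> bool" where
  "locally_bounded Q \<longleftrightarrow> (\<forall>C. compact C \<longrightarrow> C \<subseteq> W \<longrightarrow>
     (\<exists>M. \<forall>x t s. (x, t) \<in> C \<longrightarrow> s \<in> {0<..<1} \<longrightarrow> norm (Q x t (t * s)) \<le> M * 1))"

lemma locally_bounded_J: "data h \<Longrightarrow> locally_bounded (J h)"
  unfolding locally_bounded_def
  by (intro allI impI superposition_dominated[OF continuous_on_J(1) set_integrable_one J_dominated])

lemma locally_bounded_powr_J:
  assumes "data h"
  shows "locally_bounded (\<lambda>x t b. t powr l *\<^sub>R J h x t b)"
  unfolding locally_bounded_def
proof (intro allI impI)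
  fix C assume C: "compact C" "C \<subseteq> W"
  obtain M where M: "\<And>x t s. (x, t) \<in> C \<Longrightarrow> s \<in> {0<..<1} \<Longrightarrow> norm (J h x t (t * s)) \<le> M * 1"
    using locally_bounded_J[OF assms] C unfolding locally_bounded_def by meson
  have "compact ((\<lambda>z. snd z powr l) ` C)"
    by (intro compact_continuous_image C continuous_intros) (use C in auto)
  then obtain E where E: "\<And>z. z \<in> C \<Longrightarrow> norm (snd z powr l) \<le> E"
    using compact_imp_bounded bounded_iff by (metis (no_types, lifting) imageI)
  have "norm (t powr l *\<^sub>R J h x t (t * s)) \<le> (E * \<bar>M\<bar>) * 1" if "(x, t) \<in> C" "s \<in> {0<..<1}" for x t s
  proof -
    have "\<bar>t powr l\<bar> \<le> E" using E[OF that(1)] by simp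
    moreover have "norm (J h x t (t * s)) \<le> \<bar>M\<bar>" using M[OF that] by simp
    ultimately have "\<bar>t powr l\<bar> * norm (J h x t (t * s)) \<le> E * \<bar>M\<bar>"
      by (rule mult_mono) (use E[OF that(1)] norm_ge_zero[of "snd (x, t) powr l"] in \<open>linarith | simp\<close>)+
    then show ?thesis by simp
  qed
  then show "\<exists>M. \<forall>x t s. (x, t) \<in> C \<longrightarrow> s \<in> {0<..<1} \<longrightarrow> norm (t powr l *\<^sub>R J h x t (t * s)) \<le> M * 1"
    by blast
qed

lemma continuous_on_powr_J:
  assumes "data h"
  shows "continuous_on past (\<lambda>(x, t, b). t powr l *\<^sub>R J h x t b)"
  using continuous_on_J(1)[OF assms] unfolding split_beta
  by (intro continuous_intros) (auto simp: past_def)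

context
  fixes C :: "('a \<times> real) set"
  assumes C: "compact C" "C \<subseteq> W"
begin

context
  fixes Q :: "'a \<Rightarrow> real \<Rightarrow> real \<Rightarrow> complex" and \<Psi> :: "'a \<times> real \<Rightarrow> complex"
  assumes Q: "continuous_on past (\<lambda>(x, t, b). Q x t b)" "locally_bounded Q"
    and \<Psi>: "continuous_on UNIV \<Psi>" "\<forall>z. z \<notin> C \<longrightarrow> \<Psi> z = 0"
begin

lemma tested_measurable: "(\<lambda>y. tested Q \<Psi> (fst y) (snd y)) \<in> borel_measurable borel"
proof -
  let ?O = "{y. fst y \<in> W} \<inter> {y :: ('a \<times> real) \<times> real. 0 < snd y} \<inter> {y. snd y < snd (fst y)}"
  have "open (fst -` W :: (('a \<times> real) \<times> real) set)"
    by (intro open_vimage_fst open_Times U) simp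
  moreover have "(fst -` W :: (('a \<times> real) \<times> real) set) = {y. fst y \<in> W}"
    by auto
  ultimately have O: "open ?O"
    by (intro open_Int open_Collect_less continuous_intros) simp
  have "continuous_on ?O (\<lambda>y. Q (fst (fst y)) (snd (fst y)) (snd y) * \<Psi> (fst y))"
    by (intro continuous_intros continuous_on_triple_slice[OF Q(1)] continuous_on_compose2[OF \<Psi>(1)])
      (auto simp: past_def)
  then have "(\<lambda>y. indicator ?O y *\<^sub>R (Q (fst (fst y)) (snd (fst y)) (snd y) * \<Psi> (fst y))) \<in> borel_measurable borel"
    using O by (intro borel_measurable_continuous_on_indicator) auto
  moreover have "(\<lambda>y. indicator ?O y *\<^sub>R (Q (fst (fst y)) (snd (fst y)) (snd y) * \<Psi> (fst y))) =
      (\<lambda>y. tested Q \<Psi> (fst y) (snd y))"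
    using \<Psi>(2)[rule_format] C(2) by (fastforce simp: tested_def indicator_def fun_eq_iff)
  ultimately show ?thesis by simp
qed

lemma tested_bound:
  obtains M where "\<And>z b. norm (tested Q \<Psi> z b) \<le> M"
proof -
  obtain M1 where M1: "\<And>x t s. (x, t) \<in> C \<Longrightarrow> s \<in> {0<..<1} \<Longrightarrow> norm (Q x t (t * s)) \<le> M1 * 1"
    using Q(2) C unfolding locally_bounded_def by meson
  have "compact (\<Psi> ` C)"
    by (intro compact_continuous_image C continuous_on_subset[OF \<Psi>(1)]) auto
  then obtain M2 where M2: "\<And>z. z \<in> C \<Longrightarrow> norm (\<Psi> z) \<le> M2"
    using compact_imp_bounded bounded_iff by (metis imageI)
  have "norm (tested Q \<Psi> z b) \<le> \<bar>M1\<bar> * \<bar>M2\<bar>" for z b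
  proof (cases "z \<in> C \<and> b \<in> {0<..<snd z}")
    case True
    then have "norm (Q (fst z) (snd z) (snd z * (b / snd z))) \<le> M1 * 1"
      by (intro M1) (auto simp: field_simps)
    moreover have "snd z * (b / snd z) = b" using True by auto
    ultimately have "norm (Q (fst z) (snd z) b) \<le> \<bar>M1\<bar>" by simp
    moreover have "norm (\<Psi> z) \<le> \<bar>M2\<bar>" using M2[of z] True by simp
    ultimately show ?thesis
      using True by (auto simp: tested_def norm_mult intro!: mult_mono)
  next
    case False
    then show ?thesis using \<Psi>(2)[rule_format, of z] by (auto simp: tested_def indicator_def)
  qed
  then show ?thesis by (rule that)
qed

lemma integrable_tested:
  "integrable (lborel \<Otimes>\<^sub>M lborel) (\<lambda>(z, b). tested Q \<Psi> z b)"
  "integrable lborel (\<lambda>z. tested Q \<Psi> z b)"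
proof -
  obtain M where M: "\<And>z b. norm (tested Q \<Psi> z b) \<le> M" using tested_bound by blast
  have c: "closed C" using C by (simp add: compact_imp_closed)
  have "integrable lborel (\<lambda>y. tested Q \<Psi> (fst y) (snd y))"
  proof (rule integrableI_bounded_set[where A = "C \<times> {0..t0}" and B = M])
    show "emeasure lborel (C \<times> {0..t0}) < \<infinity>"
      by (intro emeasure_compact_finite compact_Times C) simp
    show "C \<times> {0..t0} \<in> sets lborel"
      using c by (simp add: closed_Times borel_closed)
    show "AE y in lborel. y \<notin> C \<times> {0..t0} \<longrightarrow> tested Q \<Psi> (fst y) (snd y) = 0"
      using \<Psi>(2)[rule_format] C by (intro AE_I2) (fastforce simp: tested_def indicator_def)
  qed (use tested_measurable M in auto)
  then show "integrable (lborel \<Otimes>\<^sub>M lborel) (\<lambda>(z, b). tested Q \<Psi> z b)"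
    by (simp add: lborel_prod split_beta')
  show "integrable lborel (\<lambda>z. tested Q \<Psi> z b)"
  proof (rule integrableI_bounded_set[where A = C and B = M])
    show "emeasure lborel C < \<infinity>" by (intro emeasure_compact_finite C)
    show "C \<in> sets lborel" using c by (simp add: borel_closed)
    show "(\<lambda>z. tested Q \<Psi> z b) \<in> borel_measurable lborel"
      using measurable_compose[OF _ tested_measurable, of "\<lambda>z. (z, b)" borel]
      by (simp add: borel_measurable_continuous_onI continuous_intros)
    show "AE z in lborel. z \<notin> C \<longrightarrow> tested Q \<Psi> z b = 0"
      using \<Psi>(2)[rule_format] by (auto simp: tested_def)
  qed (use M in auto)
qed

lemma Fubini_tested:
  "(LBINT z:W. (LBINT b:{0..snd z}. Q (fst z) (snd z) b) * \<Psi> z) = (LBINT b. (LBINT z. tested Q \<Psi> z b))"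
  "integrable lborel (\<lambda>b. LBINT z. tested Q \<Psi> z b)"
  "set_integrable lborel W (\<lambda>z. (LBINT b:{0..snd z}. Q (fst z) (snd z) b) * \<Psi> z)"
proof -
  have e: "indicator W z *\<^sub>R ((LBINT b:{0..snd z}. Q (fst z) (snd z) b) * \<Psi> z) =
        (LBINT b. tested Q \<Psi> z b)" for z :: "'a \<times> real"
  proof -
    have "(LBINT b. tested Q \<Psi> z b) = (LBINT b:{0<..<snd z}. Q (fst z) (snd z) b * \<Psi> z)"
      unfolding tested_def set_lebesgue_integral_def ..
    also have "\<dots> = (LBINT b:{0<..<snd z}. Q (fst z) (snd z) b) * \<Psi> z"
      by (rule set_integral_mult_left)
    finally have "(LBINT b. tested Q \<Psi> z b) = (LBINT b:{0..snd z}. Q (fst z) (snd z) b) * \<Psi> z"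
      unfolding set_integral_Icc_eq_Ioo(2) .
    moreover have "\<Psi> z = 0" if "z \<notin> W" using \<Psi>(2)[rule_format, of z] C(2) that by blast
    ultimately show ?thesis by (cases "z \<in> W") auto
  qed
  have "(LBINT z:W. (LBINT b:{0..snd z}. Q (fst z) (snd z) b) * \<Psi> z) =
      (LBINT z. (LBINT b. tested Q \<Psi> z b))"
    by (simp only: set_lebesgue_integral_def[of lborel W] e)
  also have "\<dots> = (LBINT b. (LBINT z. tested Q \<Psi> z b))"
    by (rule lborel_pair.Fubini_integral[symmetric, OF integrable_tested(1)])
  finally show "(LBINT z:W. (LBINT b:{0..snd z}. Q (fst z) (snd z) b) * \<Psi> z) = (LBINT b. (LBINT z. tested Q \<Psi> z b))" .
  show "integrable lborel (\<lambda>b. LBINT z. tested Q \<Psi> z b)"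
    using lborel_pair.integrable_snd[OF integrable_tested(1)] by simp
  show "set_integrable lborel W (\<lambda>z. (LBINT b:{0..snd z}. Q (fst z) (snd z) b) * \<Psi> z)"
    unfolding set_integrable_def e using lborel_pair.integrable_fst[OF integrable_tested(1)] by simp
qed

lemma tested_iterated:
  "(LBINT z. tested Q \<Psi> z b) = (LBINT x. (LBINT t. tested Q \<Psi> (x, t) b))"
  "(LBINT z. tested Q \<Psi> z b) = (LBINT t. (LBINT x. tested Q \<Psi> (x, t) b))"
  "integrable lborel (\<lambda>x. LBINT t. tested Q \<Psi> (x, t) b)"
proof -
  have i: "integrable (lborel \<Otimes>\<^sub>M lborel) (\<lambda>z. tested Q \<Psi> z b)"
    using integrable_tested(2)[of b] by (simp add: lborel_prod)
  then have i': "integrable (lborel \<Otimes>\<^sub>M lborel) (\<lambda>(x, t). tested Q \<Psi> (x, t) b)"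
    by (simp add: split_beta')
  show "(LBINT z. tested Q \<Psi> z b) = (LBINT x. (LBINT t. tested Q \<Psi> (x, t) b))"
    using lborel_pair.integral_fst'[OF i] by (simp add: lborel_prod)
  show "(LBINT z. tested Q \<Psi> z b) = (LBINT t. (LBINT x. tested Q \<Psi> (x, t) b))"
    using lborel_pair.integral_snd[OF i'] by (simp add: lborel_prod split_beta')
  show "integrable lborel (\<lambda>x. LBINT t. tested Q \<Psi> (x, t) b)"
    using lborel_pair.integrable_fst'[OF i] by simp
qed

lemma tested_time_slice:
  assumes x: "x \<in> U" and b: "0 < b" "b \<le> T" "T < t0" and T: "\<forall>t\<ge>T. (x, t) \<notin> C"
  shows "(LBINT t. tested Q \<Psi> (x, t) b) = integral {b..T} (\<lambda>t. Q x t b * \<Psi> (x, t))"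
    "(\<lambda>t. Q x t b * \<Psi> (x, t)) integrable_on {b..T}"
proof -
  have c: "continuous_on {b..T} (\<lambda>t. Q x t b * \<Psi> (x, t))"
    by (intro continuous_intros continuous_on_triple_slice[OF Q(1)] continuous_on_compose2[OF \<Psi>(1)])
      (use b x in \<open>auto simp: past_def\<close>)
  have "(LBINT t. tested Q \<Psi> (x, t) b) = (LBINT t:{b<..<T}. Q x t b * \<Psi> (x, t))"
    unfolding set_lebesgue_integral_def
    by (rule Bochner_Integration.integral_cong[OF refl])
      (use b T \<Psi>(2)[rule_format] in \<open>auto simp: tested_def indicator_def not_less\<close>)
  also have "\<dots> = (LBINT t:{b..T}. Q x t b * \<Psi> (x, t))"
    unfolding set_integral_Icc_eq_Ioo(2) ..
  also have "\<dots> = integral {b..T} (\<lambda>t. Q x t b * \<Psi> (x, t))"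
    by (rule set_borel_integral_eq_integral(2)[OF borel_integrable_atLeastAtMost'[OF c]])
  finally show "(LBINT t. tested Q \<Psi> (x, t) b) = integral {b..T} (\<lambda>t. Q x t b * \<Psi> (x, t))" .
  show "(\<lambda>t. Q x t b * \<Psi> (x, t)) integrable_on {b..T}"
    by (rule integrable_continuous_real[OF c])
qed

end

lemma swap_J:
  assumes h: "data h" and b: "0 < b" "b < t" "t < t0"
    and \<Psi>: "continuous_on UNIV \<Psi>" "\<forall>z. z \<notin> C \<longrightarrow> \<Psi> z = 0"
  shows "(LBINT x. J h x t b * \<Psi> (x, t)) =
    (LBINT r:{0<..<\<phi> l t - \<phi> l b}. K l t b r *\<^sub>R (LBINT x. h x r b * \<Psi> (x, t)))"
proof -
  let ?R = "\<phi> l t - \<phi> l b" and ?C = "fst ` C"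
  have p: "0 < \<phi> l b" "\<phi> l b \<le> \<phi> l t" "\<phi> l t < \<phi> l t0" "0 < t" using \<phi>_past[of b t] b by auto
  have C1: "compact ?C" "?C \<subseteq> U"
    using C by (auto intro!: compact_continuous_image continuous_intros)
  let ?f = "\<lambda>x r. indicator {0..?R} r *\<^sub>R (K l t b r *\<^sub>R (h x r b * \<Psi> (x, t)))"
  have Kc: "continuous_on {0..?R} (\<lambda>r. K l t b r)"
    by (intro continuous_on_K[OF l] continuous_intros) (use b p in auto)
  have z: "\<Psi> (x, t) = 0" if "x \<notin> ?C" for x using \<Psi>(2)[rule_format, of "(x, t)"] that by force
  have "integrable lborel (\<lambda>y. ?f (fst y) (snd y))"
  proof (rule integrable_continuous_compact_support[of "?C \<times> {0..?R}"])
    have "continuous_on (?C \<times> {0..?R}) (\<lambda>y. K l t b (snd y) *\<^sub>R (h (fst y) (snd y) b * \<Psi> (fst y, t)))"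
      by (intro continuous_intros continuous_on_compose2[OF Kc] data_slice[OF h] continuous_on_compose2[OF \<Psi>(1)])
        (use C1 b p in auto)
    then show "continuous_on (?C \<times> {0..?R}) (\<lambda>y. ?f (fst y) (snd y))"
      by (rule continuous_on_eq) auto
    show "?f (fst y) (snd y) = 0" if "y \<notin> ?C \<times> {0..?R}" for y
      using that z[of "fst y"] by (auto simp: indicator_def mem_Times_iff)
  qed (intro compact_Times C1 compact_Icc)
  then have i: "integrable (lborel \<Otimes>\<^sub>M lborel) (\<lambda>(x, r). ?f x r)"
    by (simp add: lborel_prod split_beta')
  have "(LBINT x. J h x t b * \<Psi> (x, t)) = (LBINT x. (LBINT r. ?f x r))"
  proof (rule Bochner_Integration.integral_cong[OF refl])
    fix x
    show "J h x t b * \<Psi> (x, t) = (LBINT r. ?f x r)"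
    proof (cases "x \<in> ?C")
      case True
      then have "continuous_on {0..?R} (\<lambda>r. K l t b r *\<^sub>R h x r b)"
        using C1 b by (intro continuous_intros Kc data_slice_r[OF h]) auto
      from set_borel_integral_eq_integral(2)[OF borel_integrable_atLeastAtMost'[OF this]]
      have "J h x t b = (LBINT r:{0..?R}. K l t b r *\<^sub>R h x r b)" by (simp add: J_def)
      then have "J h x t b * \<Psi> (x, t) = (LBINT r:{0..?R}. (K l t b r *\<^sub>R h x r b) * \<Psi> (x, t))"
        by (simp only: set_integral_mult_left)
      then show ?thesis by (simp add: set_lebesgue_integral_def)
    qed (simp add: z)
  qed
  also have "\<dots> = (LBINT r. (LBINT x. ?f x r))"
    by (rule lborel_pair.Fubini_integral[OF i, symmetric])
  also have "\<dots> = (LBINT r:{0..?R}. K l t b r *\<^sub>R (LBINT x. h x r b * \<Psi> (x, t)))"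
    by (simp add: set_lebesgue_integral_def)
  also have "\<dots> = (LBINT r:{0<..<?R}. K l t b r *\<^sub>R (LBINT x. h x r b * \<Psi> (x, t)))"
    by (rule set_integral_Icc_eq_Ioo(2))
  finally show ?thesis .
qed

end

text \<open>The contribution of the source time \<open>b\<close> to the integral on the right-hand side of the equation for \<open>u\<close>,
  where \<open>h'\<close> is \<open>w\<^sub>r\<close>.\<close>

definition S :: "('a \<Rightarrow> real \<Rightarrow> real \<Rightarrow> complex) \<Rightarrow> 'a \<Rightarrow> real \<Rightarrow> real \<Rightarrow> complex" where
  "S h' x t b = (t powr l * K l t b 0) *\<^sub>R h' x 0 b"

lemma continuous_on_S:
  assumes "data h'"
  shows "continuous_on past (\<lambda>(x, t, b). S h' x t b)"
  unfolding S_def split_beta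
proof (intro continuous_on_scaleR continuous_on_mult)
  show "continuous_on past (\<lambda>z. fst (snd z) powr l)"
    by (intro continuous_intros) (auto simp: past_def)
  show "continuous_on past (\<lambda>z. K l (fst (snd z)) (snd (snd z)) 0)"
    by (intro continuous_on_K[OF l] continuous_intros) (auto simp: past_def intro!: \<phi>_pos[OF l])
  show "continuous_on past (\<lambda>z. h' (fst z) 0 (snd (snd z)))"
    by (intro data_slice[OF assms] continuous_intros) (auto simp: past_def \<phi>_nonneg[OF l])
qed

lemma locally_bounded_S:
  assumes h': "data h'"
  shows "locally_bounded (S h')"
  unfolding locally_bounded_def
proof (intro allI impI)
  fix C assume C: "compact C" "C \<subseteq> W"
  have C1: "compact (fst ` C)" "fst ` C \<subseteq> U"
    using C by (auto intro!: compact_continuous_image continuous_intros)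
  obtain M where M: "0 \<le> M" "\<And>x r b. x \<in> fst ` C \<Longrightarrow> r \<in> {0..\<phi> l t0} \<Longrightarrow> b \<in> {0..t0} \<Longrightarrow> norm (h' x r b) \<le> M"
    using data_bound[OF h' C1] by blast
  let ?g = "\<gamma> l"
  obtain B where B: "B > 0" "\<And>q p r. 0 < q \<Longrightarrow> q \<le> p \<Longrightarrow> 0 \<le> r \<Longrightarrow> r \<le> p - q \<Longrightarrow>
      \<bar>G ?g q p r\<bar> \<le> B * (p powr (1 / 2 - 2 * ?g) * (p - r) powr (- (1 / 2)))"
    using G_bound[OF \<gamma>_less_half[OF l]] by blast
  let ?e = "\<lambda>t. t powr l * (\<bar>c_l l\<bar> * (B * (\<phi> l t powr (1 / 2 - 2 * ?g) * \<phi> l t powr (- (1 / 2)))))"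
  have pos: "0 < t" if "t \<in> snd ` C" for t using that C(2) by auto
  have "continuous_on (snd ` C) (\<phi> l)"
    by (rule continuous_on_subset[OF continuous_on_\<phi>[OF l]]) (use pos in force)
  moreover have "t \<noteq> 0" "\<phi> l t \<noteq> 0" if "t \<in> snd ` C" for t
    using pos[OF that] \<phi>_pos[OF l pos[OF that]] by auto
  ultimately have "continuous_on (snd ` C) ?e"
    by (intro continuous_on_mult continuous_on_const continuous_on_powr continuous_on_id) auto
  moreover have "compact (snd ` C)"
    by (intro compact_continuous_image C continuous_intros)
  ultimately have "compact (?e ` snd ` C)"
    by (rule compact_continuous_image)
  then obtain E where "\<forall>y\<in>?e ` snd ` C. norm y \<le> E"
    using compact_imp_bounded bounded_iff by blast
  then have E: "norm (?e t) \<le> E" if "t \<in> snd ` C" for t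
    using that by blast
  have "norm (S h' x t (t * s)) \<le> (E * M) * 1" if "(x, t) \<in> C" "s \<in> {0<..<1}" for x t s
  proof -
    have t: "0 < t" "t < t0" "t \<in> snd ` C" "x \<in> fst ` C" using that C by (auto intro: image_eqI[of _ _ "(x, t)"])
    have b: "0 < t * s" "t * s \<le> t" using that t by (auto simp: mult_left_le)
    note p = \<phi>_past[OF b t(2)]
    have "norm (S h' x t (t * s)) = (t powr l * (\<bar>c_l l\<bar> * \<bar>G ?g (\<phi> l (t * s)) (\<phi> l t) 0\<bar>)) * norm (h' x 0 (t * s))"
      by (simp add: S_def K_eq_G[OF l] abs_mult)
    also have "\<dots> \<le> ?e t * M"
    proof (intro mult_mono mult_left_mono)
      show "\<bar>G ?g (\<phi> l (t * s)) (\<phi> l t) 0\<bar> \<le> B * (\<phi> l t powr (1 / 2 - 2 * ?g) * \<phi> l t powr (- (1 / 2)))"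
        using B(2)[of "\<phi> l (t * s)" "\<phi> l t" 0] p by simp
      show "norm (h' x 0 (t * s)) \<le> M"
        using t b by (intro M) (auto simp: \<phi>_nonneg[OF l])
    qed (use B in auto)
    also have "\<dots> \<le> E * M"
      using E[OF t(3)] M by (intro mult_right_mono) auto
    finally show ?thesis by simp
  qed
  then show "\<exists>M. \<forall>x t s. (x, t) \<in> C \<longrightarrow> s \<in> {0<..<1} \<longrightarrow> norm (S h' x t (t * s)) \<le> M * 1"
    by blast
qed


end

text \<open>The function to be transformed, together with its first two derivatives in \<open>r\<close>.\<close>

locale wave_data = wave_transform l t0 U
  for l t0 :: real and U :: "'a::euclidean_space set" +
  fixes w w1 w2 :: "'a \<Rightarrow> real \<Rightarrow> real \<Rightarrow> complex"
  assumes w: "data w" "data w1" "data w2"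
    and dw: "\<And>x r b. x \<in> U \<Longrightarrow> r \<in> {0..\<phi> l t0} \<Longrightarrow> b \<in> {0..t0} \<Longrightarrow>
        ((\<lambda>r. w x r b) has_vector_derivative w1 x r b) (at r within {0..\<phi> l t0})"
      "\<And>x r b. x \<in> U \<Longrightarrow> r \<in> {0..\<phi> l t0} \<Longrightarrow> b \<in> {0..t0} \<Longrightarrow>
        ((\<lambda>r. w1 x r b) has_vector_derivative w2 x r b) (at r within {0..\<phi> l t0})"
begin

text \<open>The time derivative of \<open>J w\<close>.\<close>

definition V :: "'a \<Rightarrow> real \<Rightarrow> real \<Rightarrow> complex" where
  "V x t b = (t powr (l / 4) * b powr (- l / 4)) *\<^sub>R w x (\<phi> l t - \<phi> l b) b + J_t w x t b"

lemma has_vector_derivative_J: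
  assumes x: "x \<in> U" and b: "0 < b" "b < t" "t < t0"
  shows "((\<lambda>t. J w x t b) has_vector_derivative V x t b) (at t)"
    "((\<lambda>t. V x t b) has_vector_derivative (t powr l *\<^sub>R J w2 x t b + S w1 x t b)) (at t)"
proof -
  have b0: "0 < b" "b < t0" "b \<in> {0..t0}" using b by auto
  have c: "continuous_on {0..\<phi> l t0} (\<lambda>r. w2 x r b)"
    by (rule data_slice[OF w(3)]) (use x b in \<open>auto intro!: continuous_intros\<close>)
  have d: "((\<lambda>r. w x r b) has_vector_derivative w1 x r b) (at r within {0..\<phi> l t0})"
    "((\<lambda>r. w1 x r b) has_vector_derivative w2 x r b) (at r within {0..\<phi> l t0})"
    if "r \<in> {0..\<phi> l t0}" for r
    using dw[OF x that b0(3)] by blast+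
  note D = has_vector_derivative_wave[OF l b0(1,2) d c b(2,3)]
  note defs = wave_def[OF l] wave_t_def[OF l] wave_tt_def[OF l]
  show "((\<lambda>t. J w x t b) has_vector_derivative V x t b) (at t)"
    using D(1) unfolding defs[abs_def] by (simp add: J_def J_t_def V_def)
  show "((\<lambda>t. V x t b) has_vector_derivative (t powr l *\<^sub>R J w2 x t b + S w1 x t b)) (at t)"
    using D(2) unfolding defs[abs_def] by (simp add: J_def J_t_def V_def S_def scaleR_add_right)
qed

lemma continuous_on_V: "continuous_on past (\<lambda>(x, t, b). V x t b)"
  unfolding V_def split_beta
proof (intro continuous_on_add continuous_on_scaleR continuous_on_mult)
  show "continuous_on past (\<lambda>z. fst (snd z) powr (l / 4))" "continuous_on past (\<lambda>z. snd (snd z) powr (- l / 4))"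
    by (intro continuous_intros; force simp: past_def)+
  have p: "continuous_on past (\<lambda>z. \<phi> l (fst (snd z)))" "continuous_on past (\<lambda>z. \<phi> l (snd (snd z)))"
    by (intro continuous_on_\<phi>_compose[OF l] continuous_intros; force simp: past_def)+
  show "continuous_on past (\<lambda>z. w (fst z) (\<phi> l (fst (snd z)) - \<phi> l (snd (snd z))) (snd (snd z)))"
  proof (rule data_slice[OF w(1)])
    fix z assume z: "z \<in> past"
    then have a: "0 < snd (snd z)" "snd (snd z) \<le> fst (snd z)" "fst (snd z) < t0" by (auto simp: past_def)
    show "0 \<le> \<phi> l (fst (snd z)) - \<phi> l (snd (snd z)) \<and> \<phi> l (fst (snd z)) - \<phi> l (snd (snd z)) \<le> \<phi> l t0"
      using \<phi>_past[OF a] by linarith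
    show "0 \<le> snd (snd z) \<and> snd (snd z) \<le> t0" using a by linarith
  qed (use p in \<open>auto intro!: continuous_intros simp: past_def\<close>)
  show "continuous_on past (\<lambda>z. J_t w (fst z) (fst (snd z)) (snd (snd z)))"
    using continuous_on_J(2)[OF w(1)] by (simp add: split_beta)
qed

lemma J_V_initial:
  assumes "0 < b"
  shows "J w x b b = 0" "V x b b = w x 0 b"
proof -
  show "J w x b b = 0" by (simp add: J_def)
  have "b powr (l / 4) * b powr (- l / 4) = 1" using assms by (simp add: powr_minus_divide)
  then show "V x b b = w x 0 b" by (simp add: V_def J_t_def)
qed

context
  fixes C :: "('a \<times> real) set" and \<psi> \<psi>1 \<psi>2 \<Theta> :: "'a \<times> real \<Rightarrow> complex"
  assumes C: "compact C" "C \<subseteq> W"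
    and \<psi>: "continuous_on UNIV \<psi>" "\<forall>z. z \<notin> C \<longrightarrow> \<psi> z = 0"
    and \<psi>1: "continuous_on UNIV \<psi>1" "\<forall>z. z \<notin> C \<longrightarrow> \<psi>1 z = 0"
    and \<psi>2: "continuous_on UNIV \<psi>2" "\<forall>z. z \<notin> C \<longrightarrow> \<psi>2 z = 0"
    and \<Theta>: "continuous_on UNIV \<Theta>" "\<forall>z. z \<notin> C \<longrightarrow> \<Theta> z = 0"
    and d\<psi>: "\<And>x t. ((\<lambda>t. \<psi> (x, t)) has_vector_derivative \<psi>1 (x, t)) (at t)"
      "\<And>x t. ((\<lambda>t. \<psi>1 (x, t)) has_vector_derivative \<psi>2 (x, t)) (at t)"
    and adjoint: "\<And>t b r. 0 < b \<Longrightarrow> b < t \<Longrightarrow> t < t0 \<Longrightarrow> r \<in> {0<..<\<phi> l t - \<phi> l b} \<Longrightarrow>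
      (LBINT x. w x r b * \<Theta> (x, t)) = t powr l *\<^sub>R (LBINT x. w2 x r b * \<psi> (x, t))"
begin

lemma time_horizon:
  obtains T where "T < t0" "\<And>x t. T \<le> t \<Longrightarrow> (x, t) \<notin> C"
proof (cases "C = {}")
  case False
  have "compact (snd ` C)"
    by (intro compact_continuous_image C continuous_intros)
  then obtain m where m: "m \<in> snd ` C" "\<And>t. t \<in> snd ` C \<Longrightarrow> t \<le> m"
    using compact_attains_sup[of "snd ` C"] False by auto
  have "m < t0" using m C by auto
  then obtain T where T: "m < T" "T < t0" using dense by blast
  have "(x, t) \<notin> C" if "T \<le> t" for x t
  proof
    assume "(x, t) \<in> C"
    then have "t \<in> snd ` C" by (metis image_eqI snd_conv)
    then show False using m(2)[of t] T that by simp
  qed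
  then show ?thesis using T that by blast
qed (use that[of "t0 - 1"] in auto)

text \<open>For a fixed source time this is Green's formula on \<open>[b, T]\<close>: \<open>v \<psi>' - v' \<psi>\<close> vanishes at \<open>T\<close>, and at \<open>b\<close>
  it equals \<open>- w(x, 0; b) \<psi>\<close>, because \<open>v(b) = 0\<close> and \<open>v'(b) = w(x, 0; b)\<close>.\<close>

lemma green_in_time:
  assumes x: "x \<in> U" and b: "0 < b" "b < t0"
  shows "(LBINT t. tested (J w) \<psi>2 (x, t) b) =
    w x 0 b * \<psi> (x, b) + (LBINT t. tested (\<lambda>x t b. t powr l *\<^sub>R J w2 x t b) \<psi> (x, t) b)
    + (LBINT t. tested (S w1) \<psi> (x, t) b)"
proof -
  obtain T0 where T0: "T0 < t0" "\<And>x t. T0 \<le> t \<Longrightarrow> (x, t) \<notin> C" using time_horizon by blast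
  define T where "T = max T0 b"
  have T: "b \<le> T" "T < t0" "\<forall>t\<ge>T. (x, t) \<notin> C" using T0 b by (auto simp: T_def)
  note s1 = tested_time_slice[OF C continuous_on_J(1)[OF w(1)] locally_bounded_J[OF w(1)] \<psi>2 x b(1) T]
    and s2 = tested_time_slice[OF C continuous_on_powr_J[OF w(3)] locally_bounded_powr_J[OF w(3)] \<psi> x b(1) T]
    and s3 = tested_time_slice[OF C continuous_on_S[OF w(2)] locally_bounded_S[OF w(2)] \<psi> x b(1) T]
  let ?f = "\<lambda>t. J w x t b * \<psi>1 (x, t) - V x t b * \<psi> (x, t)"
  have cs: "continuous_on {b..T} (\<lambda>t. J w x t b)" "continuous_on {b..T} (\<lambda>t. V x t b)"
    by (rule continuous_on_triple_slice[OF continuous_on_J(1)[OF w(1)]] continuous_on_triple_slice[OF continuous_on_V],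
        (intro continuous_intros)+, use x b T in \<open>auto simp: past_def\<close>)+
  have "((\<lambda>t. J w x t b * \<psi>2 (x, t) - (t powr l *\<^sub>R J w2 x t b * \<psi> (x, t) + S w1 x t b * \<psi> (x, t)))
      has_integral ?f T - ?f b) {b..T}"
  proof (rule fundamental_theorem_of_calculus_interior[OF T(1)])
    show "continuous_on {b..T} ?f"
      by (intro continuous_intros cs continuous_on_compose2[OF \<psi>(1)] continuous_on_compose2[OF \<psi>1(1)]) auto
    fix t assume t: "t \<in> {b<..<T}"
    then have bt: "b < t" "t < t0" using T by auto
    note D = has_vector_derivative_J[OF x b(1) bt]
    show "(?f has_vector_derivative
      J w x t b * \<psi>2 (x, t) - (t powr l *\<^sub>R J w2 x t b * \<psi> (x, t) + S w1 x t b * \<psi> (x, t))) (at t)"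
      by (rule has_vector_derivative_eq_rhs[OF has_vector_derivative_diff[OF
            has_vector_derivative_mult[OF D(1) d\<psi>(2)[rule_format]] has_vector_derivative_mult[OF D(2) d\<psi>(1)]]])
        (simp add: algebra_simps)
  qed
  moreover have "?f T = 0" using T(3) \<psi>(2)[rule_format] \<psi>1(2)[rule_format] by simp
  ultimately have "((\<lambda>t. J w x t b * \<psi>2 (x, t) - (t powr l *\<^sub>R J w2 x t b * \<psi> (x, t) + S w1 x t b * \<psi> (x, t)))
      has_integral w x 0 b * \<psi> (x, b)) {b..T}"
    using J_V_initial[OF b(1), of x] by simp
  moreover have "((\<lambda>t. J w x t b * \<psi>2 (x, t) - (t powr l *\<^sub>R J w2 x t b * \<psi> (x, t) + S w1 x t b * \<psi> (x, t)))
      has_integral (integral {b..T} (\<lambda>t. J w x t b * \<psi>2 (x, t)) -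
        (integral {b..T} (\<lambda>t. t powr l *\<^sub>R J w2 x t b * \<psi> (x, t)) + integral {b..T} (\<lambda>t. S w1 x t b * \<psi> (x, t))))) {b..T}"
    by (intro has_integral_diff has_integral_add integrable_integral s1(2) s2(2) s3(2))
  ultimately have "w x 0 b * \<psi> (x, b) = integral {b..T} (\<lambda>t. J w x t b * \<psi>2 (x, t)) -
        (integral {b..T} (\<lambda>t. t powr l *\<^sub>R J w2 x t b * \<psi> (x, t)) + integral {b..T} (\<lambda>t. S w1 x t b * \<psi> (x, t)))"
    by (rule has_integral_unique)
  then show ?thesis
    unfolding s1(1) s2(1) s3(1) by simp
qed

text \<open>For fixed \<open>t\<close> and \<open>b\<close> the integral over \<open>x\<close> is carried out before the one over \<open>r\<close>, so that the adjoint
  identity can be applied to each \<open>w(\<cdot>, r; b)\<close>.\<close>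

lemma tested_adjoint:
  assumes b: "0 < b"
  shows "(LBINT z. tested (J w) \<Theta> z b) = (LBINT z. tested (\<lambda>x t b. t powr l *\<^sub>R J w2 x t b) \<psi> z b)"
proof -
  have "(LBINT x. tested (J w) \<Theta> (x, t) b) = (LBINT x. tested (\<lambda>x t b. t powr l *\<^sub>R J w2 x t b) \<psi> (x, t) b)" for t
  proof (cases "b < t \<and> t < t0")
    case True
    then have t: "b < t" "t < t0" by auto
    have "(LBINT x. tested (J w) \<Theta> (x, t) b) = (LBINT x. J w x t b * \<Theta> (x, t))"
      using b t by (simp add: tested_def)
    also have "\<dots> = (LBINT r:{0<..<\<phi> l t - \<phi> l b}. K l t b r *\<^sub>R (LBINT x. w x r b * \<Theta> (x, t)))"
      by (rule swap_J[OF C w(1) b t \<Theta>])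
    also have "\<dots> = (LBINT r:{0<..<\<phi> l t - \<phi> l b}. t powr l *\<^sub>R (K l t b r *\<^sub>R (LBINT x. w2 x r b * \<psi> (x, t))))"
      by (rule set_lebesgue_integral_cong) (use adjoint[OF b t] in auto)
    also have "\<dots> = t powr l *\<^sub>R (LBINT r:{0<..<\<phi> l t - \<phi> l b}. (K l t b r *\<^sub>R (LBINT x. w2 x r b * \<psi> (x, t))))"
      by (rule set_integral_scaleR_right)
    also have "\<dots> = t powr l *\<^sub>R (LBINT x. J w2 x t b * \<psi> (x, t))"
      by (simp only: swap_J[OF C w(3) b t \<psi>])
    also have "\<dots> = (LBINT x. tested (\<lambda>x t b. t powr l *\<^sub>R J w2 x t b) \<psi> (x, t) b)"
      using b t by (simp add: tested_def)
    finally show ?thesis .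
  next
    case False
    then have "\<not> b < t \<or> (x, t) \<notin> C" for x using C(2) by auto
    then have "tested (J w) \<Theta> (x, t) b = 0" "tested (\<lambda>x t b. t powr l *\<^sub>R J w2 x t b) \<psi> (x, t) b = 0" for x
      using \<Theta>(2) \<psi>(2) by (auto simp: tested_def indicator_def)
    then show ?thesis by simp
  qed
  then show ?thesis
    unfolding tested_iterated(2)[OF C continuous_on_J(1)[OF w(1)] locally_bounded_J[OF w(1)] \<Theta>]
      tested_iterated(2)[OF C continuous_on_powr_J[OF w(3)] locally_bounded_powr_J[OF w(3)] \<psi>]
    by simp
qed

lemma integrable_trace: "integrable lborel (\<lambda>z. w (fst z) 0 (snd z) * \<psi> z)"
proof (rule integrable_continuous_compact_support[OF C(1)])
  show "continuous_on C (\<lambda>z. w (fst z) 0 (snd z) * \<psi> z)"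
    by (intro continuous_intros data_slice[OF w(1)] continuous_on_subset[OF \<psi>(1)])
      (use C(2) in \<open>auto simp: \<phi>_nonneg[OF l]\<close>)
qed (use \<psi>(2)[rule_format] in auto)

lemma integrable_trace_slice: "integrable lborel (\<lambda>x. w x 0 b * \<psi> (x, b))"
proof (rule integrable_continuous_compact_support[of "fst ` C"])
  show "compact (fst ` C)" by (intro compact_continuous_image C continuous_intros)
  have "continuous_on (fst ` C) (\<lambda>x. w x 0 b)" if "b \<in> {0<..<t0}"
    by (rule data_slice[OF w(1)]) (use C(2) that in \<open>auto simp: \<phi>_nonneg[OF l] intro!: continuous_intros\<close>)
  moreover have "\<psi> (x, b) = 0" if "b \<notin> {0<..<t0}" for x
    by (rule \<psi>(2)[rule_format]) (use C(2) that in auto)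
  ultimately show "continuous_on (fst ` C) (\<lambda>x. w x 0 b * \<psi> (x, b))"
    by (cases "b \<in> {0<..<t0}") (auto intro!: continuous_intros continuous_on_compose2[OF \<psi>(1)])
  show "w x 0 b * \<psi> (x, b) = 0" if "x \<notin> fst ` C" for x
    using \<psi>(2)[rule_format, of "(x, b)"] that by force
qed

text \<open>Green's formula for one source time, integrated over \<open>x\<close>: the terms with \<open>t\<^sup>l J w\<^sub>r\<^sub>r\<close> cancel against
  those with the adjoint operator.\<close>

lemma green_slice:
  "(LBINT z. tested (J w) (\<lambda>z. \<psi>2 z - \<Theta> z) z b) =
    (LBINT x. w x 0 b * \<psi> (x, b)) + (LBINT z. tested (S w1) \<psi> z b)"
proof (cases "b \<in> {0<..<t0}")
  case True
  then have b: "0 < b" "b < t0" by auto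
  note cJ = continuous_on_J(1)[OF w(1)] locally_bounded_J[OF w(1)]
    and cP = continuous_on_powr_J[OF w(3)] locally_bounded_powr_J[OF w(3)]
    and cS = continuous_on_S[OF w(2)] locally_bounded_S[OF w(2)]
  have "(LBINT z. tested (J w) (\<lambda>z. \<psi>2 z - \<Theta> z) z b) = (LBINT z. tested (J w) \<psi>2 z b - tested (J w) \<Theta> z b)"
    by (rule Bochner_Integration.integral_cong) (simp_all add: tested_def algebra_simps)
  also have "\<dots> = (LBINT z. tested (J w) \<psi>2 z b) - (LBINT z. tested (J w) \<Theta> z b)"
    by (intro Bochner_Integration.integral_diff integrable_tested(2)[OF C cJ \<psi>2] integrable_tested(2)[OF C cJ \<Theta>])
  also have "(LBINT z. tested (J w) \<psi>2 z b) = (LBINT x. w x 0 b * \<psi> (x, b) +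
      (LBINT t. tested (\<lambda>x t b. t powr l *\<^sub>R J w2 x t b) \<psi> (x, t) b)
      + (LBINT t. tested (S w1) \<psi> (x, t) b))"
    unfolding tested_iterated(1)[OF C cJ \<psi>2]
  proof (rule Bochner_Integration.integral_cong[OF refl])
    fix x
    show "(LBINT t. tested (J w) \<psi>2 (x, t) b) =
      w x 0 b * \<psi> (x, b) + (LBINT t. tested (\<lambda>x t b. t powr l *\<^sub>R J w2 x t b) \<psi> (x, t) b)
      + (LBINT t. tested (S w1) \<psi> (x, t) b)"
    proof (cases "x \<in> U")
      case False
      then have "\<psi> (x, t) = 0" "\<psi>2 (x, t) = 0" for t
        using C(2) \<psi>(2)[rule_format, of "(x, t)"] \<psi>2(2)[rule_format, of "(x, t)"] by auto
      then show ?thesis by (simp add: tested_def)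
    qed (rule green_in_time[OF _ b])
  qed
  also have "\<dots> = (LBINT x. w x 0 b * \<psi> (x, b)) +
      (LBINT z. tested (\<lambda>x t b. t powr l *\<^sub>R J w2 x t b) \<psi> z b) + (LBINT z. tested (S w1) \<psi> z b)"
    unfolding tested_iterated(1)[OF C cP \<psi>] tested_iterated(1)[OF C cS \<psi>]
    using integrable_trace_slice[of b] tested_iterated(3)[OF C cP \<psi>, of b] tested_iterated(3)[OF C cS \<psi>, of b]
    by (simp only: Bochner_Integration.integral_add Bochner_Integration.integrable_add)
  finally show ?thesis
    unfolding tested_adjoint[OF b(1)] by simp
next
  case False
  have z: "tested Q \<Psi> z b = 0" if "\<forall>z. z \<notin> C \<longrightarrow> \<Psi> z = 0" for Q \<Psi> z
    using that[rule_format, of z] C(2) False by (cases "z \<in> C") (auto simp: tested_def indicator_def)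
  have "\<psi> (x, b) = 0" for x
    by (rule \<psi>(2)[rule_format]) (use C(2) False in auto)
  then show ?thesis
    using z[where \<Psi> = "\<lambda>z. \<psi>2 z - \<Theta> z"] z[where \<Psi> = \<psi>] \<psi>2(2)[rule_format] \<Theta>(2)[rule_format] \<psi>(2)[rule_format] by simp
qed

text \<open>Integrating over the source time turns \<open>J w\<close> into the solution, and the initial values \<open>w(x, 0; b)\<close> into the
  trace \<open>w(x, 0; t)\<close>.\<close>

lemma weak_equation:
  "(LBINT z:W. sol l w (fst z) (snd z) * (\<psi>2 z - \<Theta> z)) =
   (LBINT z:W. (w (fst z) 0 (snd z) + (LBINT b:{0..snd z}. S w1 (fst z) (snd z) b)) * \<psi> z)"
proof -
  have \<Psi>: "continuous_on UNIV (\<lambda>z. \<psi>2 z - \<Theta> z)" "\<forall>z. z \<notin> C \<longrightarrow> \<psi>2 z - \<Theta> z = 0"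
    using \<psi>2 \<Theta> by (auto intro!: continuous_intros)
  note FJ = Fubini_tested[OF C continuous_on_J(1)[OF w(1)] locally_bounded_J[OF w(1)] \<Psi>]
    and FS = Fubini_tested[OF C continuous_on_S[OF w(2)] locally_bounded_S[OF w(2)] \<psi>]
  have W: "W \<in> sets lborel" using U by (simp add: open_Times borel_open)
  have trace: "set_integrable lborel W (\<lambda>z. w (fst z) 0 (snd z) * \<psi> z)"
    "(LBINT z:W. w (fst z) 0 (snd z) * \<psi> z) = (LBINT b. (LBINT x. w x 0 b * \<psi> (x, b)))"
    "integrable lborel (\<lambda>b. LBINT x. w x 0 b * \<psi> (x, b))"
  proof -
    have e: "(\<lambda>z. indicator W z *\<^sub>R (w (fst z) 0 (snd z) * \<psi> z)) = (\<lambda>z. w (fst z) 0 (snd z) * \<psi> z)"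
      using C(2) \<psi>(2)[rule_format] by (fastforce simp: fun_eq_iff indicator_def)
    have i: "integrable (lborel \<Otimes>\<^sub>M lborel) (\<lambda>(x, t). w x 0 t * \<psi> (x, t))"
      using integrable_trace by (simp add: lborel_prod split_beta')
    show "set_integrable lborel W (\<lambda>z. w (fst z) 0 (snd z) * \<psi> z)"
      unfolding set_integrable_def e by (rule integrable_trace)
    show "(LBINT z:W. w (fst z) 0 (snd z) * \<psi> z) = (LBINT b. (LBINT x. w x 0 b * \<psi> (x, b)))"
      unfolding set_lebesgue_integral_def e using lborel_pair.integral_snd[OF i]
      by (simp add: lborel_prod split_beta')
    show "integrable lborel (\<lambda>b. LBINT x. w x 0 b * \<psi> (x, b))"
      using lborel_pair.integrable_snd[OF i] by simp
  qed
  have "(LBINT z:W. sol l w (fst z) (snd z) * (\<psi>2 z - \<Theta> z)) =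
      (LBINT z:W. (LBINT b:{0..snd z}. J w (fst z) (snd z) b) * (\<psi>2 z - \<Theta> z))"
    by (rule set_lebesgue_integral_cong[OF W]) (auto simp: sol_eq(2)[OF w(1)])
  also have "\<dots> = (LBINT b. (LBINT x. w x 0 b * \<psi> (x, b)) + (LBINT z. tested (S w1) \<psi> z b))"
    unfolding FJ(1) green_slice ..
  also have "\<dots> = (LBINT z:W. w (fst z) 0 (snd z) * \<psi> z) +
      (LBINT z:W. (LBINT b:{0..snd z}. S w1 (fst z) (snd z) b) * \<psi> z)"
    unfolding FS(1) trace(2) by (rule Bochner_Integration.integral_add[OF trace(3) FS(2)])
  also have "\<dots> = (LBINT z:W. w (fst z) 0 (snd z) * \<psi> z + (LBINT b:{0..snd z}. S w1 (fst z) (snd z) b) * \<psi> z)"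
    by (rule set_integral_add(2)[symmetric, OF trace(1) FS(3)])
  finally show ?thesis by (simp add: distrib_right)
qed

end

end

section \<open>The time derivative\<close>

lemma set_integrable_powr_0:
  fixes k T :: real
  assumes "k < 1" "0 \<le> T"
  shows "set_integrable lborel {0<..<T} (\<lambda>s. s powr (- k))"
proof -
  have "(\<lambda>s. s powr (- k)) absolutely_integrable_on {0..T}"
    by (intro nonnegative_absolutely_integrable_1 integrable_on_powr_from_0) (use assms in auto)
  then have "integrable (completion lborel) (\<lambda>s. indicator {0..T} s *\<^sub>R s powr (- k))"
    by (simp add: set_integrable_def)
  then have "set_integrable lborel {0..T} (\<lambda>s. s powr (- k))"
    unfolding set_integrable_def by (subst (asm) integrable_completion) auto
  then show ?thesis unfolding set_integral_Icc_eq_Ioo(1) .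
qed

context wave_data
begin

context
  assumes l4: "l < 4"
begin

text \<open>An exponent above \<open>l / 4\<close> and \<open>0\<close>, and below \<open>1\<close>; this is where \<open>l < 4\<close> enters.\<close>

definition \<kappa> :: real where "\<kappa> = (l + 8) / 12"

lemma \<kappa>: "0 < \<kappa>" "l / 4 \<le> \<kappa>" "\<kappa> < 1"
  using l l4 by (auto simp: \<kappa>_def)

text \<open>On the characteristic the kernel contributes \<open>(t / b)\<^sup>l\<^sup>/\<^sup>4\<close>, which \<open>(t / b)\<^sup>\<kappa>\<close> dominates as \<open>t \<ge> b\<close>.\<close>

lemma V_bound:
  assumes C: "compact C" "C \<subseteq> U"
  obtains M where "0 \<le> M" "\<And>x t b. x \<in> C \<Longrightarrow> 0 < b \<Longrightarrow> b \<le> t \<Longrightarrow> t < t0 \<Longrightarrow> norm (V x t b) \<le> M * (t / b) powr \<kappa>"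
proof -
  obtain M where M: "0 \<le> M" "\<And>x r b. x \<in> C \<Longrightarrow> r \<in> {0..\<phi> l t0} \<Longrightarrow> b \<in> {0..t0} \<Longrightarrow> norm (w x r b) \<le> M"
    using data_bound[OF w(1) C] by blast
  obtain B where B: "B > 0" "\<And>t b h M. 0 < b \<Longrightarrow> b \<le> t \<Longrightarrow> continuous_on {0..\<phi> l t - \<phi> l b} h \<Longrightarrow>
    (\<And>r. r \<in> {0..\<phi> l t - \<phi> l b} \<Longrightarrow> norm (h r :: complex) \<le> M) \<Longrightarrow>
    norm (integral {0..\<phi> l t - \<phi> l b} (\<lambda>r. K_t l t b r *\<^sub>R h r)) \<le> B * M * (t / b) powr \<kappa>"
    using inner_integral_K_t_bound[OF l \<kappa>(1,2)] by blast
  show ?thesis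
  proof (rule that[of "M + B * M"])
    show "0 \<le> M + B * M" using M B by simp
    fix x t b assume a: "x \<in> C" "0 < b" "b \<le> t" "t < t0"
    note p = \<phi>_past[OF a(2-4)]
    have "norm (J_t w x t b) \<le> B * M * (t / b) powr \<kappa>"
      unfolding J_t_def
    proof (rule B(2)[OF a(2,3)])
      show "continuous_on {0..\<phi> l t - \<phi> l b} (\<lambda>r. w x r b)"
        using data_slice_r[OF w(1) _ a(2-4)] a C by auto
      show "norm (w x r b) \<le> M" if "r \<in> {0..\<phi> l t - \<phi> l b}" for r
        using that a p by (intro M) auto
    qed
    moreover have "norm ((t powr (l / 4) * b powr (- l / 4)) *\<^sub>R w x (\<phi> l t - \<phi> l b) b) \<le> M * (t / b) powr \<kappa>"
    proof -
      have "t powr (l / 4) * b powr (- l / 4) = (t / b) powr (l / 4)"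
        using a p by (simp add: powr_divide powr_minus_divide)
      also have "\<dots> \<le> (t / b) powr \<kappa>"
        using a \<kappa> by (intro powr_mono) (auto simp: field_simps)
      finally have 1: "t powr (l / 4) * b powr (- l / 4) \<le> (t / b) powr \<kappa>" .
      have "norm (w x (\<phi> l t - \<phi> l b) b) \<le> M" using a p by (intro M) auto
      then have "(t powr (l / 4) * b powr (- l / 4)) * norm (w x (\<phi> l t - \<phi> l b) b) \<le> (t / b) powr \<kappa> * M"
        using 1 by (intro mult_mono) auto
      then show ?thesis by (simp add: mult.commute)
    qed
    ultimately show "norm (V x t b) \<le> (M + B * M) * (t / b) powr \<kappa>"
      unfolding V_def distrib_right by (rule norm_triangle_mono[rotated])
  qed
qed

lemma scaled_power: "0 < s \<Longrightarrow> 0 < t \<Longrightarrow> (t / (t * s)) powr \<kappa> = s powr (- \<kappa>)"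
  by (simp add: powr_minus_divide powr_divide)

lemma V_dominated:
  assumes C: "compact C" "C \<subseteq> U"
  shows "\<exists>M. \<forall>x\<in>C. \<forall>t\<in>{0<..<t0}. \<forall>s\<in>{0<..<1}. norm (V x t (t * s)) \<le> M * s powr (- \<kappa>)"
proof -
  obtain M where M: "0 \<le> M" "\<And>x t b. x \<in> C \<Longrightarrow> 0 < b \<Longrightarrow> b \<le> t \<Longrightarrow> t < t0 \<Longrightarrow> norm (V x t b) \<le> M * (t / b) powr \<kappa>"
    using V_bound[OF C] by blast
  have "norm (V x t (t * s)) \<le> M * s powr (- \<kappa>)" if "x \<in> C" "t \<in> {0<..<t0}" "s \<in> {0<..<1}" for x t s
  proof -
    have "norm (V x t (t * s)) \<le> M * (t / (t * s)) powr \<kappa>"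
      by (rule M(2)) (use that in \<open>auto simp: mult_left_le\<close>)
    also have "(t / (t * s)) powr \<kappa> = s powr (- \<kappa>)"
      by (rule scaled_power) (use that in auto)
    finally show ?thesis .
  qed
  then show ?thesis by blast
qed

definition sol_t :: "'a \<Rightarrow> real \<Rightarrow> complex" where
  "sol_t x t = (LBINT b:{0..t}. V x t b)"

lemma sol_t_0: "sol_t x 0 = 0"
  unfolding sol_t_def set_integral_Icc_eq_Ioo(2) by (simp add: set_lebesgue_integral_def)

lemma continuous_on_sol_t: "continuous_on (U \<times> {0..<t0}) (\<lambda>(x, t). sol_t x t)"
  unfolding sol_t_def
  by (rule continuous_on_superposition[OF continuous_on_V set_integrable_powr_0 V_dominated])
    (use \<kappa> in auto)

text \<open>Each \<open>J w x t b\<close> is the integral of its time derivative over \<open>[b, t]\<close>, as it vanishes at \<open>t = b\<close>;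
  exchanging the order of integration gives the same for their superposition. The bound \<open>(t / b)\<^sup>\<kappa>\<close> is integrable over \<open>0 < b < s < t\<close>.\<close>

lemma sol_eq_integral_sol_t:
  assumes x: "x \<in> U" and t: "0 \<le> t" "t < t0"
  shows "sol l w x t = integral {0..t} (sol_t x)"
proof (cases "t = 0")
  case True
  then show ?thesis by (simp add: sol_0)
next
  case False
  then have tp: "0 < t" using t by simp
  obtain M where M: "0 \<le> M" "\<And>y s b. y \<in> {x} \<Longrightarrow> 0 < b \<Longrightarrow> b \<le> s \<Longrightarrow> s < t0 \<Longrightarrow> norm (V y s b) \<le> M * (s / b) powr \<kappa>"
    using V_bound[of "{x}"] x by auto
  let ?f = "\<lambda>b s. indicator {y. 0 < fst y \<and> fst y < snd y \<and> snd y < t} (b, s) *\<^sub>R V x s b"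
  have O: "open {y :: real \<times> real. 0 < fst y \<and> fst y < snd y \<and> snd y < t}"
    by (intro open_Collect_conj open_Collect_less continuous_intros)
  have meas: "(\<lambda>(b, s). ?f b s) \<in> borel_measurable (lborel \<Otimes>\<^sub>M lborel)"
  proof -
    have "(\<lambda>y. ?f (fst y) (snd y)) \<in> borel_measurable borel"
      unfolding prod.collapse
      by (rule borel_measurable_continuous_on_indicator)
        (use O x t in \<open>auto intro!: continuous_on_triple_slice[OF continuous_on_V] continuous_intros simp: past_def\<close>)
    then show ?thesis by (simp add: split_beta' lborel_prod)
  qed
  have bound: "norm (?f b s) \<le> indicator {0<..<t} b * (M * t powr \<kappa> * b powr (- \<kappa>)) * indicator {0..t} s" for b s
  proof (cases "0 < b \<and> b < s \<and> s < t")
    case True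
    have "norm (V x s b) \<le> M * (s / b) powr \<kappa>" using M(2)[of x b s] True t by auto
    also have "\<dots> \<le> M * (t / b) powr \<kappa>"
      using True M \<kappa> by (intro mult_left_mono powr_mono2 divide_right_mono) auto
    also have "(t / b) powr \<kappa> = t powr \<kappa> * b powr (- \<kappa>)"
      using True t by (simp add: powr_divide powr_minus_divide)
    finally show ?thesis using True by (simp add: indicator_def mult.assoc)
  next
    case False
    then show ?thesis using M by (auto simp: indicator_def)
  qed
  have ind: "integrable lborel (indicator {0..t} :: real \<Rightarrow> real)"
    by (rule integrable_real_indicator) (use t in auto)
  have i2: "integrable lborel (\<lambda>s. ?f b s)" for b
  proof (rule Bochner_Integration.integrable_bound)
    show "integrable lborel (\<lambda>s. indicator {0<..<t} b * (M * t powr \<kappa> * b powr (- \<kappa>)) * indicator {0..t} s :: real)"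
      by (rule integrable_mult_right) (rule ind)
    show "(\<lambda>s. ?f b s) \<in> borel_measurable lborel"
    proof -
      have "(\<lambda>s. (\<lambda>(b, s). ?f b s) (b, s)) \<in> borel_measurable lborel"
        by (rule measurable_Pair2[OF meas]) simp
      then show ?thesis by (simp only: prod.case)
    qed
    show "AE s in lborel. norm (?f b s) \<le> norm (indicator {0<..<t} b * (M * t powr \<kappa> * b powr (- \<kappa>)) * indicator {0..t} s :: real)"
      unfolding real_norm_def by (intro AE_I2 order_trans[OF bound abs_ge_self])
  qed
  have int: "integrable (lborel \<Otimes>\<^sub>M lborel) (\<lambda>(b, s). ?f b s)"
  proof (rule lborel_pair.Fubini_integrable[OF meas])
    show "AE b in lborel. integrable lborel (\<lambda>s. case (b, s) of (b, s) \<Rightarrow> ?f b s)"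
      using i2 by simp
    show "integrable lborel (\<lambda>b. LBINT s. norm (case (b, s) of (b, s) \<Rightarrow> ?f b s))"
    proof (rule Bochner_Integration.integrable_bound)
      show "integrable lborel (\<lambda>b. (M * t powr \<kappa> * t) * (indicator {0<..<t} b *\<^sub>R b powr (- \<kappa>)))"
      proof (rule integrable_mult_right)
        show "integrable lborel (\<lambda>b. indicator {0<..<t} b *\<^sub>R b powr (- \<kappa>))"
          using set_integrable_powr_0[OF \<kappa>(3) t(1)] unfolding set_integrable_def .
      qed
      show "(\<lambda>b. LBINT s. norm (case (b, s) of (b, s) \<Rightarrow> ?f b s)) \<in> borel_measurable lborel"
      proof -
        have "(\<lambda>y. norm (case y of (b, s) \<Rightarrow> ?f b s)) \<in> borel_measurable (lborel \<Otimes>\<^sub>M lborel)"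
          by (rule measurable_compose[OF meas borel_measurable_norm])
        then have "(\<lambda>(b, s). norm (?f b s)) \<in> borel_measurable (lborel \<Otimes>\<^sub>M lborel)"
          by (simp only: split_beta')
        then show ?thesis
          unfolding prod.case by (rule lborel.borel_measurable_lebesgue_integral)
      qed
      show "AE b in lborel. norm (LBINT s. norm (case (b, s) of (b, s) \<Rightarrow> ?f b s)) \<le>
        norm ((M * t powr \<kappa> * t) * (indicator {0<..<t} b *\<^sub>R b powr (- \<kappa>)))"
      proof (rule AE_I2)
        fix b :: real
        have "(LBINT s. norm (?f b s)) \<le>
            (LBINT s. indicator {0<..<t} b * (M * t powr \<kappa> * b powr (- \<kappa>)) * indicator {0..t} s)"
        proof (rule integral_mono)
          show "integrable lborel (\<lambda>s. indicator {0<..<t} b * (M * t powr \<kappa> * b powr (- \<kappa>)) * indicator {0..t} s :: real)"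
            by (rule integrable_mult_right) (rule ind)
        qed (rule integrable_norm[OF i2] bound)+
        also have "\<dots> = (M * t powr \<kappa> * t) * (indicator {0<..<t} b *\<^sub>R b powr (- \<kappa>))"
          using t by simp
        finally have "(LBINT s. norm (?f b s)) \<le> (M * t powr \<kappa> * t) * (indicator {0<..<t} b *\<^sub>R b powr (- \<kappa>))" .
        moreover have "0 \<le> (LBINT s. norm (?f b s))" by simp
        ultimately show "norm (LBINT s. norm (case (b, s) of (b, s) \<Rightarrow> ?f b s)) \<le>
          norm ((M * t powr \<kappa> * t) * (indicator {0<..<t} b *\<^sub>R b powr (- \<kappa>)))"
          by simp
      qed
    qed
  qed
  have inner_b: "(LBINT b. ?f b s) = indicator {0<..<t} s *\<^sub>R sol_t x s" for s
  proof (cases "s \<in> {0<..<t}")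
    case True
    have "(LBINT b. ?f b s) = (LBINT b:{0<..<s}. V x s b)"
      unfolding set_lebesgue_integral_def
      by (rule Bochner_Integration.integral_cong) (use True in \<open>auto simp: indicator_def\<close>)
    then show ?thesis using True by (simp add: sol_t_def set_integral_Icc_eq_Ioo(2))
  next
    case False
    then have "(\<lambda>b. ?f b s) = (\<lambda>b. 0)" by (auto simp: indicator_def fun_eq_iff)
    then show ?thesis using False by simp
  qed
  have inner_s: "(LBINT s. ?f b s) = indicator {0<..<t} b *\<^sub>R J w x t b" for b
  proof (cases "b \<in> {0<..<t}")
    case True
    have cs: "continuous_on {b..t} (\<lambda>s. V x s b)" "continuous_on {b..t} (\<lambda>s. J w x s b)"
      by (rule continuous_on_triple_slice[OF continuous_on_V] continuous_on_triple_slice[OF continuous_on_J(1)[OF w(1)]],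
        (intro continuous_intros)+, use x True t in \<open>auto simp: past_def\<close>)+
    have "((\<lambda>s. V x s b) has_integral J w x t b - J w x b b) {b..t}"
      using True t by (intro fundamental_theorem_of_calculus_interior cs has_vector_derivative_J(1)[OF x]) auto
    moreover have "J w x b b = 0" using True by (intro J_V_initial(1)) auto
    ultimately have J: "integral {b..t} (\<lambda>s. V x s b) = J w x t b"
      by (simp add: integral_unique)
    have "(LBINT s. ?f b s) = (LBINT s:{b<..<t}. V x s b)"
      unfolding set_lebesgue_integral_def
      by (rule Bochner_Integration.integral_cong) (use True in \<open>auto simp: indicator_def\<close>)
    also have "\<dots> = integral {b..t} (\<lambda>s. V x s b)"
      unfolding set_integral_Icc_eq_Ioo(2)[symmetric]
      by (rule set_borel_integral_eq_integral(2)[OF borel_integrable_atLeastAtMost'[OF cs(1)]])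
    finally show ?thesis using J True by simp
  next
    case False
    then have "(\<lambda>s. ?f b s) = (\<lambda>s. 0)" by (auto simp: indicator_def fun_eq_iff)
    then show ?thesis using False by simp
  qed
  have "sol l w x t = (LBINT b:{0<..<t}. J w x t b)"
    using sol_eq(2)[OF w(1) x, of t] tp t by (simp add: set_integral_Icc_eq_Ioo(2))
  also have "\<dots> = (LBINT b. (LBINT s. ?f b s))"
    unfolding set_lebesgue_integral_def inner_s ..
  also have "\<dots> = (LBINT s. (LBINT b. ?f b s))"
    by (rule lborel_pair.Fubini_integral[symmetric, OF int])
  also have "\<dots> = (LBINT s:{0..t}. sol_t x s)"
    unfolding set_integral_Icc_eq_Ioo(2) unfolding set_lebesgue_integral_def inner_b ..
  also have "\<dots> = integral {0..t} (sol_t x)"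
  proof (rule set_borel_integral_eq_integral(2)[OF borel_integrable_atLeastAtMost'])
    have "continuous_on {0..t} (\<lambda>s. (\<lambda>(x, t). sol_t x t) (x, s))"
      by (rule continuous_on_compose2[OF continuous_on_sol_t]) (use x t in \<open>auto intro!: continuous_intros\<close>)
    then show "continuous_on {0..t} (sol_t x)" by simp
  qed
  finally show ?thesis .
qed

lemma has_vector_derivative_sol:
  assumes x: "x \<in> U" and t: "0 \<le> t" "t < t0"
  shows "((\<lambda>s. sol l w x s) has_vector_derivative sol_t x t) (at t within {0..<t0})"
proof -
  obtain T where T: "t < T" "T < t0" using t(2) dense by blast
  have "continuous_on {0..T} (\<lambda>s. (\<lambda>(x, t). sol_t x t) (x, s))"
    by (rule continuous_on_compose2[OF continuous_on_sol_t]) (use x T in \<open>auto intro!: continuous_intros\<close>)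
  then have "((\<lambda>s. integral {0..s} (sol_t x)) has_vector_derivative sol_t x t) (at t within {0..T})"
    by (intro integral_has_vector_derivative) (use t T in auto)
  then have "((\<lambda>s. sol l w x s) has_vector_derivative sol_t x t) (at t within {0..T})"
    by (rule has_vector_derivative_transform[rotated 2])
      (use t T x in \<open>auto intro!: sol_eq_integral_sol_t[symmetric] sol_eq_integral_sol_t\<close>)
  moreover have "at t within {0..T} = at t within {0..<t0}"
    by (rule at_within_nhd[of t "{..<T}"]) (use t T in auto)
  ultimately show ?thesis by simp
qed

end

end

section \<open>Distributional derivatives in space\<close>

lemma dist_derivs_eq:
  "dist_derivs vs T \<eta> = (- 1) ^ length vs * T (partial_derivs (rev vs) \<eta>)"
proof (induction vs arbitrary: \<eta>)
  case (Cons v vs)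
  have "dist_derivs (v # vs) T \<eta> = - dist_derivs vs T (partial_deriv v \<eta>)"
    by (simp add: dist_derivs_def dist_deriv_def)
  then show ?case by (simp add: Cons.IH partial_derivs_simps)
qed (simp add: dist_derivs_def partial_derivs_simps)

lemma partial_derivs_cmult:
  fixes f :: "'a::euclidean_space \<Rightarrow> complex"
  assumes "Ck_on (length vs) UNIV f" "set vs \<subseteq> Basis"
  shows "partial_derivs vs (\<lambda>y. c * f y) x = c * partial_derivs vs f x"
  using assms
proof (induction vs arbitrary: x)
  case (Cons v vs)
  have "partial_derivs vs (\<lambda>y. c * f y) = (\<lambda>y. c * partial_derivs vs f y)"
    using Cons Ck_on_le[of "length (v # vs)" UNIV f "length vs"] by (auto simp: fun_eq_iff)
  moreover have "(\<lambda>s. partial_derivs vs f (x + s *\<^sub>R v)) differentiable (at 0)"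
    using Cons.prems unfolding Ck_on_def by auto
  ultimately show ?case
    by (auto simp: partial_derivs_simps intro!: partial_deriv_eqI has_vector_derivative_mult_right has_partial_deriv)
qed (simp add: partial_derivs_simps)

lemma count_mi_list: "count_list (mi_list \<alpha>) i = \<alpha> i"
proof -
  obtain xs :: "'a list" where "mset xs = Abs_multiset \<alpha>" using ex_mset by blast
  moreover have "count (Abs_multiset \<alpha>) = \<alpha>" by (simp add: count_Abs_multiset)
  ultimately have "\<forall>i. count_list xs i = \<alpha> i" by (metis count_mset)
  then have "\<forall>i. count_list (mi_list \<alpha>) i = \<alpha> i"
    unfolding mi_list_def by (rule someI)
  then show ?thesis ..
qed

lemma length_mi_list: "\<alpha> \<in> multi_indices m \<Longrightarrow> length (mi_list \<alpha>) \<le> m"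
  using sum_count_set[of "mi_list \<alpha>" UNIV] by (simp add: count_mi_list multi_indices_def)

context wave_transform
begin

text \<open>Here \<open>\<phi>'\<^sup>2 = t\<^sup>l\<close>. On the line \<open>r = 0\<close> the kernel is the one in the definition of \<open>source\<close>.\<close>

lemma source_eq:
  assumes "data h'" "x \<in> U" "t \<in> {0<..<t0}"
  shows "set_integrable lborel {0..t} (source_integrand l h' x t)"
    "complex_of_real (c_l l * (deriv (\<phi> l) t)\<^sup>2) * (LBINT b:{0..t}. source_integrand l h' x t b) =
      (LBINT b:{0..t}. S h' x t b)"
proof -
  have t: "0 < t" "t < t0" using assms by auto
  have c: "c_l l > 0" using l by (simp add: c_l_def)
  define k where "k = c_l l * (deriv (\<phi> l) t)\<^sup>2"
  have "deriv (\<phi> l) t = t powr (l / 2)" by (rule DERIV_imp_deriv[OF DERIV_\<phi>[OF l t(1)]])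
  moreover have "(t powr (l / 2))\<^sup>2 = t powr l"
    by (simp add: power2_eq_square flip: powr_add)
  ultimately have k: "k = c_l l * t powr l" by (simp add: k_def)
  have k0: "k \<noteq> 0" using c t by (simp add: k)
  have e: "S h' x t b = complex_of_real k * source_integrand l h' x t b" if b: "b \<in> {0<..<t}" for b
  proof -
    have p: "0 < \<phi> l t + \<phi> l b" using \<phi>_pos[OF l t(1)] \<phi>_nonneg[OF l, of b] by simp
    then have "((\<phi> l t + \<phi> l b)\<^sup>2) powr (- \<gamma> l) = (\<phi> l t + \<phi> l b) powr (- 2 * \<gamma> l)"
      by (simp add: power2_eq_square powr_mult flip: powr_add)
    then show ?thesis
      by (simp add: S_def K_def[OF l] kernel_def source_integrand_def k scaleR_conv_of_real mult_ac)
  qed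
  have iS: "set_integrable lborel {0..t} (S h' x t)"
    by (rule source_time_scaling(1)[where W = W and g = "\<lambda>s. 1"])
      (use continuous_on_past_interior[OF continuous_on_S[OF assms(1)]] locally_bounded_S[OF assms(1)] assms set_integrable_one
        in \<open>auto simp: locally_bounded_def\<close>)
  have "set_integrable lborel {0<..<t} (\<lambda>b. complex_of_real (1 / k) * S h' x t b)"
    using iS unfolding set_integral_Icc_eq_Ioo(1) by (rule set_integrable_mult_right)
  moreover have "source_integrand l h' x t b = complex_of_real (1 / k) * S h' x t b" if "b \<in> {0<..<t}" for b
    using e[OF that] k0 by simp
  ultimately have "set_integrable lborel {0<..<t} (source_integrand l h' x t)"
    by (subst set_integrable_cong[OF refl refl]) auto
  then show "set_integrable lborel {0..t} (source_integrand l h' x t)"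
    unfolding set_integral_Icc_eq_Ioo(1) .
  have "(LBINT b:{0<..<t}. S h' x t b) = (LBINT b:{0<..<t}. complex_of_real k * source_integrand l h' x t b)"
    by (rule set_lebesgue_integral_cong) (use e in auto)
  then show "complex_of_real (c_l l * (deriv (\<phi> l) t)\<^sup>2) * (LBINT b:{0..t}. source_integrand l h' x t b) =
      (LBINT b:{0..t}. S h' x t b)"
    unfolding set_integral_Icc_eq_Ioo(2) k_def by simp
qed

lemma continuous_on_source:
  assumes "data h'"
  shows "continuous_on W (\<lambda>(x, t). LBINT b:{0..t}. S h' x t b)"
  by (rule continuous_on_source_time_integral[where g = "\<lambda>s. 1"])
    (use continuous_on_past_interior[OF continuous_on_S[OF assms(1)]] locally_bounded_S[OF assms(1)] assms set_integrable_one
        in \<open>auto simp: locally_bounded_def\<close>)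

lemma transform_converges_data:
  assumes w: "data w" and w1: "data (d_r (\<phi> l t0) w)"
  shows "transform_converges l U (\<phi> l t0) t0 w"
  unfolding transform_converges_def
proof (intro ballI conjI)
  fix x t assume x: "x \<in> U" and t: "t \<in> {0..<t0}"
  show "set_integrable lborel {0..\<bar>\<phi> l t - \<phi> l b\<bar>} (\<lambda>r. complex_of_real (kernel l t b r) * w x r b)"
    if "b \<in> {0<..<t}" for b
    by (rule inner_int_eq_J(1)[OF w x]) (use that t in auto)
  have 0: "set_integrable lborel {0..0::real} F" for F :: "real \<Rightarrow> complex"
    unfolding set_integral_Icc_eq_Ioo(1) by (simp add: set_integrable_def)
  show "set_integrable lborel {0..t} (inner_int l w x t)"
    using sol_eq(1)[OF w x, of t] 0 t by (cases "t = 0") auto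
  show "set_integrable lborel {0..t} (source_integrand l (d_r (\<phi> l t0) w) x t)"
    using source_eq(1)[OF w1 x, of t] 0 t by (cases "t = 0") auto
qed

lemma C_m_2_0_data:
  assumes "C_m_2_0_on m U (\<phi> l t0) t0 w"
  shows "data w" "data (d_r (\<phi> l t0) w)" "data ((d_r (\<phi> l t0) ^^ 2) w)"
    "\<And>x r b. x \<in> U \<Longrightarrow> r \<in> {0..\<phi> l t0} \<Longrightarrow> b \<in> {0..t0} \<Longrightarrow>
      ((\<lambda>r. w x r b) has_vector_derivative d_r (\<phi> l t0) w x r b) (at r within {0..\<phi> l t0})"
    "\<And>x r b. x \<in> U \<Longrightarrow> r \<in> {0..\<phi> l t0} \<Longrightarrow> b \<in> {0..t0} \<Longrightarrow>
      ((\<lambda>r. d_r (\<phi> l t0) w x r b) has_vector_derivative (d_r (\<phi> l t0) ^^ 2) w x r b) (at r within {0..\<phi> l t0})"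
proof -
  let ?d = "d_r (\<phi> l t0)"
  have d2: "(?d ^^ 2) w = ?d (?d w)" by (simp add: numeral_2_eq_2)
  have c: "continuous_on (U \<times> {0..\<phi> l t0} \<times> {0..t0}) (\<lambda>(x, r, b). (?d ^^ k) w x r b)" if "k \<le> 2" for k
    using assms that unfolding C_m_2_0_on_def by blast
  show "data w" "data (?d w)" "data ((?d ^^ 2) w)"
    unfolding data_def using c[of 0] c[of 1] c[of 2] by simp_all
  have D: "(\<lambda>s. (?d ^^ k) w x s b) differentiable at r within {0..\<phi> l t0}"
    if "k < 2" "x \<in> U" "r \<in> {0..\<phi> l t0}" "b \<in> {0..t0}" for k x r b
    using assms that unfolding C_m_2_0_on_def by blast
  fix x r b assume a: "x \<in> U" "r \<in> {0..\<phi> l t0}" "b \<in> {0..t0}"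
  show "((\<lambda>r. w x r b) has_vector_derivative ?d w x r b) (at r within {0..\<phi> l t0})"
    using D[of 0, OF _ a] by (simp add: d_r_def vector_derivative_works)
  show "((\<lambda>r. ?d w x r b) has_vector_derivative (?d ^^ 2) w x r b) (at r within {0..\<phi> l t0})"
    using D[of 1, OF _ a] unfolding d2 by (simp add: d_r_def[of _ "?d w"] vector_derivative_works)
qed

end

lemma regular_dist_integrable:
  fixes W :: "'a::euclidean_space set"
  assumes W: "open W" and C: "compact C" "C \<subseteq> W" and u: "continuous_on W u"
    and h: "continuous_on UNIV h" "\<And>z. z \<notin> C \<Longrightarrow> h z = 0"
  shows "set_integrable lborel W (\<lambda>z. u z * h z :: complex)"
proof -
  have "integrable lborel (\<lambda>z. u z * h z)"
    by (rule integrable_continuous_compact_support[OF C(1)])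
      (use C h in \<open>auto intro!: continuous_intros intro: continuous_on_subset[OF u] continuous_on_subset[OF h(1)]\<close>)
  moreover have "(\<lambda>z. u z * h z) = (\<lambda>z. indicator W z *\<^sub>R (u z * h z))"
    using C h(2) by (auto simp: fun_eq_iff indicator_def)
  ultimately show ?thesis unfolding set_integrable_def by simp
qed

context
  fixes m :: nat and a :: "('n::finite \<Rightarrow> nat) \<Rightarrow> real ^ 'n \<Rightarrow> complex"
    and U :: "(real ^ 'n) set" and C :: "((real ^ 'n) \<times> real) set" and \<psi> :: "(real ^ 'n) \<times> real \<Rightarrow> complex"
    and t0 :: real
  assumes U: "open U" and a: "\<And>\<alpha>. \<alpha> \<in> multi_indices m \<Longrightarrow> smooth_on U (a \<alpha>)"
    and C: "compact C" "C \<subseteq> U \<times> {0<..<t0}"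
    and \<psi>: "smooth_on UNIV \<psi>" "\<And>z. z \<notin> C \<Longrightarrow> \<psi> z = 0"
begin

definition dirs :: "('n \<Rightarrow> nat) \<Rightarrow> (real ^ 'n) list" where
  "dirs \<alpha> = map (\<lambda>i. axis i 1) (mi_list \<alpha>)"

definition \<eta> :: "('n \<Rightarrow> nat) \<Rightarrow> (real ^ 'n) \<times> real \<Rightarrow> complex" where
  "\<eta> \<alpha> z = a \<alpha> (fst z) * \<psi> z"

text \<open>The formal adjoint \<open>A\<^sup>* \<psi>\<close> acting in \<open>x\<close>.\<close>

definition adj :: "(real ^ 'n) \<times> real \<Rightarrow> complex" where
  "adj z = (\<Sum>\<alpha>\<in>multi_indices m. (- 1) ^ length (dirs \<alpha>) * partial_derivs (rev (dirs \<alpha>)) (\<lambda>y. \<eta> \<alpha> (y, snd z)) (fst z))"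

lemma dirs: "set (dirs \<alpha>) \<subseteq> Basis" "\<alpha> \<in> multi_indices m \<Longrightarrow> length (dirs \<alpha>) \<le> m"
  using length_mi_list[of \<alpha> m] by (auto simp: dirs_def axis_in_Basis_iff)

lemma \<eta>_0: "z \<notin> C \<Longrightarrow> \<eta> \<alpha> z = 0"
  by (simp add: \<eta>_def \<psi>(2))

lemma Ck_\<eta>:
  assumes "\<alpha> \<in> multi_indices m"
  shows "Ck_on k UNIV (\<eta> \<alpha>)"
proof (rule Ck_on_extend_zero[of "U \<times> UNIV" C])
  have "Ck_on k (U \<times> UNIV) \<psi>"
    using \<psi>(1) unfolding smooth_on_def by (blast intro: Ck_on_subset)
  moreover have "Ck_on k (U \<times> (UNIV :: real set)) (\<lambda>z. a \<alpha> (fst z))"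
    using a[OF assms] unfolding smooth_on_def by (blast intro: Ck_on_fst)
  ultimately show "Ck_on k (U \<times> UNIV) (\<eta> \<alpha>)"
    unfolding \<eta>_def[abs_def] by (intro Ck_on_mult open_Times U open_UNIV)
qed (use U C in \<open>auto simp: \<eta>_0 open_Times compact_imp_closed\<close>)

lemma Ck_\<eta>_slice: "\<alpha> \<in> multi_indices m \<Longrightarrow> Ck_on k UNIV (\<lambda>y. \<eta> \<alpha> (y, t))"
  by (rule Ck_on_slice[OF Ck_\<eta>])

lemma \<eta>_derivs_slice:
  "partial_derivs (map (\<lambda>v. (v, 0)) (rev (dirs \<alpha>))) (\<eta> \<alpha>) z =
    partial_derivs (rev (dirs \<alpha>)) (\<lambda>y. \<eta> \<alpha> (y, snd z)) (fst z)"
  using partial_derivs_slice[of "rev (dirs \<alpha>)" "\<eta> \<alpha>" "fst z" "snd z"] by simp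

lemma continuous_on_\<eta>_derivs:
  assumes "\<alpha> \<in> multi_indices m"
  shows "continuous_on UNIV (\<lambda>z. partial_derivs (rev (dirs \<alpha>)) (\<lambda>y. \<eta> \<alpha> (y, snd z)) (fst z))"
proof -
  have "set (map (\<lambda>v. (v, 0::real)) (rev (dirs \<alpha>))) \<subseteq> Basis"
    using dirs(1)[of \<alpha>] by (auto simp: Basis_prod_def)
  then have "continuous_on UNIV (partial_derivs (map (\<lambda>v. (v, 0)) (rev (dirs \<alpha>))) (\<eta> \<alpha>))"
    using Ck_\<eta>[OF assms, of "length (dirs \<alpha>)"] unfolding Ck_on_def by simp
  then show ?thesis by (rule continuous_on_eq) (rule \<eta>_derivs_slice)
qed

lemma \<eta>_derivs_0: "z \<notin> C \<Longrightarrow> partial_derivs (rev (dirs \<alpha>)) (\<lambda>y. \<eta> \<alpha> (y, snd z)) (fst z) = 0"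
  unfolding \<eta>_derivs_slice[symmetric]
  by (rule partial_derivs_eq_0) (use C in \<open>auto simp: \<eta>_0 compact_imp_closed\<close>)

lemma adj: "continuous_on UNIV adj" "z \<notin> C \<Longrightarrow> adj z = 0"
  unfolding adj_def[abs_def]
  by (intro continuous_on_sum continuous_on_mult continuous_on_const continuous_on_\<eta>_derivs, assumption)
    (simp add: \<eta>_derivs_0)

text \<open>Each derivative in \<open>A\<close> is moved to \<open>a\<^sub>\<alpha> \<psi>\<close>, which is smooth on the whole space although \<open>a\<^sub>\<alpha>\<close> is
  smooth on \<open>U\<close> only.\<close>

lemma adj_identity:
  assumes g: "Ck_on m U g"
  shows "(LBINT x. g x * adj (x, t)) = (LBINT x. pdo m a g x * \<psi> (x, t))"
proof -
  let ?C = "fst ` C"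
  have C1: "compact ?C" "?C \<subseteq> U"
    using C by (auto intro!: compact_continuous_image continuous_intros)
  have z: "(x, t) \<notin> C" if "x \<notin> ?C" for x using that by force
  let ?L = "\<lambda>\<alpha>. length (dirs \<alpha>)"
  have i1: "integrable lborel (\<lambda>x. g x * ((- 1) ^ ?L \<alpha> * partial_derivs (rev (dirs \<alpha>)) (\<lambda>y. \<eta> \<alpha> (y, t)) x))"
    if "\<alpha> \<in> multi_indices m" for \<alpha>
  proof (rule integrable_continuous_compact_support[OF C1(1)])
    have "continuous_on UNIV (\<lambda>x. partial_derivs (rev (dirs \<alpha>)) (\<lambda>y. \<eta> \<alpha> (y, snd (x, t))) (fst (x, t)))"
      by (rule continuous_on_compose2[OF continuous_on_\<eta>_derivs[OF that]]) (auto intro!: continuous_intros)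
    then show "continuous_on ?C (\<lambda>x. g x * ((- 1) ^ ?L \<alpha> * partial_derivs (rev (dirs \<alpha>)) (\<lambda>y. \<eta> \<alpha> (y, t)) x))"
      using Ck_on_imp_continuous[OF g] C1
      by (intro continuous_intros) (auto intro: continuous_on_subset)
  qed (use \<eta>_derivs_0[OF z] in auto)
  have i2: "integrable lborel (\<lambda>x. partial_derivs (dirs \<alpha>) g x * \<eta> \<alpha> (x, t))"
    if "\<alpha> \<in> multi_indices m" for \<alpha>
  proof (rule integrable_continuous_compact_support[OF C1(1)])
    have "continuous_on U (partial_derivs (dirs \<alpha>) g)"
      using g dirs that unfolding Ck_on_def by auto
    then show "continuous_on ?C (\<lambda>x. partial_derivs (dirs \<alpha>) g x * \<eta> \<alpha> (x, t))"
      using Ck_on_imp_continuous[OF Ck_\<eta>_slice[OF that]] C1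
      by (intro continuous_intros) (auto intro: continuous_on_subset)
  qed (use \<eta>_0[OF z] in auto)
  have "(LBINT x. g x * adj (x, t)) =
      (LBINT x. (\<Sum>\<alpha>\<in>multi_indices m. g x * ((- 1) ^ ?L \<alpha> * partial_derivs (rev (dirs \<alpha>)) (\<lambda>y. \<eta> \<alpha> (y, t)) x)))"
    by (simp add: adj_def sum_distrib_left)
  also have "\<dots> = (\<Sum>\<alpha>\<in>multi_indices m. (LBINT x. g x * ((- 1) ^ ?L \<alpha> * partial_derivs (rev (dirs \<alpha>)) (\<lambda>y. \<eta> \<alpha> (y, t)) x)))"
    by (rule Bochner_Integration.integral_sum[OF i1])
  also have "\<dots> = (\<Sum>\<alpha>\<in>multi_indices m. (LBINT x. partial_derivs (dirs \<alpha>) g x * \<eta> \<alpha> (x, t)))"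
  proof (rule sum.cong[OF refl])
    fix \<alpha> :: "'n \<Rightarrow> nat" assume \<alpha>: "\<alpha> \<in> multi_indices m"
    have "(LBINT x. g x * ((- 1) ^ ?L \<alpha> * partial_derivs (rev (dirs \<alpha>)) (\<lambda>y. \<eta> \<alpha> (y, t)) x)) =
       (- 1) ^ ?L \<alpha> * (LBINT x. g x * partial_derivs (rev (dirs \<alpha>)) (\<lambda>y. \<eta> \<alpha> (y, t)) x)"
      unfolding mult.left_commute[of "g _" "(- 1) ^ ?L \<alpha>"] by (rule integral_mult_right_zero)
    also have "\<dots> = (LBINT x. partial_derivs (dirs \<alpha>) g x * \<eta> \<alpha> (x, t))"
      by (rule integral_by_parts_iterated[OF U C1 g dirs(1) dirs(2)[OF \<alpha>] Ck_\<eta>_slice[OF \<alpha>] \<eta>_0[OF z]])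
    finally show "(LBINT x. g x * ((- 1) ^ ?L \<alpha> * partial_derivs (rev (dirs \<alpha>)) (\<lambda>y. \<eta> \<alpha> (y, t)) x)) =
       (LBINT x. partial_derivs (dirs \<alpha>) g x * \<eta> \<alpha> (x, t))" .
  qed
  also have "\<dots> = (LBINT x. (\<Sum>\<alpha>\<in>multi_indices m. partial_derivs (dirs \<alpha>) g x * \<eta> \<alpha> (x, t)))"
    by (rule Bochner_Integration.integral_sum[OF i2, symmetric])
  also have "\<dots> = (LBINT x. pdo m a g x * \<psi> (x, t))"
    by (simp add: pdo_def dirs_def \<eta>_def sum_distrib_left mult_ac)
  finally show ?thesis .
qed

text \<open>The factor \<open>t\<^sup>l\<close> does not depend on \<open>x\<close> and passes through the derivatives.\<close>

lemma dist_pdo_eq: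
  fixes u :: "(real ^ 'n) \<times> real \<Rightarrow> complex"
  assumes u: "continuous_on (U \<times> {0<..<t0}) u"
  shows "dist_mult (\<lambda>(x, t). complex_of_real (t powr l)) (dist_pdo m a (regular_dist (U \<times> {0<..<t0}) u)) \<psi> =
    (LBINT z:U \<times> {0<..<t0}. u z * (complex_of_real (snd z powr l) * adj z))"
proof -
  let ?W = "U \<times> {0<..<t0}" and ?c = "\<lambda>z::(real ^ 'n) \<times> real. complex_of_real (snd z powr l)"
  let ?d = "\<lambda>\<alpha> z. (- 1) ^ length (dirs \<alpha>) * partial_derivs (rev (dirs \<alpha>)) (\<lambda>y. \<eta> \<alpha> (y, snd z)) (fst z)"
  have W: "open ?W" using U by (simp add: open_Times)
  have T: "dist_mult (\<lambda>(x, t). a \<alpha> x) (dist_derivs (map (\<lambda>i. (axis i 1, 0)) (mi_list \<alpha>)) (regular_dist ?W u)) (\<lambda>z. ?c z * \<psi> z) =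
      (LBINT z:?W. u z * (?c z * ?d \<alpha> z))" if \<alpha>: "\<alpha> \<in> multi_indices m" for \<alpha>
  proof -
    have e: "partial_derivs (map (\<lambda>v. (v, 0)) (rev (dirs \<alpha>))) (\<lambda>z. ?c z * \<eta> \<alpha> z) z =
        ?c z * partial_derivs (rev (dirs \<alpha>)) (\<lambda>y. \<eta> \<alpha> (y, snd z)) (fst z)" for z
    proof -
      have "partial_derivs (map (\<lambda>v. (v, 0)) (rev (dirs \<alpha>))) (\<lambda>z. ?c z * \<eta> \<alpha> z) (fst z, snd z) =
          partial_derivs (rev (dirs \<alpha>)) (\<lambda>y. ?c z * \<eta> \<alpha> (y, snd z)) (fst z)"
        unfolding partial_derivs_slice by simp
      also have "\<dots> = ?c z * partial_derivs (rev (dirs \<alpha>)) (\<lambda>y. \<eta> \<alpha> (y, snd z)) (fst z)"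
        by (rule partial_derivs_cmult) (use Ck_\<eta>_slice[OF \<alpha>] dirs(1) in auto)
      finally show ?thesis by simp
    qed
    have m: "map (\<lambda>i. (axis i 1, 0)) (mi_list \<alpha>) = map (\<lambda>v. (v, 0::real)) (dirs \<alpha>)"
      by (simp add: dirs_def o_def)
    have p: "(\<lambda>z. (case z of (x, t) \<Rightarrow> a \<alpha> x) * (?c z * \<psi> z)) = (\<lambda>z. ?c z * \<eta> \<alpha> z)"
      by (auto simp: \<eta>_def fun_eq_iff)
    have "dist_mult (\<lambda>(x, t). a \<alpha> x) (dist_derivs (map (\<lambda>i. (axis i 1, 0)) (mi_list \<alpha>)) (regular_dist ?W u)) (\<lambda>z. ?c z * \<psi> z) =
        (- 1) ^ length (dirs \<alpha>) * (LBINT z:?W. u z * (?c z * partial_derivs (rev (dirs \<alpha>)) (\<lambda>y. \<eta> \<alpha> (y, snd z)) (fst z)))"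
      unfolding dist_mult_def m dist_derivs_eq p rev_map length_map regular_dist_def e ..
    also have "\<dots> = (LBINT z:?W. (- 1) ^ length (dirs \<alpha>) * (u z * (?c z * partial_derivs (rev (dirs \<alpha>)) (\<lambda>y. \<eta> \<alpha> (y, snd z)) (fst z))))"
      by (rule set_integral_mult_right[symmetric])
    finally show ?thesis by (simp only: mult_ac)
  qed
  have i: "set_integrable lborel ?W (\<lambda>z. u z * (?c z * ?d \<alpha> z))" if "\<alpha> \<in> multi_indices m" for \<alpha>
  proof (rule regular_dist_integrable[OF W C u])
    have "continuous_on ?W (\<lambda>z. ?c z * ?d \<alpha> z)"
      by (intro continuous_intros continuous_on_subset[OF continuous_on_\<eta>_derivs[OF that]]) auto
    then show "continuous_on UNIV (\<lambda>z. ?c z * ?d \<alpha> z)"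
      by (rule continuous_on_extend_zero[OF W C]) (simp add: \<eta>_derivs_0)
  qed (simp add: \<eta>_derivs_0)
  have "dist_mult (\<lambda>(x, t). complex_of_real (t powr l)) (dist_pdo m a (regular_dist ?W u)) \<psi> =
      (\<Sum>\<alpha>\<in>multi_indices m. LBINT z:?W. u z * (?c z * ?d \<alpha> z))"
  proof -
    have p: "(\<lambda>z. (case z of (x, t) \<Rightarrow> complex_of_real (t powr l)) * \<psi> z) = (\<lambda>z. ?c z * \<psi> z)"
      by (auto simp: fun_eq_iff)
    have "dist_mult (\<lambda>(x, t). complex_of_real (t powr l)) (dist_pdo m a (regular_dist ?W u)) \<psi> =
       dist_pdo m a (regular_dist ?W u) (\<lambda>z. ?c z * \<psi> z)"
      unfolding dist_mult_def[of _ "dist_pdo m a (regular_dist ?W u)"] p ..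
    also have "\<dots> = (\<Sum>\<alpha>\<in>multi_indices m. LBINT z:?W. u z * (?c z * ?d \<alpha> z))"
      unfolding dist_pdo_def by (rule sum.cong[OF refl T])
    finally show ?thesis .
  qed
  also have "\<dots> = (LBINT z:?W. (\<Sum>\<alpha>\<in>multi_indices m. u z * (?c z * ?d \<alpha> z)))"
    using i unfolding set_integrable_def set_lebesgue_integral_def
    by (subst Bochner_Integration.integral_sum[symmetric]) (auto simp: scaleR_sum_right)
  also have "\<dots> = (LBINT z:?W. u z * (?c z * adj z))"
    by (simp add: adj_def sum_distrib_left)
  finally show ?thesis .
qed

end

section \<open>The equation with the coefficient \<open>t\<^sup>l\<close>\<close>

theorem theorem1p3:
  fixes l :: real
    and m :: nat
    and \<Omega> :: "((real ^ 'n) \<times> real) set"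
    and a :: "('n \<Rightarrow> nat) \<Rightarrow> real ^ 'n \<Rightarrow> complex"
    and f :: "real ^ 'n \<Rightarrow> real \<Rightarrow> complex"
    and x0 :: "real ^ 'n" and t0 :: real
    and U :: "(real ^ 'n) set"
    and w :: "real ^ 'n \<Rightarrow> real \<Rightarrow> real \<Rightarrow> complex"
  assumes "l > -2"
    and "\<Omega> \<subseteq> closure half_space" and "half_space_domain \<Omega>" and "backward_time_connected \<Omega>"
    and "\<And>\<alpha>. \<alpha> \<in> multi_indices m \<Longrightarrow> smooth_on (fst ` \<Omega>) (a \<alpha>)"
    and "(x0, t0) \<in> \<Omega>" and "t0 > 0"
    and "open U" and "x0 \<in> U" and "U \<times> {0<..<t0} \<subseteq> \<Omega>"
    and "C_m_2_0_on m U (\<phi> l t0) t0 w"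
    and "\<And>b x r. b \<in> {0<..<t0} \<Longrightarrow> x \<in> U \<Longrightarrow> r \<in> {0<..<\<bar>\<phi> l t0 - \<phi> l b\<bar>} \<Longrightarrow>
           (d_r (\<phi> l t0) ^^ 2) w x r b - pdo m a (\<lambda>y. w y r b) x = 0"
    and "\<And>b x. b \<in> {0<..<t0} \<Longrightarrow> x \<in> U \<Longrightarrow> w x 0 b = f x b"
  shows "transform_converges l U (\<phi> l t0) t0 w \<and>
    continuous_on (U \<times> {0..<t0}) (\<lambda>(x, t). sol l w x t) \<and>
    (let W = U \<times> {0<..<t0};
         u = regular_dist W (\<lambda>(x, t). sol l w x t);
         g = (\<lambda>(x, t). source l f (d_r (\<phi> l t0) w) x t)
     in locally_integrable W g \<and>
        (\<forall>\<psi>\<in>test_functions W.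
           dist_deriv (0, 1) (dist_deriv (0, 1) u) \<psi>
           - dist_mult (\<lambda>(x, t). complex_of_real (t powr l)) (dist_pdo m a u) \<psi>
           = regular_dist W g \<psi>)) \<and>
    (\<forall>x\<in>U. sol l w x 0 = 0) \<and>
    (l < 4 \<longrightarrow>
       (\<exists>ut. (\<forall>x\<in>U. \<forall>t\<in>{0..<t0}.
                ((\<lambda>s. sol l w x s) has_vector_derivative ut x t) (at t within {0..<t0})) \<and>
             continuous_on (U \<times> {0..<t0}) (\<lambda>(x, t). ut x t) \<and>
             (\<forall>x\<in>U. ut x 0 = 0)))"
proof -
  interpret wave_transform l t0 U
    using assms(1,7,8) by unfold_locales
  let ?w1 = "d_r (\<phi> l t0) w" and ?w2 = "(d_r (\<phi> l t0) ^^ 2) w"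
  note w = C_m_2_0_data[OF assms(11)]
  interpret wave_data l t0 U w ?w1 ?w2
    by unfold_locales (use w in blast)+
  have f: "f x b = w x 0 b" if "x \<in> U" "b \<in> {0<..<t0}" for x b
    using assms(13) that by simp
  have "U \<subseteq> fst ` \<Omega>"
  proof
    fix x assume "x \<in> U"
    then have "(x, t0 / 2) \<in> \<Omega>" using assms(7,10) by auto
    then show "x \<in> fst ` \<Omega>" by (metis fst_conv image_eqI)
  qed
  then have a: "smooth_on U (a \<alpha>)" if "\<alpha> \<in> multi_indices m" for \<alpha>
    using assms(5)[OF that] unfolding smooth_on_def by (blast intro: Ck_on_subset)
  have Ck: "Ck_on m U (\<lambda>x. w x r b)" if "r \<in> {0..\<phi> l t0}" "b \<in> {0..t0}" for r b
    using assms(11) that unfolding C_m_2_0_on_def by blast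
  have sol_c: "continuous_on (U \<times> {0..<t0}) (\<lambda>(x, t). sol l w x t)"
    by (rule continuous_on_sol[OF w(1)])
  have W: "open W" using U by (simp add: open_Times)
  let ?u = "\<lambda>(x, t). sol l w x t" and ?g = "\<lambda>(x, t). source l f ?w1 x t"
  have sol_W: "continuous_on W ?u"
    using sol_c by (rule continuous_on_subset) auto
  \<comment> \<open>On \<open>W\<close> the right-hand side is the trace of \<open>w\<close> plus the superposition of the \<open>S\<close>.\<close>
  have g: "?g z = w (fst z) 0 (snd z) + (LBINT b:{0..snd z}. S ?w1 (fst z) (snd z) b)" if "z \<in> W" for z
    using that source_eq(2)[OF w(2), of "fst z" "snd z"] f by (auto simp: source_def)
  have "continuous_on W (\<lambda>z. w (fst z) 0 (snd z) + (LBINT b:{0..snd z}. S ?w1 (fst z) (snd z) b))"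
    using continuous_on_source[OF w(2)]
    by (intro continuous_on_add data_slice[OF w(1)] continuous_intros)
      (auto simp: split_beta \<phi>_nonneg[OF l])
  then have g_W: "continuous_on W ?g"
    by (rule continuous_on_eq) (simp only: g)
  have "locally_integrable W ?g"
    unfolding locally_integrable_def set_integrable_def
    by (intro allI impI borel_integrable_compact continuous_on_subset[OF g_W]) auto
  moreover have "dist_deriv (0, 1) (dist_deriv (0, 1) (regular_dist W ?u)) \<psi>
      - dist_mult (\<lambda>(x, t). complex_of_real (t powr l)) (dist_pdo m a (regular_dist W ?u)) \<psi>
      = regular_dist W ?g \<psi>" if \<psi>: "\<psi> \<in> test_functions W" for \<psi>
  proof -
    obtain C where C: "compact C" "C \<subseteq> W" and s: "smooth_on UNIV \<psi>" and z: "\<And>z. z \<notin> C \<Longrightarrow> \<psi> z = 0"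
      using \<psi> unfolding test_functions_def by blast
    let ?e = "(0, 1) :: (real ^ 'n) \<times> real"
    define \<psi>1 where "\<psi>1 = partial_deriv ?e \<psi>"
    define \<psi>2 where "\<psi>2 = partial_deriv ?e \<psi>1"
    define \<Theta> where "\<Theta> z = complex_of_real (snd z powr l) * adj m a \<psi> z" for z
    have e: "?e \<in> Basis" by (simp add: Basis_prod_def)
    have ck: "Ck_on 2 UNIV \<psi>" using s unfolding smooth_on_def by blast
    then have ck1: "Ck_on 1 UNIV \<psi>1" and ck2: "Ck_on 0 UNIV \<psi>2"
      using e by (auto simp: \<psi>1_def \<psi>2_def Ck_on_Suc numeral_2_eq_2)
    have zz: "\<forall>z. z \<notin> C \<longrightarrow> \<psi> z = 0" "\<forall>z. z \<notin> C \<longrightarrow> \<psi>1 z = 0" "\<forall>z. z \<notin> C \<longrightarrow> \<psi>2 z = 0"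
      using partial_derivs_eq_0[of C \<psi> _ "[?e]"] partial_derivs_eq_0[of C \<psi> _ "[?e, ?e]"] z C
      by (auto simp: \<psi>1_def \<psi>2_def partial_derivs_simps compact_imp_closed)
    have c: "continuous_on UNIV \<psi>" "continuous_on UNIV \<psi>1" "continuous_on UNIV \<psi>2"
      using ck ck1 ck2 by (auto intro: Ck_on_imp_continuous)
    have shift: "((\<lambda>t. h (x, t)) has_vector_derivative partial_deriv ?e h (x, t)) (at t)"
      if "Ck_on (Suc k) UNIV h" for h :: "(real ^ 'n) \<times> real \<Rightarrow> complex" and k x t
    proof (rule has_vector_derivative_shift)
      have "(\<lambda>s. h ((x, t) + s *\<^sub>R ?e)) differentiable (at 0)"
        using that e unfolding Ck_on_Suc by blast
      from has_partial_deriv[OF this]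
      show "((\<lambda>s. h (x, t + s)) has_vector_derivative partial_deriv ?e h (x, t)) (at 0)" by simp
    qed
    have d: "((\<lambda>t. \<psi> (x, t)) has_vector_derivative \<psi>1 (x, t)) (at t)"
      "((\<lambda>t. \<psi>1 (x, t)) has_vector_derivative \<psi>2 (x, t)) (at t)" for x t
      using shift[of 1 \<psi>] shift[of 0 \<psi>1] ck ck1 by (simp_all add: \<psi>1_def \<psi>2_def numeral_2_eq_2)
    note adj = adj[OF U a C s z]
    have \<Theta>: "continuous_on UNIV \<Theta>" "\<forall>z. z \<notin> C \<longrightarrow> \<Theta> z = 0"
    proof -
      have "continuous_on W \<Theta>"
        unfolding \<Theta>_def by (intro continuous_intros continuous_on_subset[OF adj(1)]) auto
      then show "continuous_on UNIV \<Theta>"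
        by (rule continuous_on_extend_zero[OF W C]) (simp add: \<Theta>_def adj(2))
    qed (simp add: \<Theta>_def adj(2))
    \<comment> \<open>The equation \<open>w\<^sub>r\<^sub>r = A w\<close> enters here: it holds for \<open>r < \<phi>(t) - \<phi>(b) < \<phi>(t\<^sub>0) - \<phi>(b)\<close>.\<close>
    have adjoint: "(LBINT x. w x r b * \<Theta> (x, t)) = t powr l *\<^sub>R (LBINT x. ?w2 x r b * \<psi> (x, t))"
      if b: "0 < b" "b < t" "t < t0" and r: "r \<in> {0<..<\<phi> l t - \<phi> l b}" for t b r
    proof -
      have p: "0 < \<phi> l b" "\<phi> l b \<le> \<phi> l t" "\<phi> l t < \<phi> l t0" using \<phi>_past[of b t] b by auto
      have "(LBINT x. w x r b * \<Theta> (x, t)) = (LBINT x. complex_of_real (t powr l) * (w x r b * adj m a \<psi> (x, t)))"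
        by (simp add: \<Theta>_def mult.left_commute)
      also have "\<dots> = complex_of_real (t powr l) * (LBINT x. w x r b * adj m a \<psi> (x, t))"
        by (rule integral_mult_right_zero)
      also have "(LBINT x. w x r b * adj m a \<psi> (x, t)) = (LBINT x. pdo m a (\<lambda>x. w x r b) x * \<psi> (x, t))"
        by (rule adj_identity[OF U a C s z]) (use Ck b r p in auto)
      also have "\<dots> = (LBINT x. ?w2 x r b * \<psi> (x, t))"
      proof (rule Bochner_Integration.integral_cong[OF refl])
        fix x
        show "pdo m a (\<lambda>x. w x r b) x * \<psi> (x, t) = ?w2 x r b * \<psi> (x, t)"
        proof (cases "x \<in> U")
          case True
          then show ?thesis using assms(12)[of b x r] b r p by auto
        next
          case False
          then have "\<psi> (x, t) = 0" using z C(2) by blast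
          then show ?thesis by simp
        qed
      qed
      finally show ?thesis by (simp add: scaleR_conv_of_real)
    qed
    have "dist_deriv ?e (dist_deriv ?e (regular_dist W ?u)) \<psi> = (LBINT z:W. ?u z * \<psi>2 z)"
      by (simp add: dist_deriv_def \<psi>1_def \<psi>2_def regular_dist_def)
    moreover have "dist_mult (\<lambda>(x, t). complex_of_real (t powr l)) (dist_pdo m a (regular_dist W ?u)) \<psi> =
        (LBINT z:W. ?u z * \<Theta> z)"
      unfolding \<Theta>_def by (rule dist_pdo_eq[OF U a C s z sol_W])
    moreover have "(LBINT z:W. ?u z * \<psi>2 z) - (LBINT z:W. ?u z * \<Theta> z) = (LBINT z:W. ?u z * (\<psi>2 z - \<Theta> z))"
      unfolding right_diff_distrib
      by (rule set_integral_diff(2)[symmetric]; rule regular_dist_integrable[OF W C sol_W]) (use c zz \<Theta> in auto)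
    moreover have "(LBINT z:W. ?u z * (\<psi>2 z - \<Theta> z)) =
       (LBINT z:W. (w (fst z) 0 (snd z) + (LBINT b:{0..snd z}. S ?w1 (fst z) (snd z) b)) * \<psi> z)"
      unfolding split_beta
      by (rule weak_equation[OF C c(1) zz(1) c(2) zz(2) c(3) zz(3) \<Theta> d adjoint])
    moreover have "\<dots> = (LBINT z:W. ?g z * \<psi> z)"
      by (rule set_lebesgue_integral_cong) (use W g in auto)
    ultimately show ?thesis
      by (simp only: regular_dist_def)
  qed
  moreover have "\<exists>ut. (\<forall>x\<in>U. \<forall>t\<in>{0..<t0}.
                ((\<lambda>s. sol l w x s) has_vector_derivative ut x t) (at t within {0..<t0})) \<and>
             continuous_on (U \<times> {0..<t0}) (\<lambda>(x, t). ut x t) \<and>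
             (\<forall>x\<in>U. ut x 0 = 0)" if "l < 4"
    using has_vector_derivative_sol[OF that] continuous_on_sol_t[OF that] sol_t_0[OF that]
    by (intro exI[of _ sol_t]) auto
  ultimately show ?thesis
    using transform_converges_data[OF w(1,2)] sol_c sol_0 unfolding Let_def by auto
qed

end
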